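(* Let $X$ be a metric space. The hyperspace $\mathrm{Bd}(X)$ is an absolute retract if and only if (i) each bounded subset of $X$ lies in a bounded chain equi-connected subspace of $X$, and (ii) $X$ is uniformly locally chain equi-connected at each bounded subset of $X$.
   Context: For a metric space $(X,d)$, $\mathrm{Bd}(X)$ is the set of all non-empty closed bounded subsets of $X$ with the Hausdorff metric $d_H(A,B)=\max\{\sup_{x\in B}d(x,A),\sup_{x\in A}d(x,B)\}$. A metric space $Y$ is an absolute retract if for each metric space $M$ containing $Y$ isometrically as a closed subset there is a (continuous) retraction $r:M\to Y$. For a metric space $(Y,\rho)$ and $\eta>0$, an $\eta$-chain in $Y$ of length $l$ linking $x$ and $y$ is a sequence $x=x_0,\dots,x_l=y$ of points of $Y$ with $\rho(x_i,x_{i-1})<\eta$ for $1\le i\le l$; its diameter is $\operatorname{diam}\{x_0,\dots,x_l\}$. $Y$ is chain equi-connected if for every $\eta>0$ there is $l\in\mathbb{N}$ such that any $x,y\in Y$ can be linked by an $\eta$-chain in $Y$ of length $\le l$. $Y$ is uniformly locally chain equi-connected at $Y_0\subset Y$ if $\forall\varepsilon>0\ \exists\delta>0\ \forall\eta>0\ \exists l\in\mathbb{N}$ such that any $x,y\in Y_0$ with $\rho(x,y)<\delta$ can be linked by an $\eta$-chain in $Y$ of diameter $<\varepsilon$ and length $\le l$. *)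

theory Defs
  imports "HOL-Analysis.Analysis"
begin

section \<open>The hyperspace of non-empty closed bounded sets\<close>

definition Bd_sets :: "'a::metric_space set set" where
  "Bd_sets = {A. A \<noteq> {} \<and> closed A \<and> bounded A}"

definition hausdorff_dist :: "'a::metric_space set \<Rightarrow> 'a set \<Rightarrow> real" where
  "hausdorff_dist A B = max (SUP x\<in>B. infdist x A) (SUP x\<in>A. infdist x B)"

text \<open>The locale \<^locale>\<open>Metric_space\<close> demands a non-negative distance on the whole type, hence the
  value 0 outside the carrier.\<close>

definition Bd :: "'a::metric_space set metric" where
  "Bd = metric (Bd_sets,
     \<lambda>A B. if A \<in> Bd_sets \<and> B \<in> Bd_sets then hausdorff_dist A B else 0)"

lemma bdd_above_infdist:
  assumes "bounded A" "B \<noteq> {}"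
  shows "bdd_above ((\<lambda>x. infdist x B) ` A)"
proof -
  obtain b where b: "b \<in> B" using assms(2) by blast
  obtain e where e: "\<And>x. x \<in> A \<Longrightarrow> dist b x \<le> e"
    using assms(1) bounded_any_center[of A b] by blast
  have "infdist x B \<le> e" if "x \<in> A" for x
    using infdist_le[OF b, of x] e[OF that] by (simp add: dist_commute)
  then show ?thesis by (auto simp: bdd_above_def)
qed

lemma infdist_le_hausdorff_dist:
  assumes "A \<in> Bd_sets" "B \<in> Bd_sets" "x \<in> A"
  shows "infdist x B \<le> hausdorff_dist A B"
proof -
  have "infdist x B \<le> (SUP x\<in>A. infdist x B)"
    using assms by (intro cSUP_upper bdd_above_infdist) (auto simp: Bd_sets_def)
  then show ?thesis by (simp add: hausdorff_dist_def)
qed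

lemma hausdorff_dist_commute: "hausdorff_dist A B = hausdorff_dist B A"
  by (simp add: hausdorff_dist_def max.commute)

lemma hausdorff_dist_least:
  assumes "A \<noteq> {}" "B \<noteq> {}"
    and "\<And>x. x \<in> A \<Longrightarrow> infdist x B \<le> e" "\<And>x. x \<in> B \<Longrightarrow> infdist x A \<le> e"
  shows "hausdorff_dist A B \<le> e"
  unfolding hausdorff_dist_def using assms by (auto intro!: cSUP_least)

lemma infdist_hausdorff_triangle:
  assumes "A \<in> Bd_sets" "B \<in> Bd_sets" "C \<in> Bd_sets" "x \<in> A"
  shows "infdist x C \<le> hausdorff_dist A B + hausdorff_dist B C"
proof -
  have ne: "B \<noteq> {}" using assms by (simp add: Bd_sets_def)
  have "infdist x C - hausdorff_dist B C \<le> dist x b" if "b \<in> B" for b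
    using infdist_triangle[of x C b] infdist_le_hausdorff_dist[OF assms(2,3) that] by simp
  then have "infdist x C - hausdorff_dist B C \<le> infdist x B"
    unfolding infdist_notempty[OF ne] by (intro cINF_greatest ne)
  then show ?thesis
    using infdist_le_hausdorff_dist[OF assms(1,2,4)] by simp
qed

lemma Metric_space_Bd:
  "Metric_space (Bd_sets :: 'a::metric_space set set)
     (\<lambda>A B. if A \<in> Bd_sets \<and> B \<in> Bd_sets then hausdorff_dist A B else 0)"
proof -
  have nonneg_Bd: "0 \<le> hausdorff_dist A B" if "A \<in> Bd_sets" "B \<in> Bd_sets" for A B :: "'a set"
  proof -
    have "A \<noteq> {}" using that by (simp add: Bd_sets_def)
    then obtain x where "x \<in> A" by blast
    then show ?thesis
      using infdist_le_hausdorff_dist[OF that] infdist_nonneg order_trans by blast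
  qed
  have sub: "A \<subseteq> B" if "A \<in> Bd_sets" "B \<in> Bd_sets" "hausdorff_dist A B = 0" for A B :: "'a set"
  proof
    fix x assume "x \<in> A"
    then have "infdist x B = 0"
      using infdist_le_hausdorff_dist[OF that(1,2)] that(3) infdist_nonneg[of x B] by force
    then show "x \<in> B"
      using that(2) by (simp add: Bd_sets_def in_closed_iff_infdist_zero)
  qed
  have zero: "hausdorff_dist A B = 0 \<longleftrightarrow> A = B"
    if "A \<in> Bd_sets" "B \<in> Bd_sets" for A B :: "'a set"
  proof
    assume "hausdorff_dist A B = 0"
    then show "A = B"
      using sub[OF that] sub[OF that(2,1)] by (simp add: hausdorff_dist_commute)
  next
    assume "A = B"
    then have "hausdorff_dist A B \<le> 0"
      using that by (intro hausdorff_dist_least) (auto simp: Bd_sets_def)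
    then show "hausdorff_dist A B = 0" using nonneg_Bd[OF that] by simp
  qed
  have triangle: "hausdorff_dist A C \<le> hausdorff_dist A B + hausdorff_dist B C"
    if "A \<in> Bd_sets" "B \<in> Bd_sets" "C \<in> Bd_sets" for A B C :: "'a set"
    using that infdist_hausdorff_triangle[OF that]
      infdist_hausdorff_triangle[OF that(3,2,1)]
    by (intro hausdorff_dist_least) (auto simp: Bd_sets_def hausdorff_dist_commute add.commute)
  show ?thesis
    by (rule Metric_space.intro)
      (simp_all add: nonneg_Bd zero triangle hausdorff_dist_commute)
qed

lemma mspace_Bd [simp]: "mspace Bd = Bd_sets"
  unfolding Bd_def by (rule Metric_space.mspace_metric[OF Metric_space_Bd])

lemma mdist_Bd: "A \<in> Bd_sets \<Longrightarrow> B \<in> Bd_sets \<Longrightarrow> mdist Bd A B = hausdorff_dist A B"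
  unfolding Bd_def Metric_space.mdist_metric[OF Metric_space_Bd] by simp

section \<open>Absolute retracts\<close>

text \<open>\<open>M\<close> ranges over the metric spaces whose points have type \<open>'m\<close>; that \<open>M\<close> contains \<open>Y\<close>
  isometrically as a closed subset is expressed by an isometric embedding \<open>f\<close> with closed image.\<close>

definition absolute_retract_among :: "'m itself \<Rightarrow> 'y metric \<Rightarrow> bool" where
  "absolute_retract_among TYPE('m) Y \<longleftrightarrow>
     (\<forall>(M::'m metric) f.
        f \<in> mspace Y \<rightarrow> mspace M \<and>
        (\<forall>x\<in>mspace Y. \<forall>y\<in>mspace Y. mdist M (f x) (f y) = mdist Y x y) \<and>
        closedin (mtopology_of M) (f ` mspace Y)
        \<longrightarrow> f ` mspace Y retract_of_space mtopology_of M)"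

text \<open>Types cannot be quantified inside a formula, so ``for each metric space \<open>M\<close>'' is expressed by
  a type \<open>'m\<close> that is free, hence universally quantified in every theorem that leaves
  it unconstrained. Over a small \<open>'m\<close> alone the condition could hold vacuously, so an implication from
  ``absolute retract'' would be false. The spaces on \<open>'y \<Rightarrow> real\<close> are therefore always included:
  they contain the convex hull, in the sup metric, of the Kuratowski image
  \<open>y \<mapsto> d y - d y\<^sub>0\<close> of \<open>Y\<close>, in which this image is closed; a retraction of that convex hull
  makes \<open>Y\<close> an absolute retract for metric spaces of every type, by Dugundji's extension theorem.\<close>

definition absolute_retract :: "'m itself \<Rightarrow> 'y metric \<Rightarrow> bool" where
  "absolute_retract TYPE('m) Y \<longleftrightarrow>
     absolute_retract_among TYPE('m) Y \<and> absolute_retract_among TYPE('y \<Rightarrow> real) Y"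

section \<open>Chains\<close>

definition eta_chain ::
    "'a::metric_space set \<Rightarrow> real \<Rightarrow> nat \<Rightarrow> 'a \<Rightarrow> 'a \<Rightarrow> (nat \<Rightarrow> 'a) \<Rightarrow> bool" where
  "eta_chain Y \<eta> l x y c \<longleftrightarrow>
     c 0 = x \<and> c l = y \<and> (\<forall>i\<le>l. c i \<in> Y) \<and> (\<forall>i\<in>{1..l}. dist (c i) (c (i - 1)) < \<eta>)"

definition chain_equi_connected :: "'a::metric_space set \<Rightarrow> bool" where
  "chain_equi_connected Y \<longleftrightarrow>
     (\<forall>\<eta>>0. \<exists>l. \<forall>x\<in>Y. \<forall>y\<in>Y. \<exists>k\<le>l. \<exists>c. eta_chain Y \<eta> k x y c)"

definition unif_locally_chain_equi_connected_at ::
    "'a::metric_space set \<Rightarrow> 'a set \<Rightarrow> bool" where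
  "unif_locally_chain_equi_connected_at Y Y0 \<longleftrightarrow>
     (\<forall>\<epsilon>>0. \<exists>\<delta>>0. \<forall>\<eta>>0. \<exists>l. \<forall>x\<in>Y0. \<forall>y\<in>Y0. dist x y < \<delta> \<longrightarrow>
        (\<exists>k\<le>l. \<exists>c. eta_chain Y \<eta> k x y c \<and> diameter (c ` {..k}) < \<epsilon>))"

end

theory Submission
  imports Defs "HOL-Library.Ramsey" "HOL-Library.Diagonal_Subsequence"
begin

text \<open>
  From an absolute retract to chains. The Kuratowski embedding puts the hyperspace into the space of
  all segments between its image points, and it is closed there (\<open>closedin_kuratowski\<close>). A
  retraction turns the segments into paths of sets, and by continuity a path from \<open>A\<close> to a set close to
  \<open>A\<close> stays close to \<open>A\<close> (\<open>absolute_retract_imp_paths\<close>). A point of one set of a path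
  can be followed along the path: cut the path into finitely many pieces of Hausdorff length less
  than \<open>\<eta>\<close> and pick successive nearby points. The number of pieces depends on the path
  and on \<open>\<eta>\<close> only, and this is where all uniform bounds on lengths of chains come from. Condition
  (i) follows at once: the union of a path from a single point to the closure of \<open>S\<close> is bounded and
  chain equi-connected.

  Condition (ii) is harder, because the paths are controlled only near one fixed set \<open>A\<close>, whereas (ii)
  is uniform over all points of a bounded set. If (ii) fails, there are arbitrarily close pairs of points
  that need arbitrarily long chains. One collects enough of them near one set \<open>A\<close>. By Ramsey's theorem the
  pairs can be chosen separated or clustered. If they are separated, \<open>A\<close> is a separated set, and
  short steps near \<open>A\<close> cannot jump from one point of \<open>A\<close> to another, so points near \<open>a \<in> A\<close> are
  chained to \<open>a\<close> itself (\<open>absolute_retract_imp_separated_linking\<close>). If they form shrinking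
  clusters, the centres contain a separated sequence, which is the case just treated, or a Cauchy sequence. A
  Cauchy sequence may have no limit in the space, and points near it may lie on different sides of the
  missing limit; but it has finite nets, and the pigeonhole principle finds infinitely many terms on the
  same side (\<open>absolute_retract_imp_Cauchy_linking\<close>).

  From chains to an absolute retract. Condition (i) gives a chain from \<open>a\<close> to \<open>b\<close>, and condition (ii)
  refines it again and again, each time with a number of new points that does not depend on \<open>a\<close> and \<open>b\<close>.
  Counting time proportionally to the number of steps yields a path without its limit points: a set of
  pairs (point, time), here called a trail, whose modulus of continuity is uniform for \<open>a\<close> and \<open>b\<close>
  in a bounded set (\<open>trail_system_exists\<close>). Such trails let one grow sets continuously, and union
  of growing sets is all that is needed to interpolate in the hyperspace. Given a metric space \<open>M\<close> around the
  hyperspace and a point \<open>m\<close> outside it at distance \<open>D\<close>, take all sets \<open>A\<close> at distance less than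
  \<open>3 D\<close> from \<open>m\<close> as sources, all sets \<open>B\<close> at distance less than \<open>4 D\<close> as targets, and follow the trails
  from \<open>A\<close> to \<open>B\<close> for a time that fades out as \<open>A\<close> or \<open>B\<close> becomes too distant. A source that is
  about to disappear contributes only points near itself, and these remain covered, because it is still a
  full target for the sources nearest to \<open>m\<close>. Hence the closure of the union of these trails
  depends continuously on \<open>m\<close> (\<open>cloud_approx\<close>), and it converges to \<open>A\<close> as \<open>m\<close> tends to \<open>A\<close>
  because trails between close points are small. All sets of the hyperspace are
  used at once, since the estimates are uniform over them.
\<close>

section \<open>The Hausdorff distance\<close>

lemma Bd_sets_nonempty: "A \<in> Bd_sets \<Longrightarrow> A \<noteq> {}"
  and Bd_sets_bounded: "A \<in> Bd_sets \<Longrightarrow> bounded A"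
  by (simp_all add: Bd_sets_def)

lemma singleton_in_Bd_sets: "{x} \<in> Bd_sets"
  by (simp add: Bd_sets_def)

lemma closure_in_Bd_sets: "S \<noteq> {} \<Longrightarrow> bounded S \<Longrightarrow> closure S \<in> Bd_sets"
  by (simp add: Bd_sets_def bounded_closure)

lemma hausdorff_dist_nonneg: "A \<in> Bd_sets \<Longrightarrow> B \<in> Bd_sets \<Longrightarrow> 0 \<le> hausdorff_dist A B"
  using Metric_space.nonneg[OF Metric_space_Bd, of A B] by simp

lemma hausdorff_dist_eq_0: "A \<in> Bd_sets \<Longrightarrow> B \<in> Bd_sets \<Longrightarrow> hausdorff_dist A B = 0 \<longleftrightarrow> A = B"
  using Metric_space.zero[OF Metric_space_Bd, of A B] by simp

lemma hausdorff_dist_self: "A \<in> Bd_sets \<Longrightarrow> hausdorff_dist A A = 0"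
  by (simp add: hausdorff_dist_eq_0)

lemma hausdorff_dist_triangle:
  assumes "A \<in> Bd_sets" "B \<in> Bd_sets" "C \<in> Bd_sets"
  shows "hausdorff_dist A C \<le> hausdorff_dist A B + hausdorff_dist B C"
  using Metric_space.triangle[OF Metric_space_Bd assms] assms by simp

text \<open>
  The distance to a set is an infimum that need not be attained, hence the strict bound.
\<close>

lemma hausdorff_dist_near:
  assumes "A \<in> Bd_sets" "B \<in> Bd_sets" "hausdorff_dist A B < e" "a \<in> A"
  obtains b where "b \<in> B" "dist a b < e"
proof -
  have "infdist a B < e"
    using infdist_le_hausdorff_dist[OF assms(1,2,4)] assms(3) by simp
  then have "(INF b\<in>B. dist a b) < e"
    using Bd_sets_nonempty[OF assms(2)] by (simp add: infdist_notempty)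
  moreover have "bdd_below (dist a ` B)"
    by (rule bdd_belowI2[where m = 0]) simp
  ultimately show ?thesis
    using that Bd_sets_nonempty[OF assms(2)] by (auto simp: cINF_less_iff)
qed

text \<open>
  Sets are built below as closures of unions of explicit points; this bound and the next one reduce
  their Hausdorff distance to the points themselves.
\<close>

lemma infdist_closure_le:
  assumes "x \<in> closure P" "\<And>p. p \<in> P \<Longrightarrow> \<exists>q\<in>Q. dist p q \<le> e"
  shows "infdist x (closure Q) \<le> e"
proof (rule field_le_epsilon)
  fix d :: real assume "d > 0"
  then obtain p where p: "p \<in> P" "dist p x < d"
    using assms(1) by (auto simp: closure_approachable)
  obtain q where "q \<in> Q" "dist p q \<le> e"
    using assms(2)[OF p(1)] by blast
  then have "infdist p (closure Q) \<le> e"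
    using infdist_le2 closure_subset by blast
  then show "infdist x (closure Q) \<le> e + d"
    using infdist_triangle[of x "closure Q" p] p(2) by (simp add: dist_commute)
qed

lemma hausdorff_dist_closure_le:
  assumes "P \<noteq> {}" "Q \<noteq> {}"
    and "\<And>p. p \<in> P \<Longrightarrow> \<exists>q\<in>Q. dist p q \<le> e" "\<And>q. q \<in> Q \<Longrightarrow> \<exists>p\<in>P. dist q p \<le> e"
  shows "hausdorff_dist (closure P) (closure Q) \<le> e"
proof (rule hausdorff_dist_least)
  show "infdist x (closure Q) \<le> e" if "x \<in> closure P" for x
    using that assms(3) by (rule infdist_closure_le)
  show "infdist x (closure P) \<le> e" if "x \<in> closure Q" for x
    using that assms(4) by (rule infdist_closure_le)
qed (use assms(1,2) in simp_all)

section \<open>Chains\<close>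

text \<open>
  A bound on the length instead of the exact length makes the relation monotone in all its
  parameters, and chains can be reversed and concatenated without bookkeeping.
\<close>

definition linked :: "'a::metric_space set \<Rightarrow> real \<Rightarrow> nat \<Rightarrow> 'a \<Rightarrow> 'a \<Rightarrow> bool" where
  "linked Z \<eta> l x y \<longleftrightarrow> (\<exists>k\<le>l. \<exists>c. eta_chain Z \<eta> k x y c)"

text \<open>
  Steps counted from \<open>0\<close> suit inductions along a chain.
\<close>

lemma eta_chain_alt:
  "eta_chain Z \<eta> k x y c \<longleftrightarrow>
    c 0 = x \<and> c k = y \<and> (\<forall>i\<le>k. c i \<in> Z) \<and> (\<forall>i<k. dist (c i) (c (Suc i)) < \<eta>)"
proof -
  have "(\<forall>i\<in>{1..k}. dist (c i) (c (i - 1)) < \<eta>) \<longleftrightarrow> (\<forall>i<k. dist (c i) (c (Suc i)) < \<eta>)"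
  proof (intro iffI allI impI ballI)
    fix i assume *: "\<forall>i\<in>{1..k}. dist (c i) (c (i - 1)) < \<eta>" and "i < k"
    then show "dist (c i) (c (Suc i)) < \<eta>"
      using *[rule_format, of "Suc i"] by (simp add: dist_commute)
  next
    fix i assume *: "\<forall>i<k. dist (c i) (c (Suc i)) < \<eta>" and "i \<in> {1..k}"
    then obtain j where "i = Suc j" "j < k" by (cases i) auto
    then show "dist (c i) (c (i - 1)) < \<eta>"
      using * by (simp add: dist_commute)
  qed
  then show ?thesis by (simp add: eta_chain_def)
qed

lemma linkedI:
  assumes "c 0 = x" "c k = y" "\<And>i. i \<le> k \<Longrightarrow> c i \<in> Z" "\<And>i. i < k \<Longrightarrow> dist (c i) (c (Suc i)) < \<eta>"
    and "k \<le> l"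
  shows "linked Z \<eta> l x y"
  unfolding linked_def eta_chain_alt using assms by blast

lemma linkedE:
  assumes "linked Z \<eta> l x y"
  obtains k c where "k \<le> l" "c 0 = x" "c k = y" "\<And>i. i \<le> k \<Longrightarrow> c i \<in> Z"
    "\<And>i. i < k \<Longrightarrow> dist (c i) (c (Suc i)) < \<eta>"
  using assms unfolding linked_def eta_chain_alt by blast

lemma linked_step: "x \<in> Z \<Longrightarrow> y \<in> Z \<Longrightarrow> dist x y < \<eta> \<Longrightarrow> linked Z \<eta> 1 x y"
  by (rule linkedI[where c = "\<lambda>i. if i = 0 then x else y" and k = 1]) auto

lemma linked_mono:
  assumes "linked Z \<eta> l x y" "Z \<subseteq> Z'" "\<eta> \<le> \<eta>'" "l \<le> l'"
  shows "linked Z' \<eta>' l' x y"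
proof -
  obtain k c where "k \<le> l" "c 0 = x" "c k = y" and c: "\<And>i. i \<le> k \<Longrightarrow> c i \<in> Z"
    "\<And>i. i < k \<Longrightarrow> dist (c i) (c (Suc i)) < \<eta>"
    using assms(1) by (rule linkedE) blast
  moreover have "c i \<in> Z'" if "i \<le> k" for i using c(1)[OF that] assms(2) by blast
  moreover have "dist (c i) (c (Suc i)) < \<eta>'" if "i < k" for i
    using c(2)[OF that] assms(3) by linarith
  ultimately show ?thesis using assms(4) by (intro linkedI[where c = c and k = k]) auto
qed

lemma linked_sym:
  assumes "linked Z \<eta> l x y"
  shows "linked Z \<eta> l y x"
proof -
  obtain k c where kc: "k \<le> l" "c 0 = x" "c k = y" and c: "\<And>i. i \<le> k \<Longrightarrow> c i \<in> Z"
    "\<And>i. i < k \<Longrightarrow> dist (c i) (c (Suc i)) < \<eta>"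
    using assms by (rule linkedE) blast
  have "dist (c (k - i)) (c (k - Suc i)) < \<eta>" if "i < k" for i
    using c(2)[of "k - Suc i"] that by (simp add: dist_commute Suc_diff_Suc)
  then show ?thesis
    using kc c(1) by (intro linkedI[where c = "\<lambda>i. c (k - i)" and k = k]) auto
qed

lemma linked_trans:
  assumes "linked Z \<eta> l x y" "linked Z \<eta> m y z"
  shows "linked Z \<eta> (l + m) x z"
proof -
  obtain k c where kc: "k \<le> l" "c 0 = x" "c k = y" and c: "\<And>i. i \<le> k \<Longrightarrow> c i \<in> Z"
    "\<And>i. i < k \<Longrightarrow> dist (c i) (c (Suc i)) < \<eta>"
    using assms(1) by (rule linkedE) blast
  obtain j d where jd: "j \<le> m" "d 0 = y" "d j = z" and d: "\<And>i. i \<le> j \<Longrightarrow> d i \<in> Z"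
    "\<And>i. i < j \<Longrightarrow> dist (d i) (d (Suc i)) < \<eta>"
    using assms(2) by (rule linkedE) blast
  let ?e = "\<lambda>i. if i \<le> k then c i else d (i - k)"
  have "dist (?e i) (?e (Suc i)) < \<eta>" if "i < k + j" for i
  proof (cases i k rule: linorder_cases)
    case equal then show ?thesis using kc jd d(2)[of 0] that by simp
  next
    case greater then show ?thesis using d(2)[of "i - k"] that by (simp add: Suc_diff_le)
  qed (use c(2) in auto)
  then show ?thesis
    using kc jd c(1) d(1) by (intro linkedI[where c = ?e and k = "k + j"]) auto
qed

lemma chain_equi_connected_iff_linked:
  "chain_equi_connected Y \<longleftrightarrow> (\<forall>\<eta>>0. \<exists>l. \<forall>x\<in>Y. \<forall>y\<in>Y. linked Y \<eta> l x y)"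
  unfolding chain_equi_connected_def linked_def by blast

text \<open>
  Small balls replace small diameters, at the price of a constant factor in the choice of the radius: a
  ball of radius \<open>\<epsilon>/3\<close> contains only sets of diameter less than \<open>\<epsilon>\<close>.
\<close>

lemma unif_locally_chain_equi_connected_atI:
  fixes S :: "'a::metric_space set"
  assumes "\<And>\<epsilon>. \<epsilon> > 0 \<Longrightarrow> \<exists>\<delta>>0. \<forall>\<eta>>0. \<exists>l. \<forall>x\<in>S. \<forall>y\<in>S. dist x y < \<delta> \<longrightarrow>
    (\<exists>p. linked (ball p \<epsilon>) \<eta> l x y)"
  shows "unif_locally_chain_equi_connected_at (UNIV :: 'a set) S"
  unfolding unif_locally_chain_equi_connected_at_def
proof (intro allI impI)
  fix \<epsilon> :: real assume "\<epsilon> > 0"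
  have "\<exists>k\<le>l. \<exists>c. eta_chain UNIV \<eta> k x y c \<and> diameter (c ` {..k}) < \<epsilon>"
    if link: "linked (ball p (\<epsilon>/3)) \<eta> l x y" for \<eta> l p and x y :: 'a
  proof -
    obtain k c where "k \<le> l" "c 0 = x" "c k = y" and c: "\<And>i. i \<le> k \<Longrightarrow> c i \<in> ball p (\<epsilon>/3)"
      "\<And>i. i < k \<Longrightarrow> dist (c i) (c (Suc i)) < \<eta>"
      using link by (rule linkedE) blast
    moreover have "diameter (c ` {..k}) \<le> 2 * \<epsilon> / 3"
    proof -
      have "dist u v \<le> 2 * \<epsilon> / 3" if "u \<in> c ` {..k}" "v \<in> c ` {..k}" for u v
      proof -
        have "dist p u < \<epsilon>/3" "dist p v < \<epsilon>/3" using that c(1) by auto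
        then show ?thesis using dist_triangle3[of u v p] by simp
      qed
      then have "(SUP (u, v) \<in> c ` {..k} \<times> c ` {..k}. dist u v) \<le> 2 * \<epsilon> / 3"
        by (intro cSUP_least) auto
      then show ?thesis by (simp add: diameter_def)
    qed
    ultimately show ?thesis
      using \<open>\<epsilon> > 0\<close> unfolding eta_chain_alt by (intro exI[of _ k] conjI exI[of _ c]) auto
  qed
  note ball_chain = this
  obtain \<delta> where "\<delta> > 0" and \<delta>: "\<forall>\<eta>>0. \<exists>l. \<forall>x\<in>S. \<forall>y\<in>S. dist x y < \<delta> \<longrightarrow>
      (\<exists>p. linked (ball p (\<epsilon>/3)) \<eta> l x y)"
    using assms[of "\<epsilon>/3"] \<open>\<epsilon> > 0\<close> by auto
  show "\<exists>\<delta>>0. \<forall>\<eta>>0. \<exists>l. \<forall>x\<in>S. \<forall>y\<in>S. dist x y < \<delta> \<longrightarrow>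
      (\<exists>k\<le>l. \<exists>c. eta_chain (UNIV :: 'a set) \<eta> k x y c \<and> diameter (c ` {..k}) < \<epsilon>)"
  proof (intro exI[of _ \<delta>] conjI allI impI)
    fix \<eta> :: real assume "\<eta> > 0"
    then obtain l where "\<forall>x\<in>S. \<forall>y\<in>S. dist x y < \<delta> \<longrightarrow> (\<exists>p. linked (ball p (\<epsilon>/3)) \<eta> l x y)"
      using \<delta> by blast
    then show "\<exists>l. \<forall>x\<in>S. \<forall>y\<in>S. dist x y < \<delta> \<longrightarrow>
      (\<exists>k\<le>l. \<exists>c. eta_chain (UNIV :: 'a set) \<eta> k x y c \<and> diameter (c ` {..k}) < \<epsilon>)"
      using ball_chain by blast
  qed fact
qed

lemma unif_locally_chain_equi_connected_atD:
  fixes S :: "'a::metric_space set"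
  assumes "unif_locally_chain_equi_connected_at (UNIV :: 'a set) S" "\<epsilon> > 0"
  obtains \<delta> where "\<delta> > 0" "\<And>\<eta>. \<eta> > 0 \<Longrightarrow> \<exists>l. \<forall>x\<in>S. \<forall>y\<in>S. dist x y < \<delta> \<longrightarrow> linked (ball x \<epsilon>) \<eta> l x y"
proof -
  have "linked (ball x \<epsilon>) \<eta> l x y"
    if "k \<le> l" "eta_chain UNIV \<eta> k x y c" "diameter (c ` {..k}) < \<epsilon>" for k l c \<eta> and x y :: 'a
  proof -
    have "dist (c 0) (c i) < \<epsilon>" if "i \<le> k" for i
    proof -
      have "dist (c 0) (c i) \<le> diameter (c ` {..k})"
        using that by (intro diameter_bounded_bound finite_imp_bounded) auto
      then show ?thesis using \<open>diameter (c ` {..k}) < \<epsilon>\<close> by simp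
    qed
    then show ?thesis
      using that(1,2) unfolding eta_chain_alt by (intro linkedI[where c = c and k = k]) auto
  qed
  note ball_linked = this
  obtain \<delta> where "\<delta> > 0" and \<delta>: "\<forall>\<eta>>0. \<exists>l. \<forall>x\<in>S. \<forall>y\<in>S. dist x y < \<delta> \<longrightarrow>
      (\<exists>k\<le>l. \<exists>c. eta_chain (UNIV :: 'a set) \<eta> k x y c \<and> diameter (c ` {..k}) < \<epsilon>)"
    using assms unfolding unif_locally_chain_equi_connected_at_def by blast
  show ?thesis
  proof (rule that[OF \<open>\<delta> > 0\<close>])
    fix \<eta> :: real assume "\<eta> > 0"
    then obtain l where "\<forall>x\<in>S. \<forall>y\<in>S. dist x y < \<delta> \<longrightarrow>
      (\<exists>k\<le>l. \<exists>c. eta_chain (UNIV :: 'a set) \<eta> k x y c \<and> diameter (c ` {..k}) < \<epsilon>)"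
      using \<delta> by blast
    then show "\<exists>l. \<forall>x\<in>S. \<forall>y\<in>S. dist x y < \<delta> \<longrightarrow> linked (ball x \<epsilon>) \<eta> l x y"
      using ball_linked by blast
  qed
qed

section \<open>Paths in an absolute retract hyperspace\<close>

text \<open>
  The Kuratowski embedding: a set is mapped to its distance function. Subtracting the distance to a base
  point keeps this function bounded.
\<close>

definition kuratowski :: "'a::metric_space set \<Rightarrow> 'a set \<Rightarrow> real" where
  "kuratowski A = (\<lambda>C. if C \<in> Bd_sets then hausdorff_dist A C - hausdorff_dist {undefined} C else 0)"

definition segment_point :: "'a::metric_space set \<Rightarrow> 'a set \<Rightarrow> real \<Rightarrow> 'a set \<Rightarrow> real" where
  "segment_point A B t = (\<lambda>C. (1 - t) * kuratowski A C + t * kuratowski B C)"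

text \<open>
  Only segments between two image points are added to the image, not its whole convex hull: segments
  suffice to obtain paths, and each of their points is determined by two sets and a parameter.
\<close>

definition segment_space :: "('a::metric_space set \<Rightarrow> real) set" where
  "segment_space = {segment_point A B t | A B t. A \<in> Bd_sets \<and> B \<in> Bd_sets \<and> 0 \<le> t \<and> t \<le> 1}"

definition sup_dist :: "('a::metric_space set \<Rightarrow> real) \<Rightarrow> ('a set \<Rightarrow> real) \<Rightarrow> real" where
  "sup_dist g h = (if g \<in> segment_space \<and> h \<in> segment_space then SUP C. \<bar>g C - h C\<bar> else 0)"

lemma segment_point_in: "A \<in> Bd_sets \<Longrightarrow> B \<in> Bd_sets \<Longrightarrow> 0 \<le> t \<Longrightarrow> t \<le> 1 \<Longrightarrow> segment_point A B t \<in> segment_space"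
  unfolding segment_space_def by blast

lemma segment_point_0 [simp]: "segment_point A B 0 = kuratowski A"
  and segment_point_1 [simp]: "segment_point A B 1 = kuratowski B"
  and segment_point_same: "segment_point A A t = kuratowski A"
  by (auto simp: segment_point_def algebra_simps)

lemma kuratowski_in: "A \<in> Bd_sets \<Longrightarrow> kuratowski A \<in> segment_space"
  using segment_point_in[of A A 0] by simp

lemma kuratowski_diff_le:
  assumes "A \<in> Bd_sets" "B \<in> Bd_sets"
  shows "\<bar>kuratowski A C - kuratowski B C\<bar> \<le> hausdorff_dist A B"
proof (cases "C \<in> Bd_sets")
  case True
  then show ?thesis
    using hausdorff_dist_triangle[of A B C] hausdorff_dist_triangle[of B A C] assms
    by (simp add: kuratowski_def hausdorff_dist_commute)
qed (use assms hausdorff_dist_nonneg in \<open>simp add: kuratowski_def\<close>)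

lemma bounded_segment_space:
  assumes "g \<in> segment_space"
  obtains K where "\<And>C. \<bar>g C\<bar> \<le> K"
proof -
  obtain A B t where g: "g = segment_point A B t" "A \<in> Bd_sets" "B \<in> Bd_sets" "0 \<le> t" "t \<le> 1"
    using assms unfolding segment_space_def by blast
  let ?H = "\<lambda>A. hausdorff_dist A {undefined}"
  have k: "\<bar>kuratowski A C\<bar> \<le> ?H A" if "A \<in> Bd_sets" for A C
  proof -
    have "kuratowski {undefined} C = 0" by (simp add: kuratowski_def)
    then show ?thesis
      using kuratowski_diff_le[OF that singleton_in_Bd_sets[of undefined], of C] by simp
  qed
  have "\<bar>g C\<bar> \<le> ?H A + ?H B" for C
  proof -
    have "\<bar>g C\<bar> \<le> (1 - t) * \<bar>kuratowski A C\<bar> + t * \<bar>kuratowski B C\<bar>"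
      using g(4,5) abs_triangle_ineq[of "(1 - t) * kuratowski A C" "t * kuratowski B C"]
      by (simp add: g(1) segment_point_def abs_mult)
    also have "\<dots> \<le> 1 * \<bar>kuratowski A C\<bar> + 1 * \<bar>kuratowski B C\<bar>"
      using g(4,5) by (intro add_mono mult_right_mono) auto
    finally show ?thesis using k[OF g(2), of C] k[OF g(3), of C] by linarith
  qed
  then show ?thesis by (rule that)
qed

lemma abs_diff_le_sup_dist:
  assumes "g \<in> segment_space" "h \<in> segment_space"
  shows "\<bar>g C - h C\<bar> \<le> sup_dist g h"
proof -
  obtain K where K: "\<And>C. \<bar>g C\<bar> \<le> K" by (rule bounded_segment_space[OF assms(1)]) blast
  obtain L where L: "\<And>C. \<bar>h C\<bar> \<le> L" by (rule bounded_segment_space[OF assms(2)]) blast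
  have "\<bar>g C - h C\<bar> \<le> K + L" for C
    using K[of C] L[of C] by linarith
  then have "bdd_above (range (\<lambda>C. \<bar>g C - h C\<bar>))"
    by (intro bdd_aboveI2)
  then have "\<bar>g C - h C\<bar> \<le> (SUP C. \<bar>g C - h C\<bar>)"
    by (rule cSUP_upper[OF UNIV_I])
  then show ?thesis
    using assms by (simp add: sup_dist_def)
qed

lemma sup_dist_le:
  assumes "g \<in> segment_space" "h \<in> segment_space" "\<And>C. \<bar>g C - h C\<bar> \<le> e"
  shows "sup_dist g h \<le> e"
  using assms by (simp add: sup_dist_def cSUP_least)

lemma Metric_space_segment_space: "Metric_space segment_space sup_dist"
proof
  fix g h :: "'a set \<Rightarrow> real"
  show "0 \<le> sup_dist g h"
  proof (cases "g \<in> segment_space \<and> h \<in> segment_space")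
    case True
    then show ?thesis using abs_diff_le_sup_dist[of g h undefined] by linarith
  qed (auto simp: sup_dist_def)
  have "\<bar>g C - h C\<bar> = \<bar>h C - g C\<bar>" for C by (rule abs_minus_commute)
  then show "sup_dist g h = sup_dist h g"
    by (auto simp: sup_dist_def)
next
  fix g h :: "'a set \<Rightarrow> real" assume gh: "g \<in> segment_space" "h \<in> segment_space"
  show "sup_dist g h = 0 \<longleftrightarrow> g = h"
  proof
    assume "sup_dist g h = 0"
    then have "\<bar>g C - h C\<bar> \<le> 0" for C
      using abs_diff_le_sup_dist[OF gh] by metis
    then show "g = h" by (auto simp: fun_eq_iff)
  qed (simp add: gh sup_dist_def)
next
  fix g h k :: "'a set \<Rightarrow> real"
  assume ghk: "g \<in> segment_space" "h \<in> segment_space" "k \<in> segment_space"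
  show "sup_dist g k \<le> sup_dist g h + sup_dist h k"
  proof (rule sup_dist_le[OF ghk(1,3)])
    fix C
    show "\<bar>g C - k C\<bar> \<le> sup_dist g h + sup_dist h k"
      using abs_diff_le_sup_dist[OF ghk(1,2), of C] abs_diff_le_sup_dist[OF ghk(2,3), of C] by linarith
  qed
qed

text \<open>
  The triangle inequality gives one estimate; evaluation at \<open>B\<close>, where the distance to \<open>B\<close> vanishes,
  gives the other.
\<close>

lemma kuratowski_isometry:
  assumes "A \<in> Bd_sets" "B \<in> Bd_sets"
  shows "sup_dist (kuratowski A) (kuratowski B) = hausdorff_dist A B"
proof (rule antisym)
  show "sup_dist (kuratowski A) (kuratowski B) \<le> hausdorff_dist A B"
    using assms by (intro sup_dist_le kuratowski_in kuratowski_diff_le)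
  have "\<bar>kuratowski A B - kuratowski B B\<bar> = hausdorff_dist A B"
    using assms hausdorff_dist_nonneg[OF assms] by (simp add: kuratowski_def hausdorff_dist_self)
  then show "hausdorff_dist A B \<le> sup_dist (kuratowski A) (kuratowski B)"
    using abs_diff_le_sup_dist[OF kuratowski_in kuratowski_in, OF assms, of B] by simp
qed

lemma sup_dist_segment_point:
  assumes "A \<in> Bd_sets" "B \<in> Bd_sets" "0 \<le> s" "s \<le> 1" "0 \<le> t" "t \<le> 1"
  shows "sup_dist (segment_point A B s) (segment_point A B t) \<le> \<bar>s - t\<bar> * hausdorff_dist A B"
proof (intro sup_dist_le segment_point_in assms)
  fix C
  have "segment_point A B s C - segment_point A B t C = (s - t) * (kuratowski B C - kuratowski A C)"
    by (simp add: segment_point_def algebra_simps)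
  then show "\<bar>segment_point A B s C - segment_point A B t C\<bar> \<le> \<bar>s - t\<bar> * hausdorff_dist A B"
    using kuratowski_diff_le[OF assms(1,2), of C] abs_minus_commute[of "kuratowski A C"]
    by (simp add: abs_mult mult_left_mono)
qed

text \<open>
  Evaluation at \<open>C\<close> again: the value at \<open>C\<close> of a point of a segment, relative to that of \<open>C\<close>,
  is the weighted mean of the distances from \<open>C\<close> to the end points.
\<close>

lemma sup_dist_segment_kuratowski:
  assumes "A \<in> Bd_sets" "B \<in> Bd_sets" "C \<in> Bd_sets" "0 \<le> t" "t \<le> 1"
  shows "(1 - t) * hausdorff_dist A C + t * hausdorff_dist B C
    \<le> sup_dist (segment_point A B t) (kuratowski C)"
proof -
  have "segment_point A B t C - kuratowski C C = (1 - t) * hausdorff_dist A C + t * hausdorff_dist B C"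
    using assms(3) by (simp add: segment_point_def kuratowski_def hausdorff_dist_self algebra_simps)
  then show ?thesis
    using abs_diff_le_sup_dist[OF segment_point_in[OF assms(1,2,4,5)] kuratowski_in[OF assms(3)], of C]
    by linarith
qed

text \<open>
  An inner point of a nondegenerate segment from \<open>A\<close> to \<open>B\<close> cannot be approximated by images of sets
  \<open>C\<close>, since by the previous estimate \<open>C\<close> would have to be close to \<open>A\<close> and to \<open>B\<close>.
\<close>

lemma closedin_kuratowski:
  "closedin (Metric_space.mtopology segment_space sup_dist) (kuratowski ` (Bd_sets :: 'a::metric_space set set))"
proof -
  interpret S: Metric_space "segment_space :: ('a set \<Rightarrow> real) set" sup_dist
    by (rule Metric_space_segment_space)
  have "\<exists>r>0. disjnt (kuratowski ` Bd_sets) (S.mball g r)"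
    if g: "g \<in> segment_space" "g \<notin> kuratowski ` Bd_sets" for g :: "'a set \<Rightarrow> real"
  proof -
    obtain A B t where AB: "g = segment_point A B t" "A \<in> Bd_sets" "B \<in> Bd_sets" "0 \<le> t" "t \<le> 1"
      using g(1) unfolding segment_space_def by blast
    define \<kappa> where "\<kappa> = min t (1 - t)"
    have "A \<noteq> B" "t \<noteq> 0" "t \<noteq> 1"
      using g(2) AB by (auto simp: segment_point_same)
    then have pos: "0 < hausdorff_dist A B" "0 < \<kappa>"
      using AB hausdorff_dist_eq_0[of A B] hausdorff_dist_nonneg[of A B] unfolding \<kappa>_def by auto
    have "\<kappa> * hausdorff_dist A B \<le> sup_dist g (kuratowski C)" if C: "C \<in> Bd_sets" for C
    proof -
      have "\<kappa> * hausdorff_dist A B \<le> \<kappa> * (hausdorff_dist A C + hausdorff_dist B C)"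
        using pos(2) hausdorff_dist_triangle[OF AB(2) C AB(3)]
        by (intro mult_left_mono) (auto simp: hausdorff_dist_commute)
      also have "\<dots> \<le> (1 - t) * hausdorff_dist A C + t * hausdorff_dist B C"
        unfolding distrib_left \<kappa>_def
        using AB hausdorff_dist_nonneg[OF AB(2) C] hausdorff_dist_nonneg[OF AB(3) C]
        by (intro add_mono mult_right_mono) auto
      also have "\<dots> \<le> sup_dist g (kuratowski C)"
        unfolding AB(1) by (rule sup_dist_segment_kuratowski[OF AB(2,3) C AB(4,5)])
      finally show ?thesis .
    qed
    then have "disjnt (kuratowski ` Bd_sets) (S.mball g (\<kappa> * hausdorff_dist A B))"
      unfolding disjnt_def by (fastforce simp: S.in_mball)
    then show ?thesis using pos by (intro exI[of _ "\<kappa> * hausdorff_dist A B"]) simp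
  qed
  then show ?thesis
    unfolding S.closedin_metric using kuratowski_in by blast
qed

text \<open>
  The segment space is one of the test spaces for an absolute retract; the retraction is composed
  with the inverse of the embedding, and its continuity is spelled out with \<open>\<epsilon>\<close> and \<open>\<delta>\<close>.
\<close>

lemma absolute_retract_imp_retraction:
  assumes "absolute_retract_among TYPE('a::metric_space set \<Rightarrow> real) (Bd :: 'a::metric_space set metric)"
  obtains r :: "('a::metric_space set \<Rightarrow> real) \<Rightarrow> 'a set" where
    "\<And>g. g \<in> segment_space \<Longrightarrow> r g \<in> Bd_sets"
    "\<And>A. A \<in> Bd_sets \<Longrightarrow> r (kuratowski A) = A"
    "\<And>g e. g \<in> segment_space \<Longrightarrow> e > 0 \<Longrightarrow>
      \<exists>d>0. \<forall>h\<in>segment_space. sup_dist g h < d \<longrightarrow> hausdorff_dist (r g) (r h) < e"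
proof -
  interpret S: Metric_space "segment_space :: ('a set \<Rightarrow> real) set" sup_dist
    by (rule Metric_space_segment_space)
  let ?M = "metric (segment_space :: ('a set \<Rightarrow> real) set, sup_dist)"
  have M: "mspace ?M = segment_space" "mdist ?M = sup_dist" "mtopology_of ?M = S.mtopology"
    by (simp_all add: mtopology_of_def)
  have "kuratowski \<in> mspace Bd \<rightarrow> mspace ?M"
    by (simp add: kuratowski_in)
  moreover have "\<forall>A\<in>mspace Bd. \<forall>B\<in>mspace Bd. mdist ?M (kuratowski A) (kuratowski B) = mdist Bd A B"
    by (simp add: M mdist_Bd kuratowski_isometry)
  moreover have "closedin (mtopology_of ?M) (kuratowski ` mspace Bd)"
    by (simp add: M closedin_kuratowski)
  ultimately have "kuratowski ` mspace Bd retract_of_space mtopology_of ?M"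
    using assms unfolding absolute_retract_among_def by blast
  then have "kuratowski ` Bd_sets retract_of_space S.mtopology"
    by (simp only: M mspace_Bd)
  then obtain \<rho> where \<rho>: "continuous_map S.mtopology (subtopology S.mtopology (kuratowski ` Bd_sets)) \<rho>"
      "\<And>g. g \<in> kuratowski ` Bd_sets \<Longrightarrow> \<rho> g = g"
    unfolding retract_of_space_def by blast
  have \<rho>_in: "\<rho> g \<in> kuratowski ` Bd_sets" if "g \<in> segment_space" for g
    using \<rho>(1) that by (auto simp: continuous_map_in_subtopology)
  have \<rho>_cont: "\<exists>d>0. \<forall>h\<in>segment_space. sup_dist g h < d \<longrightarrow> sup_dist (\<rho> g) (\<rho> h) < e"
    if "g \<in> segment_space" "e > 0" for g e
  proof -
    have "continuous_map S.mtopology S.mtopology \<rho>"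
      using \<rho>(1) by (simp add: continuous_map_in_subtopology)
    then have "\<forall>g\<in>segment_space. \<forall>e>0. \<exists>d>0. \<forall>h. h \<in> segment_space \<and> sup_dist g h < d \<longrightarrow>
        sup_dist (\<rho> g) (\<rho> h) < e"
      using S.metric_continuous_map[OF Metric_space_segment_space, of \<rho>] by simp
    then show ?thesis using that by meson
  qed
  define \<psi> :: "('a set \<Rightarrow> real) \<Rightarrow> 'a set" where "\<psi> = inv_into Bd_sets kuratowski"
  have inj: "inj_on (kuratowski :: 'a set \<Rightarrow> _) Bd_sets"
  proof (rule inj_onI)
    fix A B :: "'a set" assume AB: "A \<in> Bd_sets" "B \<in> Bd_sets" "kuratowski A = kuratowski B"
    then have "sup_dist (kuratowski A) (kuratowski B) = 0" by (simp add: kuratowski_in)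
    then show "A = B"
      using kuratowski_isometry[OF AB(1,2)] hausdorff_dist_eq_0[OF AB(1,2)] by simp
  qed
  have \<psi>: "\<psi> (kuratowski A) = A" if "A \<in> Bd_sets" for A
    unfolding \<psi>_def using inj that by (rule inv_into_f_f)
  have \<psi>_in: "\<psi> g \<in> Bd_sets" if "g \<in> kuratowski ` Bd_sets" for g
    using that \<psi> by auto
  have \<psi>_dist: "hausdorff_dist (\<psi> g) (\<psi> h) = sup_dist g h"
    if "g \<in> kuratowski ` Bd_sets" "h \<in> kuratowski ` Bd_sets" for g h
    using that by (auto simp: \<psi> kuratowski_isometry)
  show ?thesis
  proof (rule that[of "\<lambda>g. \<psi> (\<rho> g)"])
    show "\<psi> (\<rho> g) \<in> Bd_sets" if "g \<in> segment_space" for g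
      using that by (intro \<psi>_in \<rho>_in)
    show "\<psi> (\<rho> (kuratowski A)) = A" if "A \<in> Bd_sets" for A
      using that by (simp add: \<rho>(2) \<psi>)
    show "\<exists>d>0. \<forall>h\<in>segment_space. sup_dist g h < d \<longrightarrow> hausdorff_dist (\<psi> (\<rho> g)) (\<psi> (\<rho> h)) < e"
      if g: "g \<in> segment_space" "e > 0" for g e
      using \<rho>_cont[OF g] \<psi>_dist[OF \<rho>_in[OF g(1)] \<rho>_in] by auto
  qed
qed

text \<open>
  Uniform continuity is part of the notion because chains of uniformly bounded length are obtained by
  cutting the interval into equal pieces.
\<close>

definition hausdorff_path :: "(real \<Rightarrow> 'a::metric_space set) \<Rightarrow> bool" where
  "hausdorff_path \<gamma> \<longleftrightarrow> (\<forall>t\<in>{0..1}. \<gamma> t \<in> Bd_sets) \<and>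
    (\<forall>\<eta>>0. \<exists>\<zeta>>0. \<forall>s\<in>{0..1}. \<forall>t\<in>{0..1}. \<bar>s - t\<bar> < \<zeta> \<longrightarrow> hausdorff_dist (\<gamma> s) (\<gamma> t) < \<eta>)"

text \<open>
  By compactness of the interval. The theorem on uniform continuity is applied to the real function
  \<open>(s, t) \<mapsto> hausdorff_dist (\<gamma> s) (\<gamma> t)\<close>, which vanishes on the diagonal.
\<close>

lemma hausdorff_pathI:
  assumes "\<And>t. t \<in> {0..1} \<Longrightarrow> \<gamma> t \<in> Bd_sets"
    and cont: "\<And>t e. t \<in> {0..1} \<Longrightarrow> e > 0 \<Longrightarrow>
      \<exists>d>0. \<forall>s\<in>{0..1}. \<bar>t - s\<bar> < d \<longrightarrow> hausdorff_dist (\<gamma> t) (\<gamma> s) < e"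
  shows "hausdorff_path \<gamma>"
  unfolding hausdorff_path_def
proof (intro conjI ballI allI impI)
  fix \<eta> :: real assume "\<eta> > 0"
  let ?I = "{0..1::real}"
  let ?F = "\<lambda>(s, t). hausdorff_dist (\<gamma> s) (\<gamma> t)"
  have "continuous_on (?I \<times> ?I) ?F"
    unfolding continuous_on_iff
  proof (intro ballI allI impI)
    fix p :: "real \<times> real" and e :: real assume p: "p \<in> ?I \<times> ?I" and "e > 0"
    obtain s t where st: "p = (s, t)" "s \<in> ?I" "t \<in> ?I" using p by auto
    obtain d1 where d1: "d1 > 0" "\<forall>s'\<in>?I. \<bar>s - s'\<bar> < d1 \<longrightarrow> hausdorff_dist (\<gamma> s) (\<gamma> s') < e/2"
      using cont[OF st(2), of "e/2"] \<open>e > 0\<close> by auto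
    obtain d2 where d2: "d2 > 0" "\<forall>t'\<in>?I. \<bar>t - t'\<bar> < d2 \<longrightarrow> hausdorff_dist (\<gamma> t) (\<gamma> t') < e/2"
      using cont[OF st(3), of "e/2"] \<open>e > 0\<close> by auto
    have "dist (?F p') (?F p) < e" if p': "p' \<in> ?I \<times> ?I" "dist p' p < min d1 d2" for p'
    proof -
      obtain s' t' where st': "p' = (s', t')" "s' \<in> ?I" "t' \<in> ?I" using p' by auto
      have "\<bar>s - s'\<bar> < d1" "\<bar>t - t'\<bar> < d2"
        using dist_fst_le[of p' p] dist_snd_le[of p' p] p'(2) st st' by (auto simp: dist_real_def)
      then have "hausdorff_dist (\<gamma> s) (\<gamma> s') < e/2" "hausdorff_dist (\<gamma> t) (\<gamma> t') < e/2"
        using d1 d2 st' by auto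
      moreover have "\<gamma> s \<in> Bd_sets" "\<gamma> s' \<in> Bd_sets" "\<gamma> t \<in> Bd_sets" "\<gamma> t' \<in> Bd_sets"
        using st st' assms(1) by auto
      ultimately have "\<bar>hausdorff_dist (\<gamma> s') (\<gamma> t') - hausdorff_dist (\<gamma> s) (\<gamma> t)\<bar> < e"
        using hausdorff_dist_triangle[of "\<gamma> s'" "\<gamma> s" "\<gamma> t'"] hausdorff_dist_triangle[of "\<gamma> s" "\<gamma> t" "\<gamma> t'"]
          hausdorff_dist_triangle[of "\<gamma> s" "\<gamma> s'" "\<gamma> t"] hausdorff_dist_triangle[of "\<gamma> s'" "\<gamma> t'" "\<gamma> t"]
          hausdorff_dist_commute[of "\<gamma> s" "\<gamma> s'"] hausdorff_dist_commute[of "\<gamma> t" "\<gamma> t'"]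
        by linarith
      then show ?thesis by (simp add: st st' dist_real_def)
    qed
    then show "\<exists>d>0. \<forall>p'\<in>?I \<times> ?I. dist p' p < d \<longrightarrow> dist (?F p') (?F p) < e"
      using d1 d2 by (intro exI[of _ "min d1 d2"]) auto
  qed
  then have "uniformly_continuous_on (?I \<times> ?I) ?F"
    by (intro compact_uniformly_continuous compact_Times) auto
  then obtain \<zeta> where \<zeta>: "\<zeta> > 0"
    "\<And>p q. p \<in> ?I \<times> ?I \<Longrightarrow> q \<in> ?I \<times> ?I \<Longrightarrow> dist q p < \<zeta> \<Longrightarrow> dist (?F q) (?F p) < \<eta>"
    unfolding uniformly_continuous_on_def using \<open>\<eta> > 0\<close> by blast
  have "hausdorff_dist (\<gamma> s) (\<gamma> t) < \<eta>" if "s \<in> ?I" "t \<in> ?I" "\<bar>s - t\<bar> < \<zeta>" for s t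
  proof -
    have "dist (s, t) (s, s) < \<zeta>" using that by (simp add: dist_Pair_Pair dist_real_def)
    then have "dist (?F (s, t)) (?F (s, s)) < \<eta>" using that by (intro \<zeta>(2)) auto
    then show ?thesis using assms(1)[OF that(1)] by (simp add: hausdorff_dist_self dist_real_def)
  qed
  then show "\<exists>\<zeta>>0. \<forall>s\<in>?I. \<forall>t\<in>?I. \<bar>s - t\<bar> < \<zeta> \<longrightarrow> hausdorff_dist (\<gamma> s) (\<gamma> t) < \<eta>"
    using \<zeta>(1) by blast
qed (use assms in auto)

text \<open>
  The retraction is applied to the points of the segment from \<open>A\<close> to \<open>B\<close>. If \<open>B\<close> is close to \<open>A\<close>,
  the whole segment is close to the image of \<open>A\<close>, which the retraction fixes.
\<close>

proposition absolute_retract_imp_paths: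
  assumes "absolute_retract_among TYPE('a::metric_space set \<Rightarrow> real) (Bd :: 'a::metric_space set metric)"
  obtains \<gamma> :: "'a::metric_space set \<Rightarrow> 'a set \<Rightarrow> real \<Rightarrow> 'a set" where
    "\<And>A B. A \<in> Bd_sets \<Longrightarrow> B \<in> Bd_sets \<Longrightarrow> hausdorff_path (\<gamma> A B) \<and> \<gamma> A B 0 = A \<and> \<gamma> A B 1 = B"
    "\<And>A e. A \<in> Bd_sets \<Longrightarrow> e > 0 \<Longrightarrow> \<exists>\<delta>>0. \<forall>B\<in>Bd_sets. hausdorff_dist A B < \<delta> \<longrightarrow>
      (\<forall>t\<in>{0..1}. hausdorff_dist A (\<gamma> A B t) < e)"
proof -
  obtain r :: "('a set \<Rightarrow> real) \<Rightarrow> 'a set" where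
    r_in: "\<And>g. g \<in> segment_space \<Longrightarrow> r g \<in> Bd_sets" and
    r_id: "\<And>A. A \<in> Bd_sets \<Longrightarrow> r (kuratowski A) = A" and
    r_cont: "\<And>g e. g \<in> segment_space \<Longrightarrow> e > 0 \<Longrightarrow>
      \<exists>d>0. \<forall>h\<in>segment_space. sup_dist g h < d \<longrightarrow> hausdorff_dist (r g) (r h) < e"
    using absolute_retract_imp_retraction[OF assms] by blast
  have path: "hausdorff_path (\<lambda>t. r (segment_point A B t))" if AB: "A \<in> Bd_sets" "B \<in> Bd_sets" for A B
  proof (rule hausdorff_pathI)
    show "r (segment_point A B t) \<in> Bd_sets" if "t \<in> {0..1}" for t
      using AB that by (intro r_in segment_point_in) auto
    show "\<exists>d>0. \<forall>s\<in>{0..1}. \<bar>t - s\<bar> < d \<longrightarrow>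
        hausdorff_dist (r (segment_point A B t)) (r (segment_point A B s)) < e"
      if t: "t \<in> {0..1}" and "e > 0" for t e
    proof -
      have "segment_point A B t \<in> segment_space" using AB t by (intro segment_point_in) auto
      then obtain d where d: "d > 0" "\<forall>h\<in>segment_space. sup_dist (segment_point A B t) h < d \<longrightarrow>
          hausdorff_dist (r (segment_point A B t)) (r h) < e"
        using r_cont \<open>e > 0\<close> by blast
      have nn: "0 \<le> hausdorff_dist A B" using AB by (rule hausdorff_dist_nonneg)
      have "hausdorff_dist (r (segment_point A B t)) (r (segment_point A B s)) < e"
        if s: "s \<in> {0..1}" "\<bar>t - s\<bar> < d / (hausdorff_dist A B + 1)" for s
      proof -
        have "\<bar>t - s\<bar> * hausdorff_dist A B \<le> \<bar>t - s\<bar> * (hausdorff_dist A B + 1)"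
          by (intro mult_left_mono) auto
        also have "\<dots> < d" using s(2) nn by (simp add: field_simps)
        finally have "sup_dist (segment_point A B t) (segment_point A B s) < d"
          using sup_dist_segment_point[OF AB, of t s] t s by simp
        then show ?thesis using d(2) AB s by (simp add: segment_point_in)
      qed
      then show ?thesis using d(1) nn by (intro exI[of _ "d / (hausdorff_dist A B + 1)"]) auto
    qed
  qed
  have small: "\<exists>\<delta>>0. \<forall>B\<in>Bd_sets. hausdorff_dist A B < \<delta> \<longrightarrow>
      (\<forall>t\<in>{0..1}. hausdorff_dist A (r (segment_point A B t)) < e)"
    if A: "A \<in> Bd_sets" and "e > 0" for A e
  proof -
    obtain d where d: "d > 0" "\<forall>h\<in>segment_space. sup_dist (kuratowski A) h < d \<longrightarrow>
        hausdorff_dist A (r h) < e"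
      using r_cont[OF kuratowski_in[OF A] \<open>e > 0\<close>] r_id[OF A] by auto
    have "hausdorff_dist A (r (segment_point A B t)) < e"
      if B: "B \<in> Bd_sets" "hausdorff_dist A B < d" and t: "t \<in> {0..1}" for B t
    proof -
      have "t * hausdorff_dist A B \<le> 1 * hausdorff_dist A B"
        using t hausdorff_dist_nonneg[OF A B(1)] by (intro mult_right_mono) auto
      then have "sup_dist (kuratowski A) (segment_point A B t) < d"
        using sup_dist_segment_point[OF A B(1), of 0 t] t B(2) by simp
      then show ?thesis using d(2) A B t by (simp add: segment_point_in)
    qed
    then show ?thesis using d(1) by blast
  qed
  show ?thesis
    by (rule that[of "\<lambda>A B t. r (segment_point A B t)"]) (use path small r_id in auto)
qed

section \<open>Following a path of sets by chains of points\<close>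

text \<open>
  Each set of the chain has points close to any point of the previous one, so points can be selected one
  after the other.
\<close>

lemma hausdorff_chain_selection:
  assumes "\<And>i. i \<le> n \<Longrightarrow> C i \<in> Bd_sets"
    and "\<And>i. i < n \<Longrightarrow> hausdorff_dist (C i) (C (Suc i)) < \<eta>" "x \<in> C 0"
  obtains c where "c 0 = x" "\<And>i. i \<le> n \<Longrightarrow> c i \<in> C i" "\<And>i. i < n \<Longrightarrow> dist (c i) (c (Suc i)) < \<eta>"
proof -
  define c where "c = rec_nat x (\<lambda>i p. SOME q. q \<in> C (Suc i) \<and> dist p q < \<eta>)"
  have c_Suc: "c (Suc i) \<in> C (Suc i) \<and> dist (c i) (c (Suc i)) < \<eta>" if "i < n" "c i \<in> C i" for i
  proof -
    have "\<exists>q. q \<in> C (Suc i) \<and> dist (c i) q < \<eta>"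
      using hausdorff_dist_near[of "C i" "C (Suc i)" \<eta> "c i"] assms that by force
    then have "(SOME q. q \<in> C (Suc i) \<and> dist (c i) q < \<eta>) \<in> C (Suc i) \<and>
        dist (c i) (SOME q. q \<in> C (Suc i) \<and> dist (c i) q < \<eta>) < \<eta>"
      by (rule someI_ex)
    then show ?thesis by (simp add: c_def)
  qed
  have c_in: "c i \<in> C i" if "i \<le> n" for i
    using that by (induction i) (use assms(3) c_Suc in \<open>auto simp: c_def\<close>)
  show ?thesis
    by (rule that[of c]) (use c_in c_Suc in \<open>auto simp: c_def\<close>)
qed

text \<open>
  The number \<open>n\<close> of pieces is chosen for the whole path; for the point at time \<open>t\<close> the shorter
  interval from \<open>t\<close> back to \<open>0\<close> is cut into \<open>n\<close> pieces as well, so that the length does not depend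
  on \<open>t\<close>.
\<close>

lemma hausdorff_path_linked:
  assumes "hausdorff_path \<gamma>" "\<eta> > 0"
  obtains n where "\<And>t x. t \<in> {0..1} \<Longrightarrow> x \<in> \<gamma> t \<Longrightarrow> \<exists>a\<in>\<gamma> 0. linked (\<Union>s\<in>{0..1}. \<gamma> s) \<eta> n x a"
proof -
  have in_Bd: "\<gamma> t \<in> Bd_sets" if "t \<in> {0..1}" for t
    using assms(1) that unfolding hausdorff_path_def by blast
  obtain \<zeta> where \<zeta>: "\<zeta> > 0"
    "\<And>s t. s \<in> {0..1} \<Longrightarrow> t \<in> {0..1} \<Longrightarrow> \<bar>s - t\<bar> < \<zeta> \<Longrightarrow> hausdorff_dist (\<gamma> s) (\<gamma> t) < \<eta>"
    using assms unfolding hausdorff_path_def by meson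
  obtain n :: nat where n: "n > 0" "1 / real n < \<zeta>"
    using reals_Archimedean[OF \<zeta>(1)] by (metis inverse_eq_divide zero_less_Suc)
  have "\<exists>a\<in>\<gamma> 0. linked (\<Union>s\<in>{0..1}. \<gamma> s) \<eta> n x a" if t: "t \<in> {0..1}" and x: "x \<in> \<gamma> t" for t x
  proof -
    let ?T = "\<lambda>i. t * (1 - real i / real n)"
    have T: "?T i \<in> {0..1}" if "i \<le> n" for i
      using that t n(1) by (auto simp: mult_le_one)
    have "\<bar>?T i - ?T (Suc i)\<bar> < \<zeta>" for i
    proof -
      have "?T i - ?T (Suc i) = t * (1 / real n)"
        by (simp add: field_simps add_divide_distrib)
      moreover have "t * (1 / real n) \<le> 1 * (1 / real n)"
        using t by (intro mult_right_mono) auto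
      ultimately show ?thesis using n t by simp
    qed
    then have step: "hausdorff_dist (\<gamma> (?T i)) (\<gamma> (?T (Suc i))) < \<eta>" if "i < n" for i
      using that T[of i] T[of "Suc i"] by (intro \<zeta>(2)) auto
    have x0: "x \<in> \<gamma> (?T 0)" using x by simp
    obtain c where c: "c 0 = x" "\<And>i. i \<le> n \<Longrightarrow> c i \<in> \<gamma> (?T i)"
        "\<And>i. i < n \<Longrightarrow> dist (c i) (c (Suc i)) < \<eta>"
      by (rule hausdorff_chain_selection[of n "\<lambda>i. \<gamma> (?T i)" \<eta> x, OF in_Bd[OF T] step x0]) blast+
    have "c n \<in> \<gamma> 0" using c(2)[of n] n(1) by simp
    moreover have "linked (\<Union>s\<in>{0..1}. \<gamma> s) \<eta> n x (c n)"
      using c T by (intro linkedI[where c = c and k = n]) blast+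
    ultimately show ?thesis by blast
  qed
  then show ?thesis using that by blast
qed

lemma hausdorff_path_reverse:
  assumes "hausdorff_path \<gamma>"
  shows "hausdorff_path (\<lambda>t. \<gamma> (1 - t))"
  unfolding hausdorff_path_def
proof (intro conjI ballI allI impI)
  fix \<eta> :: real assume "\<eta> > 0"
  then obtain \<zeta> where \<zeta>: "\<zeta> > 0"
    "\<And>s t. s \<in> {0..1} \<Longrightarrow> t \<in> {0..1} \<Longrightarrow> \<bar>s - t\<bar> < \<zeta> \<Longrightarrow> hausdorff_dist (\<gamma> s) (\<gamma> t) < \<eta>"
    using assms unfolding hausdorff_path_def by meson
  have "hausdorff_dist (\<gamma> (1 - s)) (\<gamma> (1 - t)) < \<eta>" if "s \<in> {0..1}" "t \<in> {0..1}" "\<bar>s - t\<bar> < \<zeta>" for s t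
    using that by (intro \<zeta>(2)) auto
  then show "\<exists>\<zeta>>0. \<forall>s\<in>{0..1}. \<forall>t\<in>{0..1}. \<bar>s - t\<bar> < \<zeta> \<longrightarrow>
      hausdorff_dist (\<gamma> (1 - s)) (\<gamma> (1 - t)) < \<eta>"
    using \<zeta>(1) by blast
qed (use assms in \<open>auto simp: hausdorff_path_def\<close>)

text \<open>
  The path starts at a single point, so all points of its sets are linked to that point, and therefore to
  each other, by chains of bounded length. Chains with steps less than \<open>1\<close> also bound the diameter of
  the union.
\<close>

proposition absolute_retract_imp_chain_equi_connected:
  fixes S :: "'a::metric_space set"
  assumes AR: "absolute_retract_among TYPE('a set \<Rightarrow> real) (Bd :: 'a set metric)" and "bounded S"
  obtains Y where "S \<subseteq> Y" "bounded Y" "chain_equi_connected Y"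
proof (cases "S = {}")
  case True
  then show ?thesis by (intro that[of "{}"]) (auto simp: chain_equi_connected_def)
next
  case False
  then obtain x0 where "x0 \<in> S" by blast
  obtain \<gamma> :: "real \<Rightarrow> 'a set" where \<gamma>: "hausdorff_path \<gamma>" "\<gamma> 0 = {x0}" "\<gamma> 1 = closure S"
    using absolute_retract_imp_paths[OF AR] singleton_in_Bd_sets closure_in_Bd_sets[OF False \<open>bounded S\<close>]
    by metis
  define Y where "Y = (\<Union>s\<in>{0..1}. \<gamma> s)"
  have centre: "\<exists>n. \<forall>x\<in>Y. linked Y \<eta> n x x0" if \<eta>: "\<eta> > 0" for \<eta>
  proof -
    obtain n where "\<And>t x. t \<in> {0..1} \<Longrightarrow> x \<in> \<gamma> t \<Longrightarrow> \<exists>a\<in>\<gamma> 0. linked Y \<eta> n x a"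
      unfolding Y_def by (rule hausdorff_path_linked[OF \<gamma>(1) \<eta>]) blast
    then have "linked Y \<eta> n x x0" if "x \<in> Y" for x
      using that \<gamma>(2) unfolding Y_def by fastforce
    then show ?thesis by blast
  qed
  have "S \<subseteq> Y"
    using closure_subset[of S] \<gamma>(3) unfolding Y_def by force
  moreover have "chain_equi_connected Y"
    unfolding chain_equi_connected_iff_linked
  proof (intro allI impI)
    fix \<eta> :: real assume "\<eta> > 0"
    then obtain n where "\<forall>x\<in>Y. linked Y \<eta> n x x0" using centre by blast
    then have "\<forall>x\<in>Y. \<forall>y\<in>Y. linked Y \<eta> (n + n) x y"
      using linked_trans linked_sym by blast
    then show "\<exists>l. \<forall>x\<in>Y. \<forall>y\<in>Y. linked Y \<eta> l x y" by blast
  qed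
  moreover have "bounded Y"
  proof -
    obtain n where n: "\<forall>x\<in>Y. linked Y 1 n x x0" using centre[of 1] by auto
    have "dist x0 x \<le> real n" if "x \<in> Y" for x
    proof -
      have "linked Y 1 n x0 x" using n that linked_sym by blast
      then obtain k c where k: "k \<le> n" "c 0 = x0" "c k = x" and c: "\<And>i. i < k \<Longrightarrow> dist (c i) (c (Suc i)) < 1"
        by (rule linkedE) blast
      have "dist (c 0) (c i) \<le> real i" if "i \<le> k" for i
        using that
      proof (induction i)
        case (Suc i)
        then show ?case using c[of i] dist_triangle[of "c 0" "c (Suc i)" "c i"] by simp
      qed simp
      from this[of k] show ?thesis using k by simp
    qed
    then show ?thesis unfolding bounded_def by blast
  qed
  ultimately show ?thesis using that by blast 
qed

text \<open>
  The local form of the same idea: \<open>B\<close> is joined to \<open>A\<close> by a path that stays in the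
  \<open>e\<close>-neighbourhood of \<open>A\<close>. Since \<open>A\<close> and \<open>B\<close> need not be closed, the path joins their
  closures, and one more step of the chain leads from the closure into the set.
\<close>

lemma absolute_retract_imp_uniform_linking:
  fixes A :: "'a::metric_space set"
  assumes AR: "absolute_retract_among TYPE('a set \<Rightarrow> real) (Bd :: 'a set metric)"
    and A: "bounded A" "A \<noteq> {}" and "e > 0"
  obtains \<delta> where "\<delta> > 0"
    "\<And>B \<eta>. (\<And>b. b \<in> B \<Longrightarrow> \<exists>a\<in>A. dist a b < \<delta>) \<Longrightarrow> (\<And>a. a \<in> A \<Longrightarrow> \<exists>b\<in>B. dist a b < \<delta>) \<Longrightarrow> \<eta> > 0 \<Longrightarrow>
      \<exists>n. (\<forall>b\<in>B. \<exists>a\<in>A. linked (\<Union>a\<in>A. ball a e) \<eta> n b a) \<and>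
          (\<forall>a\<in>A. \<exists>b\<in>B. linked (\<Union>a\<in>A. ball a e) \<eta> n a b)"
proof -
  let ?N = "\<Union>a\<in>A. ball a e"
  obtain \<gamma> :: "'a set \<Rightarrow> 'a set \<Rightarrow> real \<Rightarrow> 'a set" where
    \<gamma>: "\<And>A B. A \<in> Bd_sets \<Longrightarrow> B \<in> Bd_sets \<Longrightarrow> hausdorff_path (\<gamma> A B) \<and> \<gamma> A B 0 = A \<and> \<gamma> A B 1 = B"
    "\<And>A e. A \<in> Bd_sets \<Longrightarrow> e > 0 \<Longrightarrow> \<exists>\<delta>>0. \<forall>B\<in>Bd_sets. hausdorff_dist A B < \<delta> \<longrightarrow>
      (\<forall>t\<in>{0..1}. hausdorff_dist A (\<gamma> A B t) < e)"
    using absolute_retract_imp_paths[OF AR] by blast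
  have clA: "closure A \<in> Bd_sets" using A by (intro closure_in_Bd_sets)
  obtain \<delta> where \<delta>: "\<delta> > 0" "\<And>B t. B \<in> Bd_sets \<Longrightarrow> hausdorff_dist (closure A) B < \<delta> \<Longrightarrow>
      t \<in> {0..1} \<Longrightarrow> hausdorff_dist (closure A) (\<gamma> (closure A) B t) < e/2"
    using \<gamma>(2)[OF clA, of "e/2"] \<open>e > 0\<close> by auto
  have "\<exists>n. (\<forall>b\<in>B. \<exists>a\<in>A. linked ?N \<eta> n b a) \<and> (\<forall>a\<in>A. \<exists>b\<in>B. linked ?N \<eta> n a b)"
    if BA: "\<And>b. b \<in> B \<Longrightarrow> \<exists>a\<in>A. dist a b < \<delta>/2" and AB: "\<And>a. a \<in> A \<Longrightarrow> \<exists>b\<in>B. dist a b < \<delta>/2"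
      and "\<eta> > 0" for B \<eta>
  proof -
    have "B \<noteq> {}" using AB A(2) by blast
    obtain p R where R: "\<And>a. a \<in> A \<Longrightarrow> dist p a \<le> R" using A(1) unfolding bounded_def by blast
    have "dist p b \<le> R + \<delta>/2" if b: "b \<in> B" for b
    proof -
      obtain a where "a \<in> A" "dist a b < \<delta>/2" using BA[OF b] by blast
      then show ?thesis using R[of a] dist_triangle[of p b a] by simp
    qed
    then have "bounded B" unfolding bounded_def by blast
    then have clB: "closure B \<in> Bd_sets" using \<open>B \<noteq> {}\<close> by (intro closure_in_Bd_sets)
    have "hausdorff_dist (closure A) (closure B) \<le> \<delta>/2"
    proof (rule hausdorff_dist_closure_le[OF A(2) \<open>B \<noteq> {}\<close>])
      show "\<exists>b\<in>B. dist a b \<le> \<delta>/2" if "a \<in> A" for a using AB[OF that] less_imp_le by blast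
      show "\<exists>a\<in>A. dist b a \<le> \<delta>/2" if "b \<in> B" for b
        using BA[OF that] by (metis dist_commute less_imp_le)
    qed
    then have near: "hausdorff_dist (closure A) (closure B) < \<delta>" using \<delta>(1) by simp
    define \<beta> where "\<beta> = \<gamma> (closure A) (closure B)"
    have \<beta>: "hausdorff_path \<beta>" "\<beta> 0 = closure A" "\<beta> 1 = closure B"
      using \<gamma>(1)[OF clA clB] by (auto simp: \<beta>_def)
    have \<beta>_N: "(\<Union>t\<in>{0..1}. \<beta> t) \<subseteq> ?N"
    proof
      fix z assume "z \<in> (\<Union>t\<in>{0..1}. \<beta> t)"
      then obtain t where t: "t \<in> {0..1}" "z \<in> \<beta> t" by blast
      have "\<beta> t \<in> Bd_sets" using \<beta>(1) t(1) unfolding hausdorff_path_def by blast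
      moreover have "hausdorff_dist (\<beta> t) (closure A) < e/2"
        using \<delta>(2)[OF clB near t(1)] by (simp add: \<beta>_def hausdorff_dist_commute)
      ultimately obtain a' where a': "a' \<in> closure A" "dist z a' < e/2"
        using hausdorff_dist_near[OF _ clA _ t(2)] by blast
      then obtain a where "a \<in> A" "dist a a' < e/2"
        using \<open>e > 0\<close> by (meson closure_approachable half_gt_zero)
      then show "z \<in> ?N" using a'(2) dist_triangle2[of a z a'] by (intro UN_I) auto
    qed
    obtain n1 where n1: "\<And>t x. t \<in> {0..1} \<Longrightarrow> x \<in> \<beta> t \<Longrightarrow> \<exists>a\<in>\<beta> 0. linked (\<Union>s\<in>{0..1}. \<beta> s) \<eta> n1 x a"
      by (rule hausdorff_path_linked[OF \<beta>(1) \<open>\<eta> > 0\<close>]) blast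
    let ?\<beta>' = "\<lambda>t. \<beta> (1 - t)"
    obtain n2 where n2: "\<And>t x. t \<in> {0..1} \<Longrightarrow> x \<in> ?\<beta>' t \<Longrightarrow> \<exists>a\<in>?\<beta>' 0. linked (\<Union>s\<in>{0..1}. ?\<beta>' s) \<eta> n2 x a"
      by (rule hausdorff_path_linked[OF hausdorff_path_reverse[OF \<beta>(1)] \<open>\<eta> > 0\<close>]) blast
    have \<beta>'_N: "(\<Union>t\<in>{0..1}. ?\<beta>' t) \<subseteq> ?N"
    proof -
      have "(\<Union>t\<in>{0..1}. ?\<beta>' t) \<subseteq> (\<Union>t\<in>{0..1}. \<beta> t)"
      proof
        fix z assume "z \<in> (\<Union>t\<in>{0..1}. ?\<beta>' t)"
        then obtain t where "t \<in> {0..1}" "z \<in> \<beta> (1 - t)" by blast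
        then show "z \<in> (\<Union>t\<in>{0..1}. \<beta> t)" by (intro UN_I[of "1 - t"]) auto
      qed
      then show ?thesis using \<beta>_N by (rule order_trans)
    qed
    have finish: "\<exists>q\<in>Q. linked ?N \<eta> (n1 + n2 + 1) x q"
      if link: "linked ?N \<eta> m x q'" and "m \<le> n1 + n2" and q': "q' \<in> closure Q" and QN: "closure Q \<subseteq> ?N" for m x q' Q
    proof -
      obtain q where q: "q \<in> Q" "dist q q' < \<eta>"
        using q' \<open>\<eta> > 0\<close> by (meson closure_approachable)
      have "q \<in> ?N" "q' \<in> ?N" using q(1) q' QN closure_subset[of Q] by blast+
      then have "linked ?N \<eta> 1 q' q" using q(2) by (intro linked_step) (auto simp: dist_commute)
      then have "linked ?N \<eta> (m + 1) x q" by (rule linked_trans[OF link])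
      then have "linked ?N \<eta> (n1 + n2 + 1) x q" by (rule linked_mono) (use \<open>m \<le> n1 + n2\<close> in auto)
      then show ?thesis using q(1) by blast
    qed
    have "closure A \<subseteq> ?N" "closure B \<subseteq> ?N"
      using \<beta>_N \<beta>(2,3) by (force, force)
    have "\<exists>a\<in>A. linked ?N \<eta> (n1 + n2 + 1) b a" if b: "b \<in> B" for b
    proof -
      have "b \<in> \<beta> 1" using b closure_subset \<beta>(3) by blast
      then obtain a' where "a' \<in> closure A" "linked (\<Union>s\<in>{0..1}. \<beta> s) \<eta> n1 b a'"
        using n1[of 1 b] \<beta>(2) by auto
      then show ?thesis
        using finish[of n1 b a' A] linked_mono[OF _ \<beta>_N] \<open>closure A \<subseteq> ?N\<close> by simp
    qed
    moreover have "\<exists>b\<in>B. linked ?N \<eta> (n1 + n2 + 1) a b" if a: "a \<in> A" for a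
    proof -
      have "a \<in> ?\<beta>' 1" using a closure_subset \<beta>(2) by auto
      then obtain b' where "b' \<in> closure B" "linked (\<Union>s\<in>{0..1}. ?\<beta>' s) \<eta> n2 a b'"
        using n2[of 1 a] \<beta>(3) by auto
      then show ?thesis
        using finish[of n2 a b' B] linked_mono[OF _ \<beta>'_N] \<open>closure B \<subseteq> ?N\<close> by simp
    qed
    ultimately show ?thesis by blast
  qed
  then show ?thesis using that[of "\<delta>/2"] \<delta>(1) by simp
qed

section \<open>Uniform local linking\<close>

text \<open>
  For a separated set \<open>A\<close> the neighbourhood in which the chains run falls apart into balls around the
  points of \<open>A\<close>. This turns linking near \<open>A\<close> into linking inside one small ball.
\<close>

lemma absolute_retract_imp_separated_linking:
  fixes A :: "'a::metric_space set"
  assumes AR: "absolute_retract_among TYPE('a set \<Rightarrow> real) (Bd :: 'a set metric)"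
    and A: "bounded A" "A \<noteq> {}" and "e > 0" "r > 0"
    and sep: "\<And>a b. a \<in> A \<Longrightarrow> b \<in> A \<Longrightarrow> a \<noteq> b \<Longrightarrow> r \<le> dist a b"
  obtains \<delta> where "\<delta> > 0"
    "\<And>\<eta>. \<eta> > 0 \<Longrightarrow> \<exists>n. \<forall>a\<in>A. \<forall>y. dist a y < \<delta> \<longrightarrow> linked (ball a e) \<eta> n y a"
proof -
  define e' where "e' = min e (r/4)"
  have e': "e' > 0" "e' \<le> e" "e' \<le> r/4" using \<open>e > 0\<close> \<open>r > 0\<close> by (auto simp: e'_def)
  let ?N = "\<Union>a\<in>A. ball a e'"
  obtain \<delta>0 where \<delta>0: "\<delta>0 > 0"
    "\<And>B \<eta>. (\<And>b. b \<in> B \<Longrightarrow> \<exists>a\<in>A. dist a b < \<delta>0) \<Longrightarrow> (\<And>a. a \<in> A \<Longrightarrow> \<exists>b\<in>B. dist a b < \<delta>0) \<Longrightarrow> \<eta> > 0 \<Longrightarrow>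
      \<exists>n. (\<forall>b\<in>B. \<exists>a\<in>A. linked ?N \<eta> n b a) \<and> (\<forall>a\<in>A. \<exists>b\<in>B. linked ?N \<eta> n a b)"
    using absolute_retract_imp_uniform_linking[OF AR A \<open>e' > 0\<close>] by metis
  define \<delta> where "\<delta> = min \<delta>0 e'"
  have \<delta>: "\<delta> > 0" "\<delta> \<le> \<delta>0" "\<delta> \<le> e'" using \<delta>0(1) e' by (auto simp: \<delta>_def)
  have "\<exists>n. \<forall>a\<in>A. \<forall>y. dist a y < \<delta> \<longrightarrow> linked (ball a e) \<eta> n y a" if "\<eta> > 0" for \<eta>
  proof -
    define \<eta>' where "\<eta>' = min \<eta> (r/2)"
    have \<eta>': "\<eta>' > 0" "\<eta>' \<le> \<eta>" "\<eta>' \<le> r/2" using \<open>\<eta> > 0\<close> \<open>r > 0\<close> by (auto simp: \<eta>'_def)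
    define B where "B = (\<Union>a\<in>A. ball a \<delta>)"
    have "\<exists>a\<in>A. dist a b < \<delta>0" if "b \<in> B" for b
      using that \<delta>(2) by (force simp: B_def)
    moreover have "\<exists>b\<in>B. dist a b < \<delta>0" if "a \<in> A" for a
    proof
      show "a \<in> B" unfolding B_def using that \<delta>(1) by (intro UN_I[of a]) auto
    qed (use \<delta>0(1) in simp)
    ultimately obtain n where n: "\<forall>b\<in>B. \<exists>a\<in>A. linked ?N \<eta>' n b a"
      using \<delta>0(2)[of B \<eta>'] \<eta>'(1) by blast
    have "linked (ball a e) \<eta> n y a" if a: "a \<in> A" and y: "dist a y < \<delta>" for a y
    proof -
      have "y \<in> B" using a y by (auto simp: B_def)
      then obtain a' where a': "a' \<in> A" "linked ?N \<eta>' n y a'" using n by blast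
      obtain k c where k: "k \<le> n" "c 0 = y" "c k = a'" and c: "\<And>i. i \<le> k \<Longrightarrow> c i \<in> ?N"
        "\<And>i. i < k \<Longrightarrow> dist (c i) (c (Suc i)) < \<eta>'"
        using a'(2) by (rule linkedE) blast
      (* the balls around the points of A are so far apart that a step of the chain cannot leave one *)
      have ball: "c i \<in> ball a e'" if "i \<le> k" for i
        using that
      proof (induction i)
        case 0
        then show ?case using k y \<delta>(3) by simp
      next
        case (Suc i)
        obtain b where b: "b \<in> A" "dist b (c (Suc i)) < e'" using c(1)[OF Suc.prems] by auto
        have "dist a (c i) < e'" "dist (c i) (c (Suc i)) < \<eta>'" using Suc c(2)[of i] by auto
        then have "dist a b < r"
          using b(2) e'(3) \<eta>'(3) dist_triangle[of a b "c i"] dist_triangle2[of "c i" b "c (Suc i)"] by linarith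
        then have "a = b" using sep[OF a b(1)] by fastforce
        then show ?case using b by simp
      qed
      have "dist a a' < r" using ball[of k] k e'(3) \<open>r > 0\<close> by simp
      then have "a = a'" using sep[OF a a'(1)] by fastforce
      moreover have "c i \<in> ball a e" if "i \<le> k" for i using ball[OF that] e'(2) by simp
      moreover have "dist (c i) (c (Suc i)) < \<eta>" if "i < k" for i using c(2)[OF that] \<eta>'(2) by simp
      ultimately show ?thesis using k by (intro linkedI[where c = c and k = k]) auto
    qed
    then show ?thesis by blast
  qed
  then show ?thesis using \<delta>(1) that by blast
qed

text \<open>
  A Cauchy sequence need not converge, but it is totally bounded.
\<close>

lemma Cauchy_imp_finite_net:
  fixes z :: "nat \<Rightarrow> 'a::metric_space"
  assumes "Cauchy z" "infinite J" "d > 0"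
  obtains F where "finite F" "F \<noteq> {}" "F \<subseteq> z ` J" "\<And>j. j \<in> J \<Longrightarrow> \<exists>f\<in>F. dist (z j) f < d"
proof -
  obtain K where K: "\<And>m n. m \<ge> K \<Longrightarrow> n \<ge> K \<Longrightarrow> dist (z m) (z n) < d"
    using assms(1,3) unfolding Cauchy_def by blast
  obtain j0 where j0: "j0 \<in> J" "j0 \<ge> K"
    using assms(2) by (meson infinite_nat_iff_unbounded_le)
  have "\<exists>f\<in>z ` (J \<inter> {..j0}). dist (z j) f < d" if "j \<in> J" for j
  proof (cases "j \<le> j0")
    case True
    then show ?thesis using that \<open>d > 0\<close> by (intro bexI[of _ "z j"]) auto
  next
    case False
    then show ?thesis using j0 K[of j j0] by (intro bexI[of _ "z j0"]) auto
  qed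
  then show ?thesis using j0 by (intro that[of "z ` (J \<inter> {..j0})"]) auto
qed

text \<open>
  The chains near \<open>A = z ` J\<close> start close to \<open>A\<close> and end in a finite net \<open>F\<close> of \<open>A\<close>, but
  this alone does not link the points of \<open>F\<close> to each other by chains near \<open>A\<close>: on a circle without
  one point, a sequence may approach the missing point from both sides. Finiteness of \<open>F\<close> yields one
  point of \<open>F\<close> to which infinitely many terms are linked for every \<open>\<eta>\<close>. The argument is then
  repeated for the subsequence of these terms. Its own net consists of such terms, so finitely many
  chains join the points of that net to each other.
\<close>

lemma absolute_retract_imp_Cauchy_linking:
  fixes z :: "nat \<Rightarrow> 'a::metric_space"
  assumes AR: "absolute_retract_among TYPE('a set \<Rightarrow> real) (Bd :: 'a set metric)"
    and "Cauchy z" "e > 0"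
  obtains J \<delta> p where "infinite J" "\<delta> > 0"
    "\<And>\<eta>. \<eta> > 0 \<Longrightarrow> \<exists>n. \<forall>j\<in>J. \<forall>u v. dist (z j) u < \<delta> \<longrightarrow> dist (z j) v < \<delta> \<longrightarrow> linked (ball p e) \<eta> n u v"
proof -
  define e' where "e' = e/2"
  have "e' > 0" using \<open>e > 0\<close> by (simp add: e'_def)
  obtain N where N: "\<And>m n. m \<ge> N \<Longrightarrow> n \<ge> N \<Longrightarrow> dist (z m) (z n) < e'"
    using \<open>Cauchy z\<close> \<open>e' > 0\<close> unfolding Cauchy_def by blast
  define Z where "Z = ball (z N) e"
  have nbhd: "(\<Union>a\<in>z ` J. ball a e') \<subseteq> Z" if "J \<subseteq> {N..}" for J
  proof
    fix x assume "x \<in> (\<Union>a\<in>z ` J. ball a e')"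
    then obtain j where "j \<in> J" "dist (z j) x < e'" by auto
    then show "x \<in> Z" using N[of N j] that dist_triangle[of "z N" x "z j"] by (auto simp: Z_def e'_def)
  qed
  (* uniform linking is used twice: from the neighbourhood to the sequence, and from there to the net *)
  have net: "\<exists>\<delta>>0. \<exists>F. finite F \<and> F \<subseteq> z ` J \<and>
      (\<forall>\<eta>>0. \<exists>n. \<forall>j\<in>J. \<forall>u. dist (z j) u < \<delta> \<longrightarrow> (\<exists>f\<in>F. linked Z \<eta> n u f))"
    if J: "infinite J" "J \<subseteq> {N..}" for J
  proof -
    let ?N = "\<Union>a\<in>z ` J. ball a e'"
    have bdd: "bounded (z ` J)"
      by (rule bounded_subset[OF cauchy_imp_bounded[OF \<open>Cauchy z\<close>]]) auto
    have ne: "z ` J \<noteq> {}" using J(1) by auto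
    obtain \<delta> where \<delta>: "\<delta> > 0"
      "\<And>B \<eta>. (\<And>b. b \<in> B \<Longrightarrow> \<exists>a\<in>z ` J. dist a b < \<delta>) \<Longrightarrow> (\<And>a. a \<in> z ` J \<Longrightarrow> \<exists>b\<in>B. dist a b < \<delta>) \<Longrightarrow> \<eta> > 0 \<Longrightarrow>
        \<exists>n. (\<forall>b\<in>B. \<exists>a\<in>z ` J. linked ?N \<eta> n b a) \<and> (\<forall>a\<in>z ` J. \<exists>b\<in>B. linked ?N \<eta> n a b)"
      by (rule absolute_retract_imp_uniform_linking[OF AR bdd ne \<open>e' > 0\<close>]) blast
    obtain F where F: "finite F" "F \<subseteq> z ` J" "\<And>j. j \<in> J \<Longrightarrow> \<exists>f\<in>F. dist (z j) f < \<delta>"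
      using Cauchy_imp_finite_net[OF \<open>Cauchy z\<close> J(1) \<delta>(1)] by metis
    have "\<exists>n. \<forall>j\<in>J. \<forall>u. dist (z j) u < \<delta> \<longrightarrow> (\<exists>f\<in>F. linked Z \<eta> n u f)" if "\<eta> > 0" for \<eta>
    proof -
      define B where "B = (\<Union>a\<in>z ` J. ball a \<delta>)"
      have "\<exists>a\<in>z ` J. dist a b < \<delta>" if "b \<in> B" for b
        using that by (auto simp: B_def)
      moreover have "\<exists>b\<in>B. dist a b < \<delta>" if "a \<in> z ` J" for a
      proof
        show "a \<in> B" unfolding B_def using that \<delta>(1) by (intro UN_I[of a]) auto
      qed (use \<delta>(1) in simp)
      ultimately obtain n1 where n1: "\<forall>b\<in>B. \<exists>a\<in>z ` J. linked ?N \<eta> n1 b a"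
        using \<delta>(2)[of B \<eta>] \<open>\<eta> > 0\<close> by blast
      have "\<exists>a\<in>z ` J. dist a f < \<delta>" if "f \<in> F" for f
        using that F(2) \<delta>(1) by (intro bexI[of _ f]) auto
      then obtain n2 where n2: "\<forall>a\<in>z ` J. \<exists>f\<in>F. linked ?N \<eta> n2 a f"
        using \<delta>(2)[of F \<eta>] F(3) \<open>\<eta> > 0\<close> by blast
      have "\<exists>f\<in>F. linked Z \<eta> (n1 + n2) u f" if "j \<in> J" "dist (z j) u < \<delta>" for j u
      proof -
        have "u \<in> B" using that by (auto simp: B_def)
        then obtain a where "a \<in> z ` J" "linked ?N \<eta> n1 u a" using n1 by blast
        moreover then obtain f where "f \<in> F" "linked ?N \<eta> n2 a f" using n2 by blast
        ultimately show ?thesis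
          using linked_mono[OF linked_trans nbhd[OF J(2)], of \<eta> n1 u a n2 f \<eta> "n1 + n2"] by auto
      qed
      then show ?thesis by blast
    qed
    then show ?thesis using \<delta>(1) F by blast
  qed
  have "infinite {N..}" by (rule infinite_Ici)
  then obtain \<delta>1 F where F: "\<delta>1 > 0" "finite F" "F \<subseteq> z ` {N..}"
    "\<And>\<eta>. \<eta> > 0 \<Longrightarrow> \<exists>n. \<forall>j\<in>{N..}. \<forall>u. dist (z j) u < \<delta>1 \<longrightarrow> (\<exists>f\<in>F. linked Z \<eta> n u f)"
    using net[of "{N..}"] by blast
  have "\<exists>f\<in>F. \<forall>\<eta>>0. \<exists>n. linked Z \<eta> n (z j) f" if j: "j \<in> {N..}" for j
  proof (rule ccontr)
    assume "\<not> ?thesis"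
    then have "\<forall>f\<in>F. \<exists>\<eta>>0. \<forall>n. \<not> linked Z \<eta> n (z j) f" by blast
    then obtain h where h: "\<And>f. f \<in> F \<Longrightarrow> h f > 0" "\<And>f n. f \<in> F \<Longrightarrow> \<not> linked Z (h f) n (z j) f"
      by metis
    define \<eta> where "\<eta> = Min (insert 1 (h ` F))"
    have "\<eta> > 0" using h(1) F(2) by (auto simp: \<eta>_def)
    then obtain n f where f: "f \<in> F" "linked Z \<eta> n (z j) f"
      using F(4)[of \<eta>] j F(1) by (metis dist_self)
    have "\<eta> \<le> h f" using f(1) F(2) by (auto simp: \<eta>_def)
    then show False using linked_mono[OF f(2) order_refl] h(2)[OF f(1)] by blast
  qed
  (* the end point of the chain now serves all \<eta>, and only finitely many end points are available *)
  then obtain \<phi> where \<phi>: "\<And>j. j \<in> {N..} \<Longrightarrow> \<phi> j \<in> F"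
    "\<And>j \<eta>. j \<in> {N..} \<Longrightarrow> \<eta> > 0 \<Longrightarrow> \<exists>n. linked Z \<eta> n (z j) (\<phi> j)"
    by metis
  have "finite (\<phi> ` {N..})" using \<phi>(1) F(2) by (meson finite_subset image_subsetI)
  then obtain j0 where j0: "j0 \<in> {N..}" "infinite {j \<in> {N..}. \<phi> j = \<phi> j0}"
    using pigeonhole_infinite[OF \<open>infinite {N..}\<close>] by blast
  define J where "J = {j \<in> {N..}. \<phi> j = \<phi> j0}"
  have J: "infinite J" "J \<subseteq> {N..}" using j0(2) by (auto simp: J_def)
  obtain \<delta> G where G: "\<delta> > 0" "finite G" "G \<subseteq> z ` J"
    "\<And>\<eta>. \<eta> > 0 \<Longrightarrow> \<exists>n. \<forall>j\<in>J. \<forall>u. dist (z j) u < \<delta> \<longrightarrow> (\<exists>f\<in>G. linked Z \<eta> n u f)"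
    using net[OF J] by blast
  have uniform: "\<exists>n. \<forall>j\<in>J. \<forall>u v. dist (z j) u < \<delta> \<longrightarrow> dist (z j) v < \<delta> \<longrightarrow> linked Z \<eta> n u v" if "\<eta> > 0" for \<eta>
  proof -
    obtain n1 where n1: "\<And>j u. j \<in> J \<Longrightarrow> dist (z j) u < \<delta> \<Longrightarrow> \<exists>f\<in>G. linked Z \<eta> n1 u f"
      using G(4)[OF \<open>\<eta> > 0\<close>] by blast
    have "\<exists>n. linked Z \<eta> n f (\<phi> j0)" if "f \<in> G" for f
      using that G(3) \<phi>(2)[OF _ \<open>\<eta> > 0\<close>] by (force simp: J_def)
    then obtain l where l: "\<And>f. f \<in> G \<Longrightarrow> linked Z \<eta> (l f) f (\<phi> j0)" by metis
    define n2 where "n2 = sum l G"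
    have base: "linked Z \<eta> (n1 + n2) u (\<phi> j0)" if ju: "j \<in> J" "dist (z j) u < \<delta>" for j u
    proof -
      obtain f where f: "f \<in> G" "linked Z \<eta> n1 u f" using n1[OF ju] by blast
      have "l f \<le> n2" unfolding n2_def using f(1) G(2) by (intro member_le_sum) auto
      then have "linked Z \<eta> n2 f (\<phi> j0)" using linked_mono[OF l[OF f(1)]] by simp
      then show ?thesis by (rule linked_trans[OF f(2)])
    qed
    have "linked Z \<eta> ((n1 + n2) + (n1 + n2)) u v"
      if "j \<in> J" "dist (z j) u < \<delta>" "dist (z j) v < \<delta>" for j u v
      using that by (intro linked_trans[OF base linked_sym[OF base]])
    then show ?thesis by blast
  qed
  show ?thesis by (rule that[OF J(1) G(1) uniform[unfolded Z_def]])
qed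

text \<open>
  Ramsey's theorem splits sequences into these two extreme types.
\<close>

definition separated_sequence :: "real \<Rightarrow> (nat \<Rightarrow> 'a::metric_space) \<Rightarrow> bool" where
  "separated_sequence r x \<longleftrightarrow> (\<forall>i j. i \<noteq> j \<longrightarrow> r \<le> dist (x i) (x j))"

definition close_sequence :: "real \<Rightarrow> (nat \<Rightarrow> 'a::metric_space) \<Rightarrow> bool" where
  "close_sequence r x \<longleftrightarrow> (\<forall>i j. i \<noteq> j \<longrightarrow> dist (x i) (x j) < r)"

lemma separated_or_close_subsequence:
  fixes x :: "nat \<Rightarrow> 'a::metric_space"
  shows "\<exists>\<sigma>. strict_mono \<sigma> \<and> (separated_sequence r (x \<circ> \<sigma>) \<or> close_sequence r (x \<circ> \<sigma>))"
proof -
  (* the colour of a pair of indices tells whether the two terms are close *)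
  define f :: "nat set \<Rightarrow> nat" where
    "f X = (if \<exists>i\<in>X. \<exists>j\<in>X. i \<noteq> j \<and> dist (x i) (x j) < r then 1 else 0)" for X
  have f: "f {i, j} = (if dist (x i) (x j) < r then 1 else 0)" if "i \<noteq> j" for i j
    using that by (auto simp: f_def dist_commute)
  have "\<forall>i\<in>(UNIV :: nat set). \<forall>j\<in>UNIV. i \<noteq> j \<longrightarrow> f {i, j} < 2" by (simp add: f_def)
  then obtain Y t where Y: "infinite Y" "\<forall>i\<in>Y. \<forall>j\<in>Y. i \<noteq> j \<longrightarrow> f {i, j} = t"
    using Ramsey2[of "UNIV :: nat set" f 2] infinite_UNIV_nat by blast
  define \<sigma> where "\<sigma> = enumerate Y"
  have \<sigma>: "strict_mono \<sigma>" "\<And>i. \<sigma> i \<in> Y"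
    using Y(1) by (simp_all add: \<sigma>_def strict_mono_enumerate enumerate_in_set)
  have t: "(if dist (x (\<sigma> i)) (x (\<sigma> j)) < r then 1 else 0) = t" if "i \<noteq> j" for i j
  proof -
    have "\<sigma> i \<noteq> \<sigma> j" using that \<sigma>(1) by (simp add: strict_mono_eq)
    then show ?thesis using Y(2) \<sigma>(2) f by metis
  qed
  have "separated_sequence r (x \<circ> \<sigma>) \<or> close_sequence r (x \<circ> \<sigma>)"
  proof (cases "t = 0")
    case True
    then have "r \<le> dist (x (\<sigma> i)) (x (\<sigma> j))" if "i \<noteq> j" for i j
      using t[OF that] by (auto split: if_splits)
    then show ?thesis by (simp add: separated_sequence_def)
  next
    case False
    then have "dist (x (\<sigma> i)) (x (\<sigma> j)) < r" if "i \<noteq> j" for i j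
      using t[OF that] by (auto split: if_splits)
    then show ?thesis by (simp add: close_sequence_def)
  qed
  then show ?thesis using \<sigma>(1) by blast
qed

text \<open>
  If no subsequence is separated, every subsequence contains a \<open>1/(n+1)\<close>-close one, and a diagonal
  subsequence is Cauchy.
\<close>

lemma separated_or_Cauchy_subsequence:
  fixes x :: "nat \<Rightarrow> 'a::metric_space"
  shows "\<exists>\<sigma>. strict_mono \<sigma> \<and> ((\<exists>r>0. separated_sequence r (x \<circ> \<sigma>)) \<or> Cauchy (x \<circ> \<sigma>))"
proof (cases "\<exists>r>0. \<exists>\<sigma>. strict_mono \<sigma> \<and> separated_sequence r (x \<circ> \<sigma>)")
  case True
  then show ?thesis by blast
next
  case False
  define P where "P n s \<longleftrightarrow> close_sequence (1 / real (Suc n)) (x \<circ> s)" for n s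
  interpret subseqs P
  proof
    fix n and s :: "nat \<Rightarrow> nat" assume s: "strict_mono s"
    obtain \<sigma> where \<sigma>: "strict_mono \<sigma>" and
      "separated_sequence (1 / real (Suc n)) (x \<circ> (s \<circ> \<sigma>)) \<or> close_sequence (1 / real (Suc n)) (x \<circ> (s \<circ> \<sigma>))"
      using separated_or_close_subsequence[of "1 / real (Suc n)" "x \<circ> s"] by (auto simp: o_assoc)
    moreover have "\<not> separated_sequence (1 / real (Suc n)) (x \<circ> (s \<circ> \<sigma>))"
    proof -
      have "1 / real (Suc n) > 0" by simp
      then show ?thesis using False strict_mono_o[OF s \<sigma>] by blast
    qed
    ultimately show "\<exists>\<sigma>. strict_mono \<sigma> \<and> P n (s \<circ> \<sigma>)" unfolding P_def by blast
  qed
  have "P k (diagseq \<circ> ((+) (Suc k)))" for k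
  proof (rule diagseq_holds)
    fix n and s r :: "nat \<Rightarrow> nat" assume "strict_mono r" "P n s"
    then show "P n (s \<circ> r)" by (simp add: P_def close_sequence_def strict_mono_eq)
  qed
  then have close: "dist (x (diagseq (Suc k + i))) (x (diagseq (Suc k + j))) < 1 / real (Suc k)" for k i j
    unfolding P_def close_sequence_def by (cases "i = j") auto
  have "Cauchy (x \<circ> diagseq)"
    unfolding Cauchy_def
  proof (intro allI impI)
    fix e :: real assume "e > 0"
    then obtain k where k: "1 / real (Suc k) < e" using nat_approx_posE by blast
    have "dist ((x \<circ> diagseq) m) ((x \<circ> diagseq) n) < e" if "m \<ge> Suc k" "n \<ge> Suc k" for m n
      using close[of k "m - Suc k" "n - Suc k"] k that by simp
    then show "\<exists>M. \<forall>m\<ge>M. \<forall>n\<ge>M. dist ((x \<circ> diagseq) m) ((x \<circ> diagseq) n) < e" by blast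
  qed
  then show ?thesis using subseq_diagseq by blast
qed

text \<open>
  How uniform local linking with radius \<open>\<epsilon>\<close> fails at the scale \<open>\<delta>\<close>: the \<open>l\<close>-th pair is
  not linked by any chain of length at most \<open>l\<close>. The same \<open>\<eta>\<close> serves all pairs.
\<close>

definition unlinked_pairs ::
    "'a::metric_space set \<Rightarrow> real \<Rightarrow> real \<Rightarrow> real \<Rightarrow> (nat \<Rightarrow> 'a) \<Rightarrow> (nat \<Rightarrow> 'a) \<Rightarrow> bool" where
  "unlinked_pairs S \<epsilon> \<delta> \<eta> x y \<longleftrightarrow> \<eta> > 0 \<and>
    (\<forall>l. x l \<in> S \<and> y l \<in> S \<and> dist (x l) (y l) < \<delta> \<and> (\<forall>p. \<not> linked (ball p \<epsilon>) \<eta> l (x l) (y l)))"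

text \<open>
  Pairs with a larger index need longer chains, so failure passes to subsequences. This is what makes
  Ramsey's theorem applicable.
\<close>

lemma unlinked_pairs_subsequence:
  assumes "unlinked_pairs S \<epsilon> \<delta> \<eta> x y" "strict_mono \<sigma>"
  shows "unlinked_pairs S \<epsilon> \<delta> \<eta> (x \<circ> \<sigma>) (y \<circ> \<sigma>)"
  unfolding unlinked_pairs_def o_apply
proof (intro conjI allI notI)
  fix l p assume "linked (ball p \<epsilon>) \<eta> l (x (\<sigma> l)) (y (\<sigma> l))"
  then have "linked (ball p \<epsilon>) \<eta> (\<sigma> l) (x (\<sigma> l)) (y (\<sigma> l))"
    by (rule linked_mono) (simp_all add: assms(2) strict_mono_imp_increasing)
  then show False using assms(1) unfolding unlinked_pairs_def by blast
qed (use assms(1) in \<open>auto simp: unlinked_pairs_def\<close>)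

lemma unlinked_pairs_mono: "unlinked_pairs S \<epsilon> \<delta> \<eta> x y \<Longrightarrow> \<delta> \<le> \<delta>' \<Longrightarrow> unlinked_pairs S \<epsilon> \<delta>' \<eta> x y"
  unfolding unlinked_pairs_def by (meson less_le_trans)

lemma unlinked_pairsD:
  assumes "unlinked_pairs S \<epsilon> \<delta> \<eta> x y"
  shows "\<eta> > 0" "x l \<in> S" "y l \<in> S" "dist (x l) (y l) < \<delta>" "k \<le> l \<Longrightarrow> \<not> linked (ball p \<epsilon>) \<eta> k (x l) (y l)"
proof -
  show "\<eta> > 0" "x l \<in> S" "y l \<in> S" "dist (x l) (y l) < \<delta>"
    using assms by (auto simp: unlinked_pairs_def)
  have "\<not> linked (ball p \<epsilon>) \<eta> l (x l) (y l)" using assms by (simp add: unlinked_pairs_def)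
  then show "\<not> linked (ball p \<epsilon>) \<eta> k (x l) (y l)" if "k \<le> l"
    using linked_mono[OF _ order_refl order_refl that] by blast
qed

text \<open>
  Infinitely many separated sequences are thinned out to one separated family that contains infinitely
  many terms of each. The pairing function visits every sequence infinitely often, and half of the
  separation is given up so that each point already chosen excludes at most one term of a sequence.
\<close>

lemma separated_interleaving:
  fixes X :: "nat \<Rightarrow> nat \<Rightarrow> 'a::metric_space"
  assumes "r > 0" and sep: "\<And>n. separated_sequence r (X n)"
  obtains \<nu> where "\<And>j k. j \<noteq> k \<Longrightarrow>
      r/2 \<le> dist (X (fst (prod_decode j)) (\<nu> j)) (X (fst (prod_decode k)) (\<nu> k))"
proof -
  let ?p = "\<lambda>k. fst (prod_decode k)"
  have "\<exists>\<nu>. \<forall>k. \<forall>j<k. r/2 \<le> dist (X (?p j) (\<nu> j)) (X (?p k) (\<nu> k))"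
  proof (rule dependent_wf_choice[OF wf_less])
    fix f g :: "nat \<Rightarrow> nat" and k m assume "\<And>j. (j, k) \<in> {(x, y). x < y} \<Longrightarrow> f j = g j"
    then show "(\<forall>j<k. r/2 \<le> dist (X (?p j) (f j)) (X (?p k) m)) =
        (\<forall>j<k. r/2 \<le> dist (X (?p j) (g j)) (X (?p k) m))" by simp
  next
    fix k and f :: "nat \<Rightarrow> nat"
    (* each of the finitely many points chosen so far excludes at most one term of the sequence *)
    define W where "W j = {m. dist (X (?p j) (f j)) (X (?p k) m) < r/2}" for j
    have "finite (W j)" for j
    proof -
      have "m = m'" if "m \<in> W j" "m' \<in> W j" for m m'
      proof (rule ccontr)
        assume "m \<noteq> m'"
        then have "r \<le> dist (X (?p k) m) (X (?p k) m')"
          using sep by (simp add: separated_sequence_def)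
        then show False
          using that dist_triangle3[of "X (?p k) m" "X (?p k) m'" "X (?p j) (f j)"] by (simp add: W_def)
      qed
      then have "W j = {} \<or> (\<exists>m. W j = {m})" by blast
      then show ?thesis by auto
    qed
    then have "finite (\<Union>j<k. W j)" by simp
    then obtain m where "m \<notin> (\<Union>j<k. W j)"
      using infinite_UNIV_nat ex_new_if_finite by blast
    then show "\<exists>m. \<forall>j<k. r/2 \<le> dist (X (?p j) (f j)) (X (?p k) m)"
      by (intro exI[of _ m]) (auto simp: W_def not_less)
  qed
  then obtain \<nu> where \<nu>: "\<And>j k. j < k \<Longrightarrow> r/2 \<le> dist (X (?p j) (\<nu> j)) (X (?p k) (\<nu> k))" by blast
  show ?thesis
  proof (rule that)
    fix j k :: nat assume "j \<noteq> k"
    then show "r/2 \<le> dist (X (?p j) (\<nu> j)) (X (?p k) (\<nu> k))"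
      using \<nu>[of j k] \<nu>[of k j] by (cases "j < k") (auto simp: dist_commute)
  qed
qed

text \<open>
  Failure at all scales along separated sequences would produce one separated set \<open>A\<close> that contains
  infinitely many first components for each scale. Near \<open>A\<close> there is one good scale for all of them, and
  for that scale one length for all pairs.
\<close>

lemma no_separated_unlinked_pairs:
  fixes S :: "'a::metric_space set"
  assumes AR: "absolute_retract_among TYPE('a set \<Rightarrow> real) (Bd :: 'a set metric)"
    and "bounded S" "\<epsilon> > 0" "r > 0"
  shows "\<exists>\<delta>>0. \<forall>\<eta> x y. unlinked_pairs S \<epsilon> \<delta> \<eta> x y \<longrightarrow> \<not> separated_sequence r x"
proof (rule ccontr)
  assume "\<not> ?thesis"
  then have "\<forall>n. \<exists>\<eta> x y. unlinked_pairs S \<epsilon> (1 / real (Suc n)) \<eta> x y \<and> separated_sequence r x"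
    by (metis of_nat_0_less_iff zero_less_Suc zero_less_divide_1_iff)
  then obtain \<eta> X Y where bad: "\<And>n. unlinked_pairs S \<epsilon> (1 / real (Suc n)) (\<eta> n) (X n) (Y n)"
    and sep: "\<And>n. separated_sequence r (X n)" by metis
  let ?p = "\<lambda>k. fst (prod_decode k)"
  obtain \<nu> where \<nu>: "\<And>j k. j \<noteq> k \<Longrightarrow> r/2 \<le> dist (X (?p j) (\<nu> j)) (X (?p k) (\<nu> k))"
    by (rule separated_interleaving[of r X, OF \<open>r > 0\<close> sep]) blast
  define a where "a k = X (?p k) (\<nu> k)" for k
  have "range a \<subseteq> S" using unlinked_pairsD(2)[OF bad] by (auto simp: a_def)
  then have bdd: "bounded (range a)" using \<open>bounded S\<close> bounded_subset by blast
  have sep_a: "r/2 \<le> dist u v" if "u \<in> range a" "v \<in> range a" "u \<noteq> v" for u v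
  proof -
    obtain j k where "u = a j" "v = a k" using \<open>u \<in> range a\<close> \<open>v \<in> range a\<close> by blast
    moreover with \<open>u \<noteq> v\<close> have "j \<noteq> k" by blast
    ultimately show ?thesis using \<nu>[of j k] by (simp add: a_def)
  qed
  have "range a \<noteq> {}" "r/2 > 0" using \<open>r > 0\<close> by auto
  obtain \<delta> where \<delta>: "\<delta> > 0" "\<And>\<eta>. \<eta> > 0 \<Longrightarrow>
      \<exists>l. \<forall>u\<in>range a. \<forall>y. dist u y < \<delta> \<longrightarrow> linked (ball u \<epsilon>) \<eta> l y u"
    using absolute_retract_imp_separated_linking[OF AR bdd \<open>range a \<noteq> {}\<close> \<open>\<epsilon> > 0\<close> \<open>r/2 > 0\<close> sep_a] by metis
  obtain n where n: "1 / real (Suc n) < \<delta>" using nat_approx_posE[OF \<delta>(1)] by metis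
  obtain l where l: "\<forall>u\<in>range a. \<forall>y. dist u y < \<delta> \<longrightarrow> linked (ball u \<epsilon>) (\<eta> n) l y u"
    using \<delta>(2)[OF unlinked_pairsD(1)[OF bad]] by blast
  (* the n-th sequence is visited infinitely often, each time at another term *)
  let ?k = "\<lambda>m. prod_encode (n, m)"
  have "inj (\<lambda>m. \<nu> (?k m))"
  proof (rule injI, rule ccontr)
    fix m m' assume "\<nu> (?k m) = \<nu> (?k m')" "m \<noteq> m'"
    then show False using \<nu>[of "?k m" "?k m'"] \<open>r > 0\<close> by (simp add: prod_encode_eq)
  qed
  then have "infinite (range (\<lambda>m. \<nu> (?k m)))"
    using finite_imageD infinite_UNIV_nat by blast
  then obtain m where m: "l \<le> \<nu> (?k m)"
    by (metis (no_types, lifting) infinite_nat_iff_unbounded_le rangeE)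
  define i where "i = \<nu> (?k m)"
  have "X n i \<in> range a" by (rule range_eqI[of _ _ "?k m"]) (simp add: a_def i_def)
  moreover have "dist (X n i) (Y n i) < \<delta>" using unlinked_pairsD(4)[OF bad, of n i] n by linarith
  ultimately have "linked (ball (X n i) \<epsilon>) (\<eta> n) l (Y n i) (X n i)" using l by blast
  then show False
    using linked_sym unlinked_pairsD(5)[OF bad, of l i] m unfolding i_def by blast
qed

text \<open>
  Otherwise there are unlinked pairs at all scales, and by the preceding lemma and Ramsey's theorem they
  form clusters of diameter tending to \<open>0\<close>. Let \<open>z n\<close> be a point of the \<open>n\<close>-th cluster. A
  subsequence of \<open>z\<close> is separated or Cauchy, and in both cases uniform linking near its terms reaches
  all points of some late cluster, with one length for the whole cluster.
\<close>

proposition absolute_retract_imp_unif_locally_chain_equi_connected: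
  fixes S :: "'a::metric_space set"
  assumes AR: "absolute_retract_among TYPE('a set \<Rightarrow> real) (Bd :: 'a set metric)" and "bounded S"
  shows "unif_locally_chain_equi_connected_at (UNIV :: 'a set) S"
proof (rule unif_locally_chain_equi_connected_atI, rule ccontr)
  fix \<epsilon> :: real assume "\<epsilon> > 0"
  assume contra: "\<not> (\<exists>\<delta>>0. \<forall>\<eta>>0. \<exists>l. \<forall>x\<in>S. \<forall>y\<in>S. dist x y < \<delta> \<longrightarrow> (\<exists>p. linked (ball p \<epsilon>) \<eta> l x y))"
  have bad: "\<exists>\<eta> x y. unlinked_pairs S \<epsilon> \<delta> \<eta> x y" if "\<delta> > 0" for \<delta>
  proof -
    obtain \<eta> where "\<eta> > 0" and
      "\<forall>l. \<exists>x y. x \<in> S \<and> y \<in> S \<and> dist x y < \<delta> \<and> (\<forall>p. \<not> linked (ball p \<epsilon>) \<eta> l x y)"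
      using contra \<open>\<delta> > 0\<close> by meson
    then show ?thesis unfolding unlinked_pairs_def by metis
  qed
  (* separated subsequences are impossible at small scales, so the other case of Ramsey's theorem holds *)
  have "\<exists>\<eta> x y. unlinked_pairs S \<epsilon> (1 / real (Suc n)) \<eta> x y \<and> close_sequence (1 / real (Suc n)) x" for n
  proof -
    define r where "r = 1 / real (Suc n)"
    have "r > 0" by (simp add: r_def)
    obtain \<delta> where \<delta>: "\<delta> > 0" "\<And>\<eta> x y. unlinked_pairs S \<epsilon> \<delta> \<eta> x y \<Longrightarrow> \<not> separated_sequence r x"
      using no_separated_unlinked_pairs[OF AR \<open>bounded S\<close> \<open>\<epsilon> > 0\<close> \<open>r > 0\<close>] by blast
    obtain \<eta> x y where xy: "unlinked_pairs S \<epsilon> (min \<delta> r) \<eta> x y"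
      using bad[of "min \<delta> r"] \<delta>(1) \<open>r > 0\<close> by auto
    obtain \<sigma> where \<sigma>: "strict_mono \<sigma>" "separated_sequence r (x \<circ> \<sigma>) \<or> close_sequence r (x \<circ> \<sigma>)"
      using separated_or_close_subsequence by blast
    have sub: "unlinked_pairs S \<epsilon> (min \<delta> r) \<eta> (x \<circ> \<sigma>) (y \<circ> \<sigma>)"
      using xy \<sigma>(1) by (rule unlinked_pairs_subsequence)
    have "\<not> separated_sequence r (x \<circ> \<sigma>)"
      by (rule \<delta>(2)[OF unlinked_pairs_mono[OF sub]]) simp
    moreover have "unlinked_pairs S \<epsilon> r \<eta> (x \<circ> \<sigma>) (y \<circ> \<sigma>)"
      by (rule unlinked_pairs_mono[OF sub]) simp
    ultimately show ?thesis using \<sigma>(2) unfolding r_def by blast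
  qed
  then obtain \<eta> X Y where bad: "\<And>n. unlinked_pairs S \<epsilon> (1 / real (Suc n)) (\<eta> n) (X n) (Y n)"
    and close: "\<And>n. close_sequence (1 / real (Suc n)) (X n)" by metis
  define z where "z n = X n 0" for n
  have X: "dist (z n) (X n l) < 1 / real (Suc n)" for n l
    using close[of n] unfolding z_def close_sequence_def by (cases "l = 0") auto
  have Y: "dist (z n) (Y n l) < 2 / real (Suc n)" for n l
  proof -
    note X[of n l]
    then have "dist (z n) (Y n l) < 1 / real (Suc n) + 1 / real (Suc n)"
      using unlinked_pairsD(4)[OF bad, of n l] dist_triangle[of "z n" "Y n l" "X n l"] by linarith
    then show ?thesis by (simp add: field_simps)
  qed
  have small: "\<exists>N. \<forall>n\<ge>N. 2 / real (Suc n) < \<delta>" if "\<delta> > 0" for \<delta>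
  proof -
    have "(\<lambda>n. 2 / real (Suc n)) \<longlonglongrightarrow> 0"
      using tendsto_mult[OF tendsto_const[of 2] LIMSEQ_inverse_real_of_nat] by (simp add: divide_inverse)
    from order_tendstoD(2)[OF this that] show ?thesis by (simp add: eventually_sequentially)
  qed
  obtain \<sigma> where \<sigma>: "strict_mono \<sigma>" and "(\<exists>r>0. separated_sequence r (z \<circ> \<sigma>)) \<or> Cauchy (z \<circ> \<sigma>)"
    using separated_or_Cauchy_subsequence by blast
  then consider r where "r > 0" "separated_sequence r (z \<circ> \<sigma>)" | "Cauchy (z \<circ> \<sigma>)" by blast
  then have "\<exists>\<delta>>0. \<exists>J. infinite J \<and> (\<forall>\<eta>>0. \<exists>l. \<forall>j\<in>J. \<exists>p. \<forall>u v. dist (z (\<sigma> j)) u < \<delta> \<longrightarrow>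
      dist (z (\<sigma> j)) v < \<delta> \<longrightarrow> linked (ball p \<epsilon>) \<eta> l u v)"
  proof cases
    case 1
    let ?A = "range (z \<circ> \<sigma>)"
    have "?A \<subseteq> S" using unlinked_pairsD(2)[OF bad] by (auto simp: z_def)
    then have bdd: "bounded ?A" using \<open>bounded S\<close> bounded_subset by blast
    have sep: "r \<le> dist u v" if "u \<in> ?A" "v \<in> ?A" "u \<noteq> v" for u v
      using that 1(2) unfolding separated_sequence_def by (metis imageE)
    have "?A \<noteq> {}" by simp
    obtain \<delta> where \<delta>: "\<delta> > 0" "\<And>\<eta>. \<eta> > 0 \<Longrightarrow>
        \<exists>l. \<forall>a\<in>?A. \<forall>y. dist a y < \<delta> \<longrightarrow> linked (ball a \<epsilon>) \<eta> l y a"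
      using absolute_retract_imp_separated_linking[OF AR bdd \<open>?A \<noteq> {}\<close> \<open>\<epsilon> > 0\<close> 1(1) sep] by metis
    have "\<exists>l. \<forall>j\<in>UNIV. \<exists>p. \<forall>u v. dist (z (\<sigma> j)) u < \<delta> \<longrightarrow> dist (z (\<sigma> j)) v < \<delta> \<longrightarrow>
        linked (ball p \<epsilon>) \<eta> l u v" if "\<eta> > 0" for \<eta>
    proof -
      obtain l where l: "\<And>a y. a \<in> ?A \<Longrightarrow> dist a y < \<delta> \<Longrightarrow> linked (ball a \<epsilon>) \<eta> l y a"
        using \<delta>(2)[OF \<open>\<eta> > 0\<close>] by blast
      have "linked (ball (z (\<sigma> j)) \<epsilon>) \<eta> (l + l) u v"
        if "dist (z (\<sigma> j)) u < \<delta>" "dist (z (\<sigma> j)) v < \<delta>" for j u v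
        using that by (intro linked_trans[OF l linked_sym[OF l]]) auto
      then show ?thesis by blast
    qed
    then show ?thesis using \<delta>(1) infinite_UNIV_nat by blast
  next
    case 2
    obtain J \<delta> p where J: "infinite J" "\<delta> > 0" "\<And>\<eta>. \<eta> > 0 \<Longrightarrow> \<exists>n. \<forall>j\<in>J. \<forall>u v.
        dist ((z \<circ> \<sigma>) j) u < \<delta> \<longrightarrow> dist ((z \<circ> \<sigma>) j) v < \<delta> \<longrightarrow> linked (ball p \<epsilon>) \<eta> n u v"
      by (rule absolute_retract_imp_Cauchy_linking[OF AR 2 \<open>\<epsilon> > 0\<close>]) blast
    show ?thesis
    proof (intro exI[of _ \<delta>] exI[of _ J] conjI allI impI J(1,2))
      fix \<eta> :: real assume "\<eta> > 0"
      then obtain n where "\<forall>j\<in>J. \<forall>u v. dist (z (\<sigma> j)) u < \<delta> \<longrightarrow> dist (z (\<sigma> j)) v < \<delta> \<longrightarrow>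
          linked (ball p \<epsilon>) \<eta> n u v"
        using J(3) unfolding o_apply by blast
      then show "\<exists>l. \<forall>j\<in>J. \<exists>p. \<forall>u v. dist (z (\<sigma> j)) u < \<delta> \<longrightarrow> dist (z (\<sigma> j)) v < \<delta> \<longrightarrow>
          linked (ball p \<epsilon>) \<eta> l u v"
        by (intro exI[of _ n] ballI exI[of _ p]) (rule bspec)
    qed
  qed
  then obtain \<delta> J where "\<delta> > 0" "infinite J" and J: "\<forall>\<eta>>0. \<exists>l. \<forall>j\<in>J. \<exists>p. \<forall>u v.
      dist (z (\<sigma> j)) u < \<delta> \<longrightarrow> dist (z (\<sigma> j)) v < \<delta> \<longrightarrow> linked (ball p \<epsilon>) \<eta> l u v"
    by (elim exE conjE)
  obtain N where N: "\<And>n. n \<ge> N \<Longrightarrow> 2 / real (Suc n) < \<delta>" using small[OF \<open>\<delta> > 0\<close>] by blast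
  obtain j where j: "j \<in> J" "j \<ge> N" using \<open>infinite J\<close> by (meson infinite_nat_iff_unbounded_le)
  define n where "n = \<sigma> j"
  have "n \<ge> N" using j(2) strict_mono_imp_increasing[OF \<sigma>, of j] by (simp add: n_def)
  obtain l where "\<forall>j\<in>J. \<exists>p. \<forall>u v. dist (z (\<sigma> j)) u < \<delta> \<longrightarrow> dist (z (\<sigma> j)) v < \<delta> \<longrightarrow>
      linked (ball p \<epsilon>) (\<eta> n) l u v"
    using J[rule_format, OF unlinked_pairsD(1)[OF bad[of n]]] by (elim exE)
  then obtain p where l: "\<forall>u v. dist (z n) u < \<delta> \<longrightarrow> dist (z n) v < \<delta> \<longrightarrow> linked (ball p \<epsilon>) (\<eta> n) l u v"
    using j(1) unfolding n_def by blast
  have "dist (z n) (X n l) < \<delta>" "dist (z n) (Y n l) < \<delta>"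
    using X[of n l] Y[of n l] N[OF \<open>n \<ge> N\<close>] divide_right_mono[of 1 2 "real (Suc n)"] by simp_all
  then have "linked (ball p \<epsilon>) (\<eta> n) l (X n l) (Y n l)" using l by blast
  then show False using unlinked_pairsD(5)[OF bad, of l l] by blast
qed

section \<open>Trails\<close>

text \<open>
  \<open>L a b\<close> is a path from \<open>a\<close> to \<open>b\<close> given by its pairs (point, time). It is defined only at
  countably many times, because in an incomplete space limits need not exist. The second condition is
  the one-sided form of uniform continuity that suffices for growing sets: from a point at time \<open>s\<close>
  one can go back to any slightly earlier time \<open>v\<close> without moving far. The third condition says that
  trails between close points are small. All conditions are uniform over \<open>S\<close>.
\<close>

definition trail_system :: "'a::metric_space set \<Rightarrow> ('a \<Rightarrow> 'a \<Rightarrow> ('a \<times> real) set) \<Rightarrow> bool" where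
  "trail_system S L \<longleftrightarrow>
    (\<forall>a\<in>S. \<forall>b\<in>S. (a, 0) \<in> L a b \<and> (b, 1) \<in> L a b \<and> (\<forall>(p, s)\<in>L a b. s \<le> 0 \<longrightarrow> p = a)) \<and>
    (\<forall>\<epsilon>>0. \<exists>\<zeta>>0. \<forall>a\<in>S. \<forall>b\<in>S. \<forall>(p, s)\<in>L a b. \<forall>v\<ge>0. s - v < \<zeta> \<longrightarrow>
      (\<exists>(q, t)\<in>L a b. t \<le> v \<and> dist p q < \<epsilon>)) \<and>
    (\<forall>\<epsilon>>0. \<exists>\<delta>>0. \<forall>a\<in>S. \<forall>b\<in>S. dist a b < \<delta> \<longrightarrow> (\<forall>(p, s)\<in>L a b. dist a p < \<epsilon>)) \<and>
    (\<exists>R. \<forall>a\<in>S. \<forall>b\<in>S. \<forall>(p, s)\<in>L a b. dist a p \<le> R)"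

lemma trail_systemD:
  assumes "trail_system S L"
  shows trail_system_start: "\<And>a b. a \<in> S \<Longrightarrow> b \<in> S \<Longrightarrow> (a, 0) \<in> L a b"
    and trail_system_end: "\<And>a b. a \<in> S \<Longrightarrow> b \<in> S \<Longrightarrow> (b, 1) \<in> L a b"
    and trail_system_0: "\<And>a b p s. a \<in> S \<Longrightarrow> b \<in> S \<Longrightarrow> (p, s) \<in> L a b \<Longrightarrow> s \<le> 0 \<Longrightarrow> p = a"
    and trail_system_back: "\<And>\<epsilon>. \<epsilon> > 0 \<Longrightarrow> \<exists>\<zeta>>0. \<forall>a\<in>S. \<forall>b\<in>S. \<forall>(p, s)\<in>L a b. \<forall>v\<ge>0. s - v < \<zeta> \<longrightarrow>
      (\<exists>(q, t)\<in>L a b. t \<le> v \<and> dist p q < \<epsilon>)"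
    and trail_system_small: "\<And>\<epsilon>. \<epsilon> > 0 \<Longrightarrow>
      \<exists>\<delta>>0. \<forall>a\<in>S. \<forall>b\<in>S. dist a b < \<delta> \<longrightarrow> (\<forall>(p, s)\<in>L a b. dist a p < \<epsilon>)"
    and trail_system_bounded: "\<exists>R. \<forall>a\<in>S. \<forall>b\<in>S. \<forall>(p, s)\<in>L a b. dist a p \<le> R"
proof -
  note parts = assms[unfolded trail_system_def]
  show "(a, 0) \<in> L a b" "(b, 1) \<in> L a b" if "a \<in> S" "b \<in> S" for a b
    using parts[THEN conjunct1] that by blast+
  show "p = a" if "a \<in> S" "b \<in> S" "(p, s) \<in> L a b" "s \<le> 0" for a b p s
    using parts[THEN conjunct1] that by blast
  show "\<exists>\<zeta>>0. \<forall>a\<in>S. \<forall>b\<in>S. \<forall>(p, s)\<in>L a b. \<forall>v\<ge>0. s - v < \<zeta> \<longrightarrow>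
      (\<exists>(q, t)\<in>L a b. t \<le> v \<and> dist p q < \<epsilon>)" if "\<epsilon> > 0" for \<epsilon>
    by (rule parts[THEN conjunct2, THEN conjunct1, THEN spec, THEN mp, OF that])
  show "\<exists>\<delta>>0. \<forall>a\<in>S. \<forall>b\<in>S. dist a b < \<delta> \<longrightarrow> (\<forall>(p, s)\<in>L a b. dist a p < \<epsilon>)" if "\<epsilon> > 0" for \<epsilon>
    by (rule parts[THEN conjunct2, THEN conjunct2, THEN conjunct1, THEN spec, THEN mp, OF that])
  show "\<exists>R. \<forall>a\<in>S. \<forall>b\<in>S. \<forall>(p, s)\<in>L a b. dist a p \<le> R"
    by (rule parts[THEN conjunct2, THEN conjunct2, THEN conjunct2])
qed

text \<open>
  The nested refinement: level \<open>k\<close> is a sequence of points, and \<open>F k x y\<close> inserts a chain with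
  \<open>l k\<close> steps between each two successive ones \<open>x\<close> and \<open>y\<close>. Sequences stay at \<open>b\<close> after the first
  step of level \<open>0\<close>, which spares a bound on the index.
\<close>

primrec trail_level ::
    "(nat \<Rightarrow> 'a \<Rightarrow> 'a \<Rightarrow> nat \<Rightarrow> 'a) \<Rightarrow> (nat \<Rightarrow> nat) \<Rightarrow> 'a \<Rightarrow> 'a \<Rightarrow> nat \<Rightarrow> nat \<Rightarrow> 'a" where
  "trail_level F l a b 0 = (\<lambda>n. if n = 0 then a else b)"
| "trail_level F l a b (Suc k) = (\<lambda>n. F k (trail_level F l a b k (n div l k))
     (trail_level F l a b k (Suc (n div l k))) (n mod l k))"

lemmas trail_level_Suc = trail_level.simps(2)

declare trail_level_Suc [simp del]

text \<open>
  The data of the refinement. The first subdivision joins arbitrary points of \<open>S\<close> inside \<open>Y\<close>, by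
  condition (i); the later ones join points at distance less than \<open>\<eta> k\<close> inside balls of radius
  \<open>(1/2) ^ Suc k\<close>, by condition (ii). All points remain at distance at most \<open>1\<close> from \<open>Y\<close>, a bounded
  region in which condition (ii) is uniform. The assumption \<open>F_close\<close> demands a trivial chain whenever two
  points are close enough for the next level already. It makes trails between close points small.
\<close>

locale chain_refinement =
  fixes S Y :: "'a::metric_space set" and \<eta> :: "nat \<Rightarrow> real" and l :: "nat \<Rightarrow> nat"
    and F :: "nat \<Rightarrow> 'a \<Rightarrow> 'a \<Rightarrow> nat \<Rightarrow> 'a"
  assumes bounded_Y: "bounded Y"
    and S_subset_Y: "S \<subseteq> Y"
    and \<eta>_pos: "0 < \<eta> k"
    and \<eta>_le: "\<eta> k \<le> (1/2) ^ k"
    and l_pos: "0 < l k"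
    and F_0: "F k x y 0 = x"
    and F_close: "dist x y < \<eta> k \<Longrightarrow> F k x y j \<in> {x, y}"
    and F_first: "x \<in> S \<Longrightarrow> y \<in> S \<Longrightarrow>
      F 0 x y (l 0) = y \<and> dist (F 0 x y j) (F 0 x y (Suc j)) < \<eta> 0 \<and> F 0 x y j \<in> Y"
    and F_Suc: "\<exists>u\<in>Y. dist u x \<le> 1 \<Longrightarrow> \<exists>u\<in>Y. dist u y \<le> 1 \<Longrightarrow> dist x y < \<eta> k \<Longrightarrow>
      F (Suc k) x y (l (Suc k)) = y \<and> dist (F (Suc k) x y j) (F (Suc k) x y (Suc j)) < \<eta> (Suc k) \<and>
      dist x (F (Suc k) x y j) < (1/2) ^ Suc k"
begin

abbreviation level :: "'a \<Rightarrow> 'a \<Rightarrow> nat \<Rightarrow> nat \<Rightarrow> 'a" where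
  "level \<equiv> trail_level F l"

definition steps :: "nat \<Rightarrow> nat" where
  "steps k = (\<Prod>i<k. l i)"

definition trail :: "'a \<Rightarrow> 'a \<Rightarrow> ('a \<times> real) set" where
  "trail a b = {(level a b k n, real n / real (steps k)) | k n. True}"

lemma steps_0 [simp]: "steps 0 = 1" and steps_Suc: "steps (Suc k) = steps k * l k" and steps_pos: "0 < steps k"
  using l_pos by (simp_all add: steps_def prod_pos)

text \<open>
  At the end of a block the successor starts the next block. As chains end where the next one begins, the
  formula inside a block holds there too.
\<close>

lemma level_Suc_Suc:
  assumes "F k (level a b k (n div l k)) (level a b k (Suc (n div l k))) (l k) = level a b k (Suc (n div l k))"
  shows "level a b (Suc k) (Suc n) =
    F k (level a b k (n div l k)) (level a b k (Suc (n div l k))) (Suc (n mod l k))"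
proof (cases "Suc (n mod l k) = l k")
  case True
  then have "Suc n mod l k = 0" "Suc n div l k = Suc (n div l k)"
    by (simp_all add: mod_Suc div_Suc)
  then show ?thesis using assms True by (simp add: F_0 trail_level_Suc)
next
  case False
  then have "Suc n mod l k = Suc (n mod l k)" "Suc n div l k = n div l k"
    by (simp_all add: mod_Suc div_Suc)
  then show ?thesis by (simp add: trail_level_Suc)
qed

context
  fixes a b :: 'a
  assumes a: "a \<in> S" and b: "b \<in> S"
begin

text \<open>
  The radii of the balls add up to less than \<open>1\<close>, hence all levels remain near \<open>Y\<close>.
\<close>

lemma level_chain:
  "(\<exists>u\<in>Y. dist u (level a b (Suc k) n) \<le> 1 - (1/2) ^ k) \<and>
    dist (level a b (Suc k) n) (level a b (Suc k) (Suc n)) < \<eta> k"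
proof (induction k arbitrary: n)
  case 0
  have "level a b 0 i \<in> S" for i using a b by simp
  then have F: "F 0 (level a b 0 i) (level a b 0 i') (l 0) = level a b 0 i'"
    "dist (F 0 (level a b 0 i) (level a b 0 i') j) (F 0 (level a b 0 i) (level a b 0 i') (Suc j)) < \<eta> 0"
    "F 0 (level a b 0 i) (level a b 0 i') j \<in> Y" for i i' j
    using F_first by blast+
  have "level a b (Suc 0) n \<in> Y" unfolding trail_level_Suc by (rule F(3))
  then have "\<exists>u\<in>Y. dist u (level a b (Suc 0) n) \<le> 1 - (1/2) ^ 0"
    by (intro bexI[of _ "level a b (Suc 0) n"]) simp_all
  moreover have "dist (level a b (Suc 0) n) (level a b (Suc 0) (Suc n)) < \<eta> 0"
    unfolding level_Suc_Suc[OF F(1)] unfolding trail_level_Suc by (rule F(2))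
  ultimately show ?case by blast
next
  case (Suc k)
  let ?c = "level a b (Suc k)" and ?i = "n div l (Suc k)"
  have half: "(1/2::real) ^ k \<ge> 0" by simp
  have near: "\<exists>u\<in>Y. dist u (?c i) \<le> 1" for i
  proof -
    obtain u where "u \<in> Y" "dist u (?c i) \<le> 1 - (1/2) ^ k" using Suc[of i] by blast
    then show ?thesis using half by (intro bexI[of _ u]) linarith+
  qed
  have F: "F (Suc k) (?c ?i) (?c (Suc ?i)) (l (Suc k)) = ?c (Suc ?i)"
    "dist (F (Suc k) (?c ?i) (?c (Suc ?i)) j) (F (Suc k) (?c ?i) (?c (Suc ?i)) (Suc j)) < \<eta> (Suc k)"
    "dist (?c ?i) (F (Suc k) (?c ?i) (?c (Suc ?i)) j) < (1/2) ^ Suc k" for j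
    using F_Suc[OF near near, of ?i "Suc ?i" k] Suc[of ?i] by blast+
  have "dist (level a b (Suc (Suc k)) n) (level a b (Suc (Suc k)) (Suc n)) < \<eta> (Suc k)"
    using F(2) unfolding level_Suc_Suc[OF F(1)] unfolding trail_level_Suc[of F l a b "Suc k"] .
  moreover have "\<exists>u\<in>Y. dist u (level a b (Suc (Suc k)) n) \<le> 1 - (1/2) ^ Suc k"
  proof -
    obtain u where u: "u \<in> Y" "dist u (?c ?i) \<le> 1 - (1/2) ^ k" using Suc[of ?i] by blast
    have "dist (?c ?i) (level a b (Suc (Suc k)) n) < (1/2) ^ Suc k"
      using F(3) unfolding trail_level_Suc[of F l a b "Suc k"] .
    then have "dist u (level a b (Suc (Suc k)) n) \<le> 1 - (1/2) ^ k + (1/2) ^ Suc k"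
      using u(2) dist_triangle[of u "level a b (Suc (Suc k)) n" "?c ?i"] by linarith
    then show ?thesis using u(1) by (intro bexI[of _ u]) simp_all
  qed
  ultimately show ?case by blast
qed

lemma level_in_cball: "\<exists>u\<in>Y. dist u (level a b k n) \<le> 1"
proof (cases k)
  case 0
  then have "level a b k n \<in> Y" using a b S_subset_Y by auto
  then show ?thesis by (intro bexI[of _ "level a b k n"]) auto
next
  case (Suc i)
  have "(1/2::real) ^ i \<ge> 0" by simp
  then show ?thesis using level_chain[of i n] Suc by (metis diff_ge_0_iff_ge diff_le_eq le_add_same_cancel1 order_trans)
qed

lemma level_parent: "dist (level a b (Suc k) (n div l (Suc k))) (level a b (Suc (Suc k)) n) < (1/2) ^ Suc k"
proof -
  have "dist (level a b (Suc k) (n div l (Suc k))) (level a b (Suc k) (Suc (n div l (Suc k)))) < \<eta> k"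
    using level_chain by blast
  note F = F_Suc[OF level_in_cball level_in_cball this, THEN conjunct2, THEN conjunct2]
  show ?thesis unfolding trail_level_Suc[of F l a b "Suc k"] by (rule F)
qed

text \<open>
  Every point of a finer level lies near the point of level \<open>Suc k\<close> from whose block it descends, and
  it comes no earlier. The second conjunct compares the times \<open>i / steps (Suc k)\<close> and
  \<open>n / steps (Suc k + d)\<close> without division.
\<close>

lemma level_ancestor:
  "\<exists>i. dist (level a b (Suc k) i) (level a b (Suc k + d) n) \<le> 2 * (1/2) ^ Suc k - 2 * (1/2) ^ (Suc k + d) \<and>
    i * steps (Suc k + d) \<le> n * steps (Suc k)"
proof (induction d arbitrary: n)
  case 0
  then show ?case by (intro exI[of _ n]) simp
next
  case (Suc d)
  let ?j = "Suc k + d"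
  obtain i where i: "dist (level a b (Suc k) i) (level a b ?j (n div l ?j)) \<le> 2 * (1/2) ^ Suc k - 2 * (1/2) ^ ?j"
    "i * steps ?j \<le> (n div l ?j) * steps (Suc k)" using Suc by blast
  have "dist (level a b ?j (n div l ?j)) (level a b (Suc ?j) n) < (1/2) ^ ?j"
    using level_parent[of "k + d" n] by simp
  then have "dist (level a b (Suc k) i) (level a b (Suc ?j) n) \<le> 2 * (1/2) ^ Suc k - 2 * (1/2) ^ ?j + (1/2) ^ ?j"
    using i(1) dist_triangle[of "level a b (Suc k) i" "level a b (Suc ?j) n" "level a b ?j (n div l ?j)"]
    by linarith
  moreover have "i * steps (Suc ?j) \<le> n * steps (Suc k)"
  proof -
    have "i * steps (Suc ?j) = i * steps ?j * l ?j" by (simp add: steps_Suc)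
    also have "\<dots> \<le> (n div l ?j) * steps (Suc k) * l ?j" using i(2) by (intro mult_right_mono) auto
    also have "\<dots> = (n div l ?j * l ?j) * steps (Suc k)" by (simp only: mult_ac)
    also have "\<dots> \<le> n * steps (Suc k)" by (intro mult_right_mono) auto
    finally show ?thesis .
  qed
  ultimately show ?case by (intro exI[of _ i]) (simp add: field_simps)
qed

text \<open>
  Conversely, the points of a level occur in all finer levels at the same time.
\<close>

lemma level_refine: "\<exists>i. level a b (k + d) i = level a b k n \<and> i * steps k = n * steps (k + d)"
proof (induction d)
  case 0
  then show ?case by auto
next
  case (Suc d)
  then obtain i where i: "level a b (k + d) i = level a b k n" "i * steps k = n * steps (k + d)" by blast
  have "level a b (k + Suc d) (i * l (k + d)) = level a b k n"
    using i(1) l_pos[of "k + d"] by (simp add: F_0 trail_level_Suc)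
  moreover have "i * l (k + d) * steps k = n * steps (k + Suc d)"
    using i(2) by (simp add: steps_Suc mult_ac)
  ultimately show ?case by blast
qed

lemma trail_approx:
  assumes "(p, s) \<in> trail a b"
  shows "\<exists>i. dist p (level a b (Suc k) i) \<le> 2 * (1/2) ^ Suc k \<and> real i / real (steps (Suc k)) \<le> s"
proof -
  obtain j n where p: "p = level a b j n" "s = real n / real (steps j)"
    using assms unfolding trail_def by blast
  show ?thesis
  proof (cases "j \<le> Suc k")
    case True
    then obtain d where d: "Suc k = j + d" using le_Suc_ex by blast
    obtain i where i: "level a b (j + d) i = level a b j n" "i * steps j = n * steps (j + d)"
      using level_refine by blast
    have "real i * real (steps j) = real n * real (steps (Suc k))"
      using i(2) d by (metis of_nat_mult)
    then have "real i / real (steps (Suc k)) = s"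
      using steps_pos[of j] steps_pos[of "Suc k"] unfolding p(2) by (simp add: frac_eq_eq)
    then show ?thesis using i(1) d p(1) by (intro exI[of _ i]) simp
  next
    case False
    then obtain d where d: "j = Suc k + d" using le_Suc_ex nat_le_linear by blast
    obtain i where i: "dist (level a b (Suc k) i) (level a b j n) \<le> 2 * (1/2) ^ Suc k - 2 * (1/2) ^ j"
      "i * steps j \<le> n * steps (Suc k)" using level_ancestor[of k d n] d by blast
    have "real i * real (steps j) \<le> real n * real (steps (Suc k))"
      using i(2) by (metis of_nat_mult of_nat_le_iff)
    then have "real i / real (steps (Suc k)) \<le> s"
      using steps_pos[of j] steps_pos[of "Suc k"] unfolding p(2) by (simp add: divide_simps mult.commute)
    moreover have "(1/2::real) ^ j \<ge> 0" by simp
    then have "dist p (level a b (Suc k) i) \<le> 2 * (1/2) ^ Suc k"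
      using i(1) p(1) by (simp only: dist_commute)
    ultimately show ?thesis by blast
  qed
qed

text \<open>
  Go to the point of level \<open>Suc k\<close> in whose block \<open>p\<close> lies; if this is still too late, its
  predecessor is early enough, since the points of this level have distance \<open>1 / steps (Suc k)\<close> in time.
\<close>

lemma trail_back:
  assumes "(p, s) \<in> trail a b" "v \<ge> 0" "s - v < 1 / real (steps (Suc k))"
  shows "\<exists>(q, t)\<in>trail a b. t \<le> v \<and> dist p q < 4 * (1/2) ^ Suc k"
proof -
  let ?N = "real (steps (Suc k))"
  obtain i where i: "dist p (level a b (Suc k) i) \<le> 2 * (1/2) ^ Suc k" "real i / ?N \<le> s"
    using trail_approx[OF assms(1)] by blast
  have in_trail: "(level a b (Suc k) j, real j / ?N) \<in> trail a b" for j
    unfolding trail_def by blast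
  show ?thesis
  proof (cases "real i / ?N \<le> v")
    case True
    moreover have "2 * (1/2) ^ Suc k < 4 * (1/2::real) ^ Suc k" by simp
    ultimately show ?thesis using i(1) le_less_trans by (intro bexI[OF _ in_trail[of i]]) blast
  next
    case False
    then have "i \<noteq> 0" using assms(2) by (cases "i = 0") auto
    then obtain j where j: "i = Suc j" by (cases i) auto
    have "real j / ?N = real i / ?N - 1 / ?N" by (simp add: j diff_divide_distrib[symmetric])
    then have "real j / ?N \<le> v" using i(2) assms(3) by linarith
    moreover have "dist (level a b (Suc k) i) (level a b (Suc k) j) < 2 * (1/2) ^ Suc k"
      using level_chain[of k j] \<eta>_le[of k] unfolding j by (simp add: dist_commute)
    then have "dist p (level a b (Suc k) j) < 4 * (1/2) ^ Suc k"
      using i(1) dist_triangle[of p "level a b (Suc k) j" "level a b (Suc k) i"] by linarith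
    ultimately show ?thesis by (intro bexI[OF _ in_trail[of j]]) auto
  qed
qed

text \<open>
  The first levels are trivial by \<open>F_close\<close>, they consist of \<open>a\<close> and \<open>b\<close> only. All other points
  descend from these within a small distance.
\<close>

lemma trail_near_start:
  assumes "\<And>i. i \<le> k \<Longrightarrow> dist a b < \<eta> i" "(p, s) \<in> trail a b"
  shows "dist a p < 2 * (1/2) ^ k"
proof -
  have ab: "level a b j n \<in> {a, b}" if "j \<le> Suc k" for j n
    using that
  proof (induction j arbitrary: n)
    case (Suc j)
    let ?x = "level a b j (n div l j)" and ?y = "level a b j (Suc (n div l j))"
    have xy: "?x \<in> {a, b}" "?y \<in> {a, b}" using Suc.IH Suc.prems Suc_leD by blast+
    then have "dist ?x ?y \<le> dist a b" by (auto simp: dist_commute)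
    then have "dist ?x ?y < \<eta> j" using assms(1)[of j] Suc.prems by simp
    then have "level a b (Suc j) n \<in> {?x, ?y}" unfolding trail_level_Suc by (rule F_close)
    then show ?case using xy by auto
  qed simp
  obtain i where i: "dist p (level a b (Suc k) i) \<le> 2 * (1/2) ^ Suc k"
    using trail_approx[OF assms(2)] by blast
  have "dist a b < (1/2) ^ k" using assms(1)[of k] \<eta>_le[of k] by simp
  then have "dist a (level a b (Suc k) i) < (1/2) ^ k" using ab[of "Suc k" i] by auto
  then show ?thesis using i dist_triangle2[of a p "level a b (Suc k) i"] by simp
qed

end

lemma trail_system_trail: "trail_system S trail"
  unfolding trail_system_def
proof (intro conjI allI impI ballI)
  fix a b assume ab: "a \<in> S" "b \<in> S"
  have "(level a b 0 n, real n / real (steps 0)) \<in> trail a b" for n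
    unfolding trail_def by blast
  from this[of 0] this[of 1] show "(a, 0) \<in> trail a b" "(b, 1) \<in> trail a b"
    by simp_all
  have first: "level a b k 0 = a" for k by (induction k) (simp_all add: F_0 trail_level_Suc)
  fix z assume "z \<in> trail a b"
  then obtain k n where "z = (level a b k n, real n / real (steps k))"
    unfolding trail_def by blast
  then show "case z of (p, s) \<Rightarrow> s \<le> 0 \<longrightarrow> p = a"
    using first steps_pos[of k] by (auto simp: divide_le_0_iff)
next
  fix \<epsilon> :: real assume "\<epsilon> > 0"
  then obtain k where k: "(1/2::real) ^ k < \<epsilon> / 2"
    using real_arch_pow_inv[of "\<epsilon>/2" "1/2"] by auto
  then have k4: "4 * (1/2) ^ Suc k < \<epsilon>" by simp
  have "\<exists>(q, t)\<in>trail a b. t \<le> v \<and> dist p q < \<epsilon>"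
    if *: "a \<in> S" "b \<in> S" "(p, s) \<in> trail a b" "v \<ge> 0" "s - v < 1 / real (steps (Suc k))" for a b p s v
  proof -
    obtain z where "z \<in> trail a b" "snd z \<le> v" "dist p (fst z) < 4 * (1/2) ^ Suc k"
      using trail_back[OF *] by (auto simp: case_prod_unfold)
    then show ?thesis using k4 by (intro bexI[of _ z]) (auto simp: case_prod_unfold)
  qed
  then show "\<exists>\<zeta>>0. \<forall>a\<in>S. \<forall>b\<in>S. \<forall>(p, s)\<in>trail a b. \<forall>v\<ge>0. s - v < \<zeta> \<longrightarrow>
      (\<exists>(q, t)\<in>trail a b. t \<le> v \<and> dist p q < \<epsilon>)"
    using steps_pos[of "Suc k"] by (intro exI[of _ "1 / real (steps (Suc k))"]) auto
next
  fix \<epsilon> :: real assume "\<epsilon> > 0"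
  then obtain k where k: "(1/2::real) ^ k < \<epsilon> / 2"
    using real_arch_pow_inv[of "\<epsilon>/2" "1/2"] by auto
  define \<delta> where "\<delta> = Min (\<eta> ` {..k})"
  have "\<delta> > 0" using \<eta>_pos by (auto simp: \<delta>_def)
  moreover have "dist a p < \<epsilon>"
    if "a \<in> S" "b \<in> S" "dist a b < \<delta>" "(p, s) \<in> trail a b" for a b p s
  proof -
    have "dist a b < \<eta> i" if "i \<le> k" for i
      using \<open>dist a b < \<delta>\<close> that by (auto simp: \<delta>_def)
    then show ?thesis using trail_near_start[OF \<open>a \<in> S\<close> \<open>b \<in> S\<close> _ \<open>(p, s) \<in> trail a b\<close>, of k] k by force
  qed
  ultimately show "\<exists>\<delta>>0. \<forall>a\<in>S. \<forall>b\<in>S. dist a b < \<delta> \<longrightarrow> (\<forall>(p, s)\<in>trail a b. dist a p < \<epsilon>)"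
    by (intro exI[of _ \<delta>]) blast
next
  obtain R where R: "\<And>u v. u \<in> Y \<Longrightarrow> v \<in> Y \<Longrightarrow> dist u v \<le> R"
    using bounded_Y unfolding bounded_two_points by blast
  have "dist a p \<le> R + 1" if abp: "a \<in> S" "b \<in> S" "(p, s) \<in> trail a b" for a b p s
  proof -
    obtain k n where "p = level a b k n" using abp(3) unfolding trail_def by blast
    then obtain u where "u \<in> Y" "dist u p \<le> 1" using level_in_cball[OF abp(1,2)] by blast
    then show ?thesis using R[of a u] abp(1) S_subset_Y dist_triangle[of a p u] by auto
  qed
  then show "\<exists>R. \<forall>a\<in>S. \<forall>b\<in>S. \<forall>(p, s)\<in>trail a b. dist a p \<le> R" by blast
qed

end

text \<open>
  One function selects all chains. They are prolonged by repetition of the last point, so that all have the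
  same length and no bound on the index is needed. The length is \<open>Suc l\<close>, not \<open>l\<close>, since the
  trivial chain from \<open>x\<close> to \<open>y\<close> needs one step even if \<open>l = 0\<close>.
\<close>

lemma uniform_chain_choice:
  fixes T :: "'a::metric_space \<Rightarrow> 'a set"
  assumes "\<forall>x y. Q x y \<longrightarrow> linked (T x) \<eta> l x y" "\<eta> > 0"
  shows "\<exists>m f. m > 0 \<and> (\<forall>x y. f x y 0 = x) \<and> (\<forall>x y j. dist x y < \<eta> \<longrightarrow> f x y j \<in> {x, y}) \<and>
    (\<forall>x y j. Q x y \<longrightarrow> f x y m = y \<and> dist (f x y j) (f x y (Suc j)) < \<eta> \<and> f x y j \<in> T x)"
proof -
  have "\<exists>c. c 0 = x \<and> (dist x y < \<eta> \<longrightarrow> (\<forall>j. c j \<in> {x, y})) \<and>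
      (Q x y \<longrightarrow> c (Suc l) = y \<and> (\<forall>j. dist (c j) (c (Suc j)) < \<eta> \<and> c j \<in> T x))" for x y
  proof (cases "Q x y")
    case True
    obtain k c where k: "k \<le> l" "c 0 = x" "c k = y" and c: "\<And>i. i \<le> k \<Longrightarrow> c i \<in> T x"
      "\<And>i. i < k \<Longrightarrow> dist (c i) (c (Suc i)) < \<eta>"
      using assms(1) True by (blast elim: linkedE)
    have "x \<in> T x" "y \<in> T x" using k c(1)[of 0] c(1)[of k] by auto
    show ?thesis
    proof (cases "dist x y < \<eta>")
      case True
      then show ?thesis using \<open>x \<in> T x\<close> \<open>y \<in> T x\<close> \<open>\<eta> > 0\<close>
        by (intro exI[of _ "\<lambda>j. if j = 0 then x else y"]) auto
    next
      case False
      have "dist (c (min j k)) (c (min (Suc j) k)) < \<eta>" for j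
        using c(2)[of j] \<open>\<eta> > 0\<close> by (cases "j < k") (auto simp: min_def)
      then show ?thesis
        using False k c(1) by (intro exI[of _ "\<lambda>j. c (min j k)"]) (auto simp: min_def)
    qed
  next
    case False
    then show ?thesis by (intro exI[of _ "\<lambda>j. x"]) auto
  qed
  then obtain f where f: "\<And>x y. f x y 0 = x \<and> (dist x y < \<eta> \<longrightarrow> (\<forall>j. f x y j \<in> {x, y})) \<and>
      (Q x y \<longrightarrow> f x y (Suc l) = y \<and> (\<forall>j. dist (f x y j) (f x y (Suc j)) < \<eta> \<and> f x y j \<in> T x))"
    by metis
  show ?thesis by (intro exI[of _ "Suc l"] exI[of _ f] conjI) (use f in \<open>blast+\<close>)
qed

lemma bounded_neighbourhood:
  fixes A :: "'a::metric_space set"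
  assumes "bounded A"
  shows "bounded {x. \<exists>a\<in>A. dist a x \<le> r}"
proof -
  obtain c R where R: "\<And>a. a \<in> A \<Longrightarrow> dist c a \<le> R" using assms unfolding bounded_def by blast
  have "dist c x \<le> R + r" if x: "x \<in> {x. \<exists>a\<in>A. dist a x \<le> r}" for x
  proof -
    obtain a where "a \<in> A" "dist a x \<le> r" using x by blast
    then show ?thesis using R[of a] dist_triangle[of c x a] by simp
  qed
  then show ?thesis unfolding bounded_def by blast
qed

text \<open>
  The step size \<open>\<eta> k\<close> is at most the \<open>\<delta>\<close> that condition (ii) gives for the radius of the next level, so
  the chains of each level can be refined again.
\<close>

lemma trail_system_on_bounded_set:
  fixes S Y :: "'a::metric_space set"
  assumes Y: "S \<subseteq> Y" "bounded Y" "chain_equi_connected Y"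
    and local: "\<And>T. bounded T \<Longrightarrow> unif_locally_chain_equi_connected_at (UNIV :: 'a set) T"
  shows "\<exists>L. trail_system S L"
proof -
  define Z where "Z = {x. \<exists>u\<in>Y. dist u x \<le> 1}"
  have "bounded Z" unfolding Z_def using Y(2) by (rule bounded_neighbourhood)
  have "\<exists>\<delta>>0. \<forall>\<eta>>0. \<exists>l. \<forall>x\<in>Z. \<forall>y\<in>Z. dist x y < \<delta> \<longrightarrow> linked (ball x ((1/2) ^ Suc k)) \<eta> l x y" for k
  proof -
    have "(1/2::real) ^ Suc k > 0" by simp
    from unif_locally_chain_equi_connected_atD[OF local[OF \<open>bounded Z\<close>] this] show ?thesis by metis
  qed
  then obtain \<delta> where \<delta>: "\<And>k. \<delta> k > 0"
    "\<And>k \<eta>. \<eta> > 0 \<Longrightarrow> \<exists>l. \<forall>x\<in>Z. \<forall>y\<in>Z. dist x y < \<delta> k \<longrightarrow> linked (ball x ((1/2) ^ Suc k)) \<eta> l x y"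
    by metis
  define \<eta> where "\<eta> k = min (\<delta> k) ((1/2) ^ k)" for k :: nat
  have \<eta>: "\<eta> k > 0" "\<eta> k \<le> \<delta> k" "\<eta> k \<le> (1/2) ^ k" for k
    using \<delta>(1) by (auto simp: \<eta>_def)
  (* what the function that inserts chains at level k has to satisfy *)
  define good where "good k m f \<longleftrightarrow> m > 0 \<and> (\<forall>x y. f x y 0 = x) \<and>
      (\<forall>x y j. dist x y < \<eta> k \<longrightarrow> f x y j \<in> {x, y}) \<and>
      (\<forall>x y j. x \<in> S \<longrightarrow> y \<in> S \<longrightarrow> k = 0 \<longrightarrow>
        f x y m = y \<and> dist (f x y j) (f x y (Suc j)) < \<eta> k \<and> f x y j \<in> Y) \<and>
      (\<forall>x y i j. x \<in> Z \<longrightarrow> y \<in> Z \<longrightarrow> k = Suc i \<longrightarrow> dist x y < \<eta> i \<longrightarrow>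
        f x y m = y \<and> dist (f x y j) (f x y (Suc j)) < \<eta> k \<and> f x y j \<in> ball x ((1/2) ^ k))"
    for k m and f :: "'a \<Rightarrow> 'a \<Rightarrow> nat \<Rightarrow> 'a"
  have "\<exists>m f. good k m f" for k
  proof (cases k)
    case 0
    obtain l where l: "\<forall>x\<in>Y. \<forall>y\<in>Y. linked Y (\<eta> 0) l x y"
      using Y(3) \<eta>(1)[of 0] unfolding chain_equi_connected_iff_linked by blast
    have link: "\<forall>x y. x \<in> S \<and> y \<in> S \<longrightarrow> linked Y (\<eta> 0) l x y" using l Y(1) by blast
    obtain m f where "m > 0 \<and> (\<forall>x y. f x y 0 = x) \<and> (\<forall>x y j. dist x y < \<eta> 0 \<longrightarrow> f x y j \<in> {x, y}) \<and>
      (\<forall>x y j. x \<in> S \<and> y \<in> S \<longrightarrow>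
        f x y m = y \<and> dist (f x y j) (f x y (Suc j)) < \<eta> 0 \<and> f x y j \<in> Y)"
      using uniform_chain_choice[of "\<lambda>x y. x \<in> S \<and> y \<in> S" "\<lambda>_. Y", OF link \<eta>(1)] by (elim exE)
    then have "good k m f" unfolding good_def using 0 by simp
    then show ?thesis by blast
  next
    case (Suc i)
    obtain l where l: "\<forall>x\<in>Z. \<forall>y\<in>Z. dist x y < \<delta> i \<longrightarrow> linked (ball x ((1/2) ^ Suc i)) (\<eta> k) l x y"
      using \<delta>(2)[OF \<eta>(1)] by blast
    have link: "\<forall>x y. x \<in> Z \<and> y \<in> Z \<and> dist x y < \<eta> i \<longrightarrow> linked (ball x ((1/2) ^ Suc i)) (\<eta> k) l x y"
      using l \<eta>(2)[of i] less_le_trans by blast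
    obtain m f where "m > 0 \<and> (\<forall>x y. f x y 0 = x) \<and> (\<forall>x y j. dist x y < \<eta> k \<longrightarrow> f x y j \<in> {x, y}) \<and>
      (\<forall>x y j. x \<in> Z \<and> y \<in> Z \<and> dist x y < \<eta> i \<longrightarrow>
        f x y m = y \<and> dist (f x y j) (f x y (Suc j)) < \<eta> k \<and> f x y j \<in> ball x ((1/2) ^ Suc i))"
      using uniform_chain_choice[of "\<lambda>x y. x \<in> Z \<and> y \<in> Z \<and> dist x y < \<eta> i" "\<lambda>x. ball x ((1/2) ^ Suc i)",
          OF link \<eta>(1)] by (elim exE)
    then have "good k m f" unfolding good_def using Suc by simp
    then show ?thesis by blast
  qed
  then obtain l F where good: "\<And>k. good k (l k) (F k)" by metis
  have "chain_refinement S Y \<eta> l F"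
  proof
    show "bounded Y" "S \<subseteq> Y" by fact+
    show "0 < \<eta> k" "\<eta> k \<le> (1/2) ^ k" for k by (fact \<eta>)+
    show "0 < l k" "F k x y 0 = x" for k x y
      using good[of k] unfolding good_def by blast+
    show "F k x y j \<in> {x, y}" if "dist x y < \<eta> k" for k x y j
      using good[of k] that unfolding good_def by blast
    show "F 0 x y (l 0) = y \<and> dist (F 0 x y j) (F 0 x y (Suc j)) < \<eta> 0 \<and> F 0 x y j \<in> Y"
      if "x \<in> S" "y \<in> S" for x y j
      using good[of 0] that unfolding good_def by blast
    show "F (Suc k) x y (l (Suc k)) = y \<and> dist (F (Suc k) x y j) (F (Suc k) x y (Suc j)) < \<eta> (Suc k) \<and>
        dist x (F (Suc k) x y j) < (1/2) ^ Suc k"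
      if "\<exists>u\<in>Y. dist u x \<le> 1" "\<exists>u\<in>Y. dist u y \<le> 1" "dist x y < \<eta> k" for k x y j
    proof -
      have "x \<in> Z" "y \<in> Z" using that by (simp_all add: Z_def)
      then have "F (Suc k) x y (l (Suc k)) = y \<and> dist (F (Suc k) x y j) (F (Suc k) x y (Suc j)) < \<eta> (Suc k) \<and>
          F (Suc k) x y j \<in> ball x ((1/2) ^ Suc k)"
        using good[of "Suc k"] that(3) unfolding good_def by blast
      then show ?thesis unfolding mem_ball .
    qed
  qed
  then show ?thesis using chain_refinement.trail_system_trail by blast
qed

lemma trail_system_subset:
  assumes "trail_system S L" "T \<subseteq> S"
  shows "trail_system T L"
  unfolding trail_system_def
proof (intro conjI allI impI)
  note L = assms(1)
  show "\<forall>a\<in>T. \<forall>b\<in>T. (a, 0) \<in> L a b \<and> (b, 1) \<in> L a b \<and> (\<forall>(p, s)\<in>L a b. s \<le> 0 \<longrightarrow> p = a)"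
  proof (intro ballI conjI)
    fix a b assume "a \<in> T" "b \<in> T"
    then have ab: "a \<in> S" "b \<in> S" using assms(2) by blast+
    show "(a, 0) \<in> L a b" "(b, 1) \<in> L a b"
      using trail_system_start[OF L ab] trail_system_end[OF L ab] .
    show "case z of (p, s) \<Rightarrow> s \<le> 0 \<longrightarrow> p = a" if "z \<in> L a b" for z
      using trail_system_0[OF L ab] that by (auto split: prod.splits)
  qed
  show "\<exists>\<zeta>>0. \<forall>a\<in>T. \<forall>b\<in>T. \<forall>(p, s)\<in>L a b. \<forall>v\<ge>0. s - v < \<zeta> \<longrightarrow>
      (\<exists>(q, t)\<in>L a b. t \<le> v \<and> dist p q < \<epsilon>)" if "\<epsilon> > 0" for \<epsilon>
    using trail_system_back[OF L that] assms(2) by (meson subsetD)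
  show "\<exists>\<delta>>0. \<forall>a\<in>T. \<forall>b\<in>T. dist a b < \<delta> \<longrightarrow> (\<forall>(p, s)\<in>L a b. dist a p < \<epsilon>)" if "\<epsilon> > 0" for \<epsilon>
    using trail_system_small[OF L that] assms(2) by (meson subsetD)
  show "\<exists>R. \<forall>a\<in>T. \<forall>b\<in>T. \<forall>(p, s)\<in>L a b. dist a p \<le> R"
    using trail_system_bounded[OF L] assms(2) by (meson subsetD)
qed

text \<open>
  On \<open>S n\<close> only the first \<open>n\<close> systems are used, hence the minimum of finitely many constants serves
  all of them.
\<close>

lemma trail_system_glue:
  fixes S :: "nat \<Rightarrow> 'a::metric_space set"
  assumes "\<And>j. trail_system (S j) (G j)"
    and lev: "\<And>a b n. a \<in> S n \<Longrightarrow> b \<in> S n \<Longrightarrow> lev a b \<le> n \<and> a \<in> S (lev a b) \<and> b \<in> S (lev a b)"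
  shows "trail_system (S n) (\<lambda>a b. G (lev a b) a b)"
  unfolding trail_system_def
proof (intro conjI allI impI)
  note G = assms(1)
  let ?L = "\<lambda>a b. G (lev a b) a b"
  show "\<forall>a\<in>S n. \<forall>b\<in>S n. (a, 0) \<in> ?L a b \<and> (b, 1) \<in> ?L a b \<and> (\<forall>(p, s)\<in>?L a b. s \<le> 0 \<longrightarrow> p = a)"
  proof (intro ballI conjI)
    fix a b assume "a \<in> S n" "b \<in> S n"
    then have ab: "a \<in> S (lev a b)" "b \<in> S (lev a b)" using lev by blast+
    show "(a, 0) \<in> ?L a b" "(b, 1) \<in> ?L a b"
      using trail_system_start[OF G ab] trail_system_end[OF G ab] .
    show "case z of (p, s) \<Rightarrow> s \<le> 0 \<longrightarrow> p = a" if "z \<in> ?L a b" for z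
      using trail_system_0[OF G ab] that by (auto split: prod.splits)
  qed
  show "\<exists>\<zeta>>0. \<forall>a\<in>S n. \<forall>b\<in>S n. \<forall>(p, s)\<in>?L a b. \<forall>v\<ge>0. s - v < \<zeta> \<longrightarrow>
      (\<exists>(q, t)\<in>?L a b. t \<le> v \<and> dist p q < \<epsilon>)" if "\<epsilon> > 0" for \<epsilon>
  proof -
    define ok where "ok j \<zeta> \<longleftrightarrow> (\<forall>a\<in>S j. \<forall>b\<in>S j. \<forall>(p, s)\<in>G j a b. \<forall>v\<ge>0. s - v < \<zeta> \<longrightarrow>
      (\<exists>(q, t)\<in>G j a b. t \<le> v \<and> dist p q < \<epsilon>))" for j \<zeta>
    have "\<forall>j. \<exists>\<zeta>>0. ok j \<zeta>" unfolding ok_def using trail_system_back[OF G that] by blast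
    then obtain \<zeta> where \<zeta>: "\<And>j. \<zeta> j > 0" "\<And>j. ok j (\<zeta> j)" by metis
    define \<zeta>' where "\<zeta>' = Min (\<zeta> ` {..n})"
    have "\<zeta>' > 0" "\<And>j. j \<le> n \<Longrightarrow> \<zeta>' \<le> \<zeta> j" using \<zeta>(1) by (auto simp: \<zeta>'_def)
    have "\<exists>(q, t)\<in>?L a b. t \<le> v \<and> dist p q < \<epsilon>"
      if ab: "a \<in> S n" "b \<in> S n" and p: "(p, s) \<in> ?L a b" and v: "v \<ge> 0" "s - v < \<zeta>'" for a b p s v
    proof -
      have l: "lev a b \<le> n" "a \<in> S (lev a b)" "b \<in> S (lev a b)" using lev[OF ab] by blast+
      have "s - v < \<zeta> (lev a b)" using v(2) \<open>\<And>j. j \<le> n \<Longrightarrow> \<zeta>' \<le> \<zeta> j\<close>[OF l(1)] by linarith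
      then show ?thesis using \<zeta>(2)[of "lev a b", unfolded ok_def] l(2,3) p v(1) by blast
    qed
    then show ?thesis using \<open>\<zeta>' > 0\<close> by (intro exI[of _ \<zeta>'] conjI) auto
  qed
  show "\<exists>\<delta>>0. \<forall>a\<in>S n. \<forall>b\<in>S n. dist a b < \<delta> \<longrightarrow> (\<forall>(p, s)\<in>?L a b. dist a p < \<epsilon>)" if "\<epsilon> > 0" for \<epsilon>
  proof -
    define ok where "ok j \<delta> \<longleftrightarrow> (\<forall>a\<in>S j. \<forall>b\<in>S j. dist a b < \<delta> \<longrightarrow> (\<forall>(p, s)\<in>G j a b. dist a p < \<epsilon>))" for j \<delta>
    have "\<forall>j. \<exists>\<delta>>0. ok j \<delta>" unfolding ok_def using trail_system_small[OF G that] by blast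
    then obtain \<delta> where \<delta>: "\<And>j. \<delta> j > 0" "\<And>j. ok j (\<delta> j)" by metis
    define \<delta>' where "\<delta>' = Min (\<delta> ` {..n})"
    have "\<delta>' > 0" "\<And>j. j \<le> n \<Longrightarrow> \<delta>' \<le> \<delta> j" using \<delta>(1) by (auto simp: \<delta>'_def)
    have "dist a p < \<epsilon>"
      if ab: "a \<in> S n" "b \<in> S n" and p: "(p, s) \<in> ?L a b" and d: "dist a b < \<delta>'" for a b p s
    proof -
      have l: "lev a b \<le> n" "a \<in> S (lev a b)" "b \<in> S (lev a b)" using lev[OF ab] by blast+
      have "dist a b < \<delta> (lev a b)" using d \<open>\<And>j. j \<le> n \<Longrightarrow> \<delta>' \<le> \<delta> j\<close>[OF l(1)] by linarith
      then show ?thesis using \<delta>(2)[of "lev a b", unfolded ok_def] l(2,3) p by blast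
    qed
    then show ?thesis using \<open>\<delta>' > 0\<close> by (intro exI[of _ \<delta>'] conjI) auto
  qed
  show "\<exists>R. \<forall>a\<in>S n. \<forall>b\<in>S n. \<forall>(p, s)\<in>?L a b. dist a p \<le> R"
  proof -
    define ok where "ok j R \<longleftrightarrow> (\<forall>a\<in>S j. \<forall>b\<in>S j. \<forall>(p, s)\<in>G j a b. dist a p \<le> R)" for j R
    have "\<forall>j. \<exists>R. ok j R" unfolding ok_def using trail_system_bounded[OF G] by blast
    then obtain R where R: "\<And>j. ok j (R j)" by metis
    define R' where "R' = Max (R ` {..n})"
    have R': "R j \<le> R'" if "j \<le> n" for j using that by (auto simp: R'_def)
    have "dist a p \<le> R'" if ab: "a \<in> S n" "b \<in> S n" and p: "(p, s) \<in> ?L a b" for a b p s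
    proof -
      have l: "lev a b \<le> n" "a \<in> S (lev a b)" "b \<in> S (lev a b)" using lev[OF ab] by blast+
      have "dist a p \<le> R (lev a b)" using R[of "lev a b", unfolded ok_def] l(2,3) p by blast
      then show ?thesis using R'[OF l(1)] by linarith
    qed
    then show ?thesis by (intro exI[of _ R']) auto
  qed
qed

text \<open>
  The trails constructed so far depend on the bounded set. Balls with integral radii are glued by taking for
  each pair of points the first ball that contains both.
\<close>

proposition trail_system_exists:
  assumes Y: "\<And>S :: 'a::metric_space set. bounded S \<Longrightarrow> \<exists>Y. S \<subseteq> Y \<and> bounded Y \<and> chain_equi_connected Y"
    and local: "\<And>S. bounded S \<Longrightarrow> unif_locally_chain_equi_connected_at (UNIV :: 'a::metric_space set) S"
  obtains L :: "'a::metric_space \<Rightarrow> 'a \<Rightarrow> ('a \<times> real) set" where "\<And>S. bounded S \<Longrightarrow> trail_system S L"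
proof -
  define x0 :: 'a where "x0 = undefined"
  define S where "S n = cball x0 (real n)" for n
  have "\<exists>G. trail_system (S j) G" for j
    using Y[of "S j"] trail_system_on_bounded_set local by (metis S_def bounded_cball)
  then obtain G where G: "\<And>j. trail_system (S j) (G j)" by metis
  define lev where "lev a b = nat \<lceil>max (dist x0 a) (dist x0 b)\<rceil>" for a b
  have lev: "lev a b \<le> n \<and> a \<in> S (lev a b) \<and> b \<in> S (lev a b)" if "a \<in> S n" "b \<in> S n" for a b n
  proof -
    have "max (dist x0 a) (dist x0 b) \<le> real (lev a b)" unfolding lev_def by (rule real_nat_ceiling_ge)
    moreover have "lev a b \<le> n" using that by (simp add: lev_def S_def ceiling_le_iff)
    ultimately show ?thesis by (auto simp: S_def)
  qed
  have glued: "trail_system (S n) (\<lambda>a b. G (lev a b) a b)" for n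
    using G lev by (rule trail_system_glue)
  show ?thesis
  proof (rule that)
    fix T :: "'a set" assume "bounded T"
    then obtain e where e: "\<And>x. x \<in> T \<Longrightarrow> dist x0 x \<le> e"
      using bounded_any_center[of T x0] by blast
    have "T \<subseteq> S (nat \<lceil>e\<rceil>)"
      using e real_nat_ceiling_ge[of e] by (force simp: S_def intro: order_trans)
    then show "trail_system T (\<lambda>a b. G (lev a b) a b)"
      using glued trail_system_subset by blast
  qed
qed

section \<open>The retraction\<close>

text \<open>
  Decreases from \<open>1\<close> to \<open>0\<close> on the interval from \<open>c - 1\<close> to \<open>c\<close>.
\<close>

definition cutoff :: "real \<Rightarrow> real \<Rightarrow> real" where
  "cutoff c q = max 0 (min 1 (c - q))"

lemma cutoff_bounds: "0 \<le> cutoff c q" "cutoff c q \<le> 1"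
  by (auto simp: cutoff_def)

lemma cutoff_pos_iff: "0 < cutoff c q \<longleftrightarrow> q < c"
  by (auto simp: cutoff_def)

lemma cutoff_eq_1: "q \<le> c - 1 \<Longrightarrow> cutoff c q = 1"
  by (simp add: cutoff_def)

text \<open>
  The estimate contains neither \<open>x\<close> nor \<open>y\<close>, although the quotients are not uniformly continuous for
  unbounded \<open>x\<close>: where both quotients exceed \<open>4\<close> the cutoff vanishes. This is the uniformity
  over all sets of the hyperspace that makes the retraction continuous.
\<close>

lemma cutoff_quotient_diff:
  assumes "\<bar>x - y\<bar> \<le> e" "\<bar>D - E\<bar> \<le> e" "e \<le> D / 2" "0 < D" "0 \<le> x" "0 \<le> y" "c \<le> 4"
  shows "\<bar>cutoff c (x / D) - cutoff c (y / E)\<bar> \<le> 10 * e / D"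
proof -
  have E: "E \<ge> D / 2" "E > 0" using assms by linarith+
  have "e \<ge> 0" using assms(1) by linarith
  have lip: "\<bar>cutoff c u - cutoff c v\<bar> \<le> \<bar>u - v\<bar>" for u v by (auto simp: cutoff_def)
  consider "y / E \<le> 4" | "x / D \<le> 4" | "y / E > 4" "x / D > 4" by linarith
  then show ?thesis
  proof cases
    case 1
    have "x / D - y / E = ((x - y) + (y / E) * (E - D)) / D"
      using E assms(4) by (simp add: field_simps)
    moreover have "\<bar>(x - y) + (y / E) * (E - D)\<bar> \<le> e + 4 * e"
    proof -
      have "\<bar>(y / E) * (E - D)\<bar> \<le> 4 * e"
        unfolding abs_mult using 1 E assms(2,6) by (intro mult_mono) auto
      then show ?thesis by (rule order_trans[OF abs_triangle_ineq add_mono[OF assms(1)]])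
    qed
    ultimately have "\<bar>x / D - y / E\<bar> \<le> 5 * e / D"
      using assms(4) by (simp add: divide_right_mono)
    moreover have "5 * e / D \<le> 10 * e / D" using \<open>e \<ge> 0\<close> assms(4) by (simp add: divide_right_mono)
    ultimately show ?thesis using lip[of "x / D" "y / E"] by linarith
  next
    case 2
    have "x / D - y / E = ((x - y) + (x / D) * (E - D)) / E"
      using E assms(4) by (simp add: field_simps)
    moreover have "\<bar>(x - y) + (x / D) * (E - D)\<bar> \<le> e + 4 * e"
    proof -
      have "\<bar>(x / D) * (E - D)\<bar> \<le> 4 * e"
        unfolding abs_mult using 2 assms(2,4,5) by (intro mult_mono) auto
      then show ?thesis by (rule order_trans[OF abs_triangle_ineq add_mono[OF assms(1)]])
    qed
    ultimately have "\<bar>x / D - y / E\<bar> \<le> 5 * e / E"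
      using E by (simp add: divide_right_mono)
    also have "\<dots> \<le> 5 * e / (D / 2)"
      using E \<open>e \<ge> 0\<close> assms(4) by (intro divide_left_mono) auto
    also have "\<dots> = 10 * e / D" by simp
    finally show ?thesis using lip[of "x / D" "y / E"] by linarith
  next
    case 3
    then have "cutoff c (x / D) = 0" "cutoff c (y / E) = 0" using assms(7) by (auto simp: cutoff_def)
    then show ?thesis using \<open>e \<ge> 0\<close> assms(4) by simp
  qed
qed

text \<open>
  The factor \<open>2\<close> makes room for an infimum that is not attained, and it allows equality, which is needed
  when \<open>A = B\<close>. The condition depends on \<open>A\<close> and \<open>B\<close> only, so the trails that are used do not change
  with \<open>m\<close>.
\<close>

lemma hausdorff_dist_witness:
  assumes "A \<in> Bd_sets" "B \<in> Bd_sets" "b \<in> B"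
  shows "\<exists>a\<in>A. dist a b \<le> 2 * hausdorff_dist A B"
proof (cases "A = B")
  case True
  then show ?thesis using assms by (intro bexI[of _ b]) (auto simp: hausdorff_dist_self)
next
  case False
  then have "0 < hausdorff_dist B A"
    using hausdorff_dist_nonneg[OF assms(2,1)] hausdorff_dist_eq_0[OF assms(2,1)] by auto
  then have "hausdorff_dist B A < 2 * hausdorff_dist B A" by simp
  then obtain a where "a \<in> A" "dist b a < 2 * hausdorff_dist B A"
    using hausdorff_dist_near[OF assms(2,1) _ assms(3)] by blast
  then show ?thesis by (intro bexI[of _ a]) (auto simp: dist_commute hausdorff_dist_commute)
qed

locale hyperspace_embedding = Metric_space M d for M :: "'m set" and d +
  fixes f :: "'a::metric_space set \<Rightarrow> 'm" and L :: "'a \<Rightarrow> 'a \<Rightarrow> ('a \<times> real) set"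
  assumes f_in: "A \<in> Bd_sets \<Longrightarrow> f A \<in> M"
    and f_isometry: "A \<in> Bd_sets \<Longrightarrow> B \<in> Bd_sets \<Longrightarrow> d (f A) (f B) = hausdorff_dist A B"
    and closed_image: "closedin mtopology (f ` Bd_sets)"
    and trails: "bounded S \<Longrightarrow> trail_system S L"
begin

definition gap :: "'m \<Rightarrow> real" where
  "gap m = (INF A\<in>Bd_sets. d m (f A))"

text \<open>
  Weights are functions of the distance from \<open>m\<close> in units of the gap. A source still has full target
  weight, since \<open>3\<close> is the end of the range of sources and the beginning of the decline of targets.
\<close>

definition source_weight :: "'a set \<Rightarrow> 'm \<Rightarrow> real" where
  "source_weight A m = cutoff 3 (d m (f A) / gap m)"

definition target_weight :: "'a set \<Rightarrow> 'm \<Rightarrow> real" where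
  "target_weight A m = cutoff 4 (d m (f A) / gap m)"

text \<open>
  The time up to which a trail is followed fades out with either weight. A source contributes at least
  its own points, at time \<open>0\<close>, as long as its weight is positive.
\<close>

definition cloud :: "'m \<Rightarrow> 'a set" where
  "cloud m = {p. \<exists>A B a b s. A \<in> Bd_sets \<and> B \<in> Bd_sets \<and> a \<in> A \<and> b \<in> B \<and>
     0 < source_weight A m \<and> 0 < target_weight B m \<and> dist a b \<le> 2 * hausdorff_dist A B \<and>
     (p, s) \<in> L a b \<and> s \<le> source_weight A m * target_weight B m}"

definition retract_set :: "'m \<Rightarrow> 'a set" where
  "retract_set m = (if m \<in> f ` Bd_sets then inv_into Bd_sets f m else closure (cloud m))"

lemma Bd_sets_UNIV_nonempty: "(Bd_sets :: 'a set set) \<noteq> {}"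
  using singleton_in_Bd_sets by blast

lemma gap_le: "A \<in> Bd_sets \<Longrightarrow> gap m \<le> d m (f A)"
  unfolding gap_def by (rule cINF_lower) (auto intro!: bdd_belowI2[where m = 0])

lemma gap_lipschitz:
  assumes "m \<in> M" "m' \<in> M"
  shows "\<bar>gap m - gap m'\<bar> \<le> d m m'"
proof -
  have "gap x - d x y \<le> gap y" if xy: "x \<in> M" "y \<in> M" for x y
    unfolding gap_def[of y]
  proof (rule cINF_greatest[OF Bd_sets_UNIV_nonempty])
    fix A :: "'a set" assume A: "A \<in> Bd_sets"
    show "gap x - d x y \<le> d y (f A)"
      using gap_le[OF A, of x] triangle[OF xy f_in[OF A]] by linarith
  qed
  from this[OF assms] this[OF assms(2,1)] show ?thesis by (simp add: commute)
qed

lemma gap_pos: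
  assumes "m \<in> M" "m \<notin> f ` Bd_sets"
  shows "0 < gap m"
proof -
  obtain r where r: "r > 0" "disjnt (f ` Bd_sets) (mball m r)"
    using closed_image assms unfolding closedin_metric by blast
  have "r \<le> d m (f A)" if "A \<in> Bd_sets" for A
    using r(2) that assms(1) f_in[OF that] unfolding disjnt_def by (force simp: in_mball not_less[symmetric])
  then have "r \<le> gap m" unfolding gap_def by (intro cINF_greatest Bd_sets_UNIV_nonempty)
  then show ?thesis using r(1) by simp
qed

lemma exists_source:
  assumes "0 < gap m"
  obtains A where "A \<in> Bd_sets" "source_weight A m = 1" "target_weight A m = 1"
proof -
  have "(INF A\<in>Bd_sets. d m (f A)) < 2 * gap m" using assms by (simp add: gap_def)
  then obtain A where "A \<in> Bd_sets" "d m (f A) < 2 * gap m"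
    using cInf_lessD[of "(\<lambda>A. d m (f A)) ` Bd_sets"] Bd_sets_UNIV_nonempty by auto
  moreover then have "d m (f A) / gap m \<le> 2" using assms by (simp add: divide_simps)
  ultimately show ?thesis
    by (intro that[of A]) (simp_all add: source_weight_def target_weight_def cutoff_eq_1)
qed

lemma source_imp_target: "0 < source_weight A m \<Longrightarrow> target_weight A m = 1"
  by (simp add: source_weight_def target_weight_def cutoff_pos_iff cutoff_eq_1)

lemma target_weight_pos_imp: "0 < gap m \<Longrightarrow> 0 < target_weight A m \<Longrightarrow> d m (f A) < 4 * gap m"
  by (simp add: target_weight_def cutoff_pos_iff divide_simps)

text \<open>
  Sets whose images lie in one ball of \<open>M\<close> have bounded Hausdorff distance from each other, so one bounded
  set contains all of them and the trails between their points are uniform.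
\<close>

lemma bounded_region:
  assumes "m \<in> M"
  obtains S where "bounded S" "\<And>A. A \<in> Bd_sets \<Longrightarrow> d m (f A) < \<rho> \<Longrightarrow> A \<subseteq> S"
proof (cases "\<exists>A\<in>Bd_sets. d m (f A) < \<rho>")
  case True
  then obtain A0 where A0: "A0 \<in> Bd_sets" "d m (f A0) < \<rho>" by blast
  define S where "S = {x. \<exists>a\<in>A0. dist a x \<le> 2 * \<rho>}"
  have "bounded S"
    unfolding S_def using Bd_sets_bounded[OF A0(1)] by (rule bounded_neighbourhood)
  moreover have "A \<subseteq> S" if A: "A \<in> Bd_sets" "d m (f A) < \<rho>" for A
  proof
    fix x assume "x \<in> A"
    have "hausdorff_dist A A0 < 2 * \<rho>"
      using triangle[OF f_in[OF A(1)] assms f_in[OF A0(1)]] A A0 f_isometry[OF A(1) A0(1)]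
      by (simp add: commute)
    then obtain a where "a \<in> A0" "dist x a < 2 * \<rho>"
      using hausdorff_dist_near[OF A(1) A0(1) _ \<open>x \<in> A\<close>] by blast
    then show "x \<in> S" unfolding S_def by (auto simp: dist_commute intro: less_imp_le)
  qed
  ultimately show ?thesis by (rule that)
next
  case False
  then show ?thesis by (intro that[of "{}"]) auto
qed

text \<open>
  By the trail from \<open>a\<close> to itself at time \<open>0\<close>.
\<close>

lemma source_subset_cloud:
  assumes "A \<in> Bd_sets" "0 < source_weight A m"
  shows "A \<subseteq> cloud m"
proof
  fix a assume a: "a \<in> A"
  have "(a, 0) \<in> L a a"
    using trail_system_start[OF trails[of "{a}"]] by simp
  then show "a \<in> cloud m"
    unfolding cloud_def using assms a source_imp_target[OF assms(2)]
    by (intro CollectI exI[of _ A] exI[of _ a] exI[of _ 0]) (auto simp: hausdorff_dist_self)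
qed

lemma cloud_nonempty: "0 < gap m \<Longrightarrow> cloud m \<noteq> {}"
  using exists_source[of m] source_subset_cloud[of _ m] Bd_sets_nonempty
  by (metis subset_empty zero_less_one)

lemma cloudE:
  assumes "p \<in> cloud m"
  obtains A B a b s where "A \<in> Bd_sets" "B \<in> Bd_sets" "a \<in> A" "b \<in> B"
     "0 < source_weight A m" "0 < target_weight B m" "dist a b \<le> 2 * hausdorff_dist A B"
     "(p, s) \<in> L a b" "s \<le> source_weight A m * target_weight B m"
  using assms unfolding cloud_def by blast

lemma cloud_bounded:
  assumes "m \<in> M" "0 < gap m"
  shows "bounded (cloud m)"
proof -
  obtain S where S: "bounded S" "\<And>A. A \<in> Bd_sets \<Longrightarrow> d m (f A) < 4 * gap m \<Longrightarrow> A \<subseteq> S"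
    by (rule bounded_region[OF assms(1), of "4 * gap m"]) blast
  obtain R where R: "\<forall>a\<in>S. \<forall>b\<in>S. \<forall>(p, s)\<in>L a b. dist a p \<le> R"
    using trail_system_bounded[OF trails[OF S(1)]] by blast
  have "cloud m \<subseteq> {x. \<exists>a\<in>S. dist a x \<le> R}"
  proof
    fix p assume "p \<in> cloud m"
    then obtain A B a b s where p: "A \<in> Bd_sets" "B \<in> Bd_sets" "a \<in> A" "b \<in> B"
     "0 < source_weight A m" "0 < target_weight B m" "(p, s) \<in> L a b"
      by (rule cloudE) blast
    have "0 < target_weight A m" using source_imp_target[OF p(5)] by simp
    then have "A \<subseteq> S" "B \<subseteq> S"
      using p(1,2,6) S(2) target_weight_pos_imp[OF assms(2)] by blast+
    then have "dist a p \<le> R" "a \<in> S" using R p by blast+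
    then show "p \<in> {x. \<exists>a\<in>S. dist a x \<le> R}" by blast
  qed
  then show ?thesis using bounded_neighbourhood[OF S(1)] bounded_subset by blast
qed

lemma retract_set_image: "A \<in> Bd_sets \<Longrightarrow> retract_set (f A) = A"
proof -
  have "inj_on f Bd_sets"
  proof (rule inj_onI)
    fix A B :: "'a set" assume AB: "A \<in> Bd_sets" "B \<in> Bd_sets" "f A = f B"
    then have "hausdorff_dist A B = 0" using f_isometry[OF AB(1,2)] f_in by simp
    then show "A = B" using hausdorff_dist_eq_0[OF AB(1,2)] by simp
  qed
  then show "A \<in> Bd_sets \<Longrightarrow> retract_set (f A) = A"
    by (simp add: retract_set_def)
qed

lemma retract_set_in: "m \<in> M \<Longrightarrow> retract_set m \<in> Bd_sets"
  using cloud_nonempty cloud_bounded gap_pos retract_set_image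
  by (cases "m \<in> f ` Bd_sets") (auto simp: retract_set_def[of m] intro!: closure_in_Bd_sets inv_into_into)

text \<open>
  The heart of the construction. Let \<open>p\<close> lie on a trail from \<open>a \<in> A\<close> to \<open>b \<in> B\<close> at time \<open>s\<close>. If \<open>A\<close>
  and \<open>B\<close> keep positive weights, going back slightly on the same trail suffices. Otherwise the
  product of the weights at \<open>m\<close> was small, so \<open>s\<close> is small and \<open>p\<close> is near \<open>a\<close>. If \<open>A\<close> is still
  a source, \<open>a\<close> itself is in the new cloud. If not, \<open>A\<close> was nearly no source before, so it is still
  a target of nearly full weight, and a trail from a set \<open>K\<close> of full source weight comes close to \<open>a\<close>.
\<close>

lemma cloud_approx:
  assumes S: "bounded S" "\<And>A. A \<in> Bd_sets \<Longrightarrow> 0 < target_weight A m \<or> 0 < target_weight A m' \<Longrightarrow> A \<subseteq> S"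
    and \<zeta>: "\<forall>a\<in>S. \<forall>b\<in>S. \<forall>(p, s)\<in>L a b. \<forall>v\<ge>0. s - v < \<zeta> \<longrightarrow> (\<exists>(q, t)\<in>L a b. t \<le> v \<and> dist p q < \<epsilon>)"
    and "\<zeta> \<le> 1" "0 < gap m'"
    and close: "\<And>A. A \<in> Bd_sets \<Longrightarrow> \<bar>source_weight A m - source_weight A m'\<bar> < \<zeta>/2"
      "\<And>A. A \<in> Bd_sets \<Longrightarrow> \<bar>target_weight A m - target_weight A m'\<bar> < \<zeta>/2"
    and "p \<in> cloud m"
  shows "\<exists>q\<in>cloud m'. dist p q \<le> 2 * \<epsilon>"
proof -
  obtain A B a b s where A: "A \<in> Bd_sets" "a \<in> A" "0 < source_weight A m"
    and B: "B \<in> Bd_sets" "b \<in> B" "0 < target_weight B m"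
    and ab: "dist a b \<le> 2 * hausdorff_dist A B" "(p, s) \<in> L a b"
      "s \<le> source_weight A m * target_weight B m"
    using \<open>p \<in> cloud m\<close> by (rule cloudE) blast
  have weights: "0 \<le> source_weight C x" "source_weight C x \<le> 1" "0 \<le> target_weight C x" "target_weight C x \<le> 1" for C x
    by (simp_all add: source_weight_def target_weight_def cutoff_bounds)
  have A1: "target_weight A m = 1" using A(3) by (rule source_imp_target)
  have "a \<in> S" "b \<in> S" using S(2)[of A] S(2)[of B] A B A1 by auto
  have retreat: "\<exists>q t. (q, t) \<in> L x y \<and> t \<le> v \<and> dist p' q < \<epsilon>"
    if "x \<in> S" "y \<in> S" "(p', s') \<in> L x y" "v \<ge> 0" "s' - v < \<zeta>" for x y p' s' v
    using \<zeta> that by blast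
  note T = trails[OF S(1)]
  have near_a: "dist p a < \<epsilon>" if s: "s < \<zeta>"
  proof -
    obtain q t where "(q, t) \<in> L a b" "t \<le> 0" "dist p q < \<epsilon>"
      using retreat[OF \<open>a \<in> S\<close> \<open>b \<in> S\<close> ab(2), of 0] s by auto
    then show ?thesis using trail_system_0[OF T \<open>a \<in> S\<close> \<open>b \<in> S\<close>] by blast
  qed
  have \<epsilon>: "\<epsilon> > 0"
  proof -
    have "\<zeta> > 0" using close(1)[OF A(1)] by linarith
    then obtain q t where "dist a q < \<epsilon>"
      using retreat[OF \<open>a \<in> S\<close> \<open>a \<in> S\<close> trail_system_start[OF T \<open>a \<in> S\<close> \<open>a \<in> S\<close>], of 0] by auto
    then show ?thesis using zero_le_dist[of a q] by linarith
  qed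
  consider (both) "0 < source_weight A m'" "0 < target_weight B m'"
    | (source) "0 < source_weight A m'" "target_weight B m' = 0"
    | (none) "source_weight A m' = 0"
    using weights[of A m'] weights[of B m'] by linarith
  then show ?thesis
  proof cases
    case both
    let ?u = "source_weight A m * target_weight B m" and ?v = "source_weight A m' * target_weight B m'"
    have "?u - ?v = (source_weight A m - source_weight A m') * target_weight B m
        + source_weight A m' * (target_weight B m - target_weight B m')"
      by (simp add: algebra_simps)
    also have "\<dots> \<le> \<bar>source_weight A m - source_weight A m'\<bar> * 1 + 1 * \<bar>target_weight B m - target_weight B m'\<bar>"
    proof (rule add_mono)
      show "(source_weight A m - source_weight A m') * target_weight B m \<le> \<bar>source_weight A m - source_weight A m'\<bar> * 1"
        using weights by (intro mult_mono) auto
      have "source_weight A m' * (target_weight B m - target_weight B m')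
          \<le> source_weight A m' * \<bar>target_weight B m - target_weight B m'\<bar>"
        using weights by (intro mult_left_mono) auto
      also have "\<dots> \<le> 1 * \<bar>target_weight B m - target_weight B m'\<bar>"
        using weights by (intro mult_right_mono) auto
      finally show "source_weight A m' * (target_weight B m - target_weight B m')
          \<le> 1 * \<bar>target_weight B m - target_weight B m'\<bar>" .
    qed
    also have "\<dots> < \<zeta>"
      unfolding mult_1 mult_1_right using close(1)[OF A(1)] close(2)[OF B(1)] by linarith
    finally have "s - ?v < \<zeta>" using ab(3) by linarith
    moreover have "0 \<le> ?v" using weights by simp
    ultimately obtain q t where "(q, t) \<in> L a b" "t \<le> ?v" "dist p q < \<epsilon>"
      using retreat[OF \<open>a \<in> S\<close> \<open>b \<in> S\<close> ab(2), of ?v] by blast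
    moreover then have "q \<in> cloud m'"
      unfolding cloud_def using A B ab both by blast
    ultimately show ?thesis using \<epsilon> by (intro bexI[of _ q]) auto
  next
    case source
    have "target_weight B m < \<zeta>" using close(2)[OF B(1)] source(2) by linarith
    moreover have "s \<le> 1 * target_weight B m"
      using ab(3) weights mult_right_mono[of "source_weight A m" 1 "target_weight B m"] by (meson order_trans)
    ultimately have "dist p a < \<epsilon>" using near_a by linarith
    moreover have "a \<in> cloud m'" using source_subset_cloud[OF A(1) source(1)] A(2) by blast
    ultimately show ?thesis using \<epsilon> by (intro bexI[of _ a]) auto
  next
    case none
    have "source_weight A m < \<zeta>" using close(1)[OF A(1)] none by linarith
    moreover have "s \<le> source_weight A m * 1"
      using ab(3) weights mult_left_mono[of "target_weight B m" 1 "source_weight A m"] by (meson order_trans)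
    ultimately have "dist p a < \<epsilon>" using near_a by linarith
    (* A is still fully covered by trails that start at a set of full source weight *)
    have A': "target_weight A m' > 1 - \<zeta>/2" using close(2)[OF A(1)] A1 by linarith
    then have "target_weight A m' > 0" using \<open>\<zeta> \<le> 1\<close> by linarith
    obtain K where K: "K \<in> Bd_sets" "source_weight K m' = 1" "target_weight K m' = 1"
      using exists_source[OF \<open>0 < gap m'\<close>] by blast
    obtain k where k: "k \<in> K" "dist k a \<le> 2 * hausdorff_dist K A"
      using hausdorff_dist_witness[OF K(1) A(1,2)] by blast
    have "k \<in> S" using S(2)[OF K(1)] K(3) k(1) by auto
    have "1 - target_weight A m' < \<zeta>" using A' close(1)[OF A(1)] by linarith
    then obtain q t where q: "(q, t) \<in> L k a" "t \<le> target_weight A m'" "dist a q < \<epsilon>"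
      using retreat[OF \<open>k \<in> S\<close> \<open>a \<in> S\<close> trail_system_end[OF T \<open>k \<in> S\<close> \<open>a \<in> S\<close>], of "target_weight A m'"] weights by blast
    have "q \<in> cloud m'"
      unfolding cloud_def using K A k q \<open>target_weight A m' > 0\<close>
      by (intro CollectI exI[of _ K] exI[of _ A] exI[of _ k] exI[of _ a] exI[of _ t]) auto
    moreover have "dist p q \<le> 2 * \<epsilon>"
      using \<open>dist p a < \<epsilon>\<close> q(3) dist_triangle[of p q a] by linarith
    ultimately show ?thesis by blast
  qed
qed

text \<open>
  Near \<open>m\<close> all weights change by little, uniformly over the hyperspace, and both clouds approximate each
  other. For \<open>d m m' \<le> D/2\<close> the gap at \<open>m'\<close> is at most \<open>3/2 D\<close>, so active sets have distance at most
  \<open>6 D + D/2\<close> from \<open>m\<close>; hence the region of radius \<open>8 D\<close>.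
\<close>

lemma continuous_off_image:
  assumes m: "m \<in> M" "m \<notin> f ` Bd_sets" and "\<epsilon> > 0"
  shows "\<exists>\<delta>>0. \<forall>m'\<in>M. d m m' < \<delta> \<longrightarrow> hausdorff_dist (retract_set m) (retract_set m') < \<epsilon>"
proof -
  define D where "D = gap m"
  have "D > 0" unfolding D_def by (rule gap_pos[OF m])
  obtain S where S: "bounded S" "\<And>A. A \<in> Bd_sets \<Longrightarrow> d m (f A) < 8 * D \<Longrightarrow> A \<subseteq> S"
    by (rule bounded_region[OF m(1), of "8 * D"]) blast
  have "\<epsilon>/3 > 0" using \<open>\<epsilon> > 0\<close> by simp
  then obtain \<zeta>0 where "\<zeta>0 > 0" and \<zeta>0: "\<forall>a\<in>S. \<forall>b\<in>S. \<forall>(p, s)\<in>L a b. \<forall>v\<ge>0. s - v < \<zeta>0 \<longrightarrow>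
      (\<exists>(q, t)\<in>L a b. t \<le> v \<and> dist p q < \<epsilon>/3)"
    using trail_system_back[OF trails[OF S(1)]] by meson
  define \<zeta> where "\<zeta> = min \<zeta>0 1"
  have "\<zeta> > 0" "\<zeta> \<le> 1" "\<zeta> \<le> \<zeta>0" using \<open>\<zeta>0 > 0\<close> by (auto simp: \<zeta>_def)
  have \<zeta>: "\<forall>a\<in>S. \<forall>b\<in>S. \<forall>(p, s)\<in>L a b. \<forall>v\<ge>0. s - v < \<zeta> \<longrightarrow> (\<exists>(q, t)\<in>L a b. t \<le> v \<and> dist p q < \<epsilon>/3)"
    using \<zeta>0 less_le_trans[OF _ \<open>\<zeta> \<le> \<zeta>0\<close>] by blast
  define \<delta> where "\<delta> = min (D/2) (D * \<zeta> / 20)"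
  have "\<delta> > 0" using \<open>D > 0\<close> \<open>\<zeta> > 0\<close> by (simp add: \<delta>_def)
  have "hausdorff_dist (retract_set m) (retract_set m') < \<epsilon>" if m': "m' \<in> M" "d m m' < \<delta>" for m'
  proof -
    define E where "E = gap m'"
    have DE: "\<bar>D - E\<bar> \<le> d m m'" unfolding D_def E_def by (rule gap_lipschitz[OF m(1) m'(1)])
    have e: "d m m' \<le> D/2" "10 * d m m' / D < \<zeta>/2"
    proof -
      have "d m m' < D * \<zeta> / 20" "d m m' < D / 2" using m'(2) by (simp_all add: \<delta>_def)
      then show "d m m' \<le> D/2" "10 * d m m' / D < \<zeta>/2" using \<open>D > 0\<close> \<open>\<zeta> > 0\<close> by (simp_all add: field_simps)
    qed
    have E: "E > 0" "E \<le> 3 * D / 2" using DE e(1) \<open>D > 0\<close> by linarith+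
    have "m' \<notin> f ` Bd_sets"
    proof
      assume "m' \<in> f ` Bd_sets"
      then obtain A where "A \<in> Bd_sets" "m' = f A" by blast
      then have "E \<le> 0" using gap_le[of A m'] m'(1) by (simp add: E_def)
      then show False using E(1) by simp
    qed
    then have eq: "retract_set m = closure (cloud m)" "retract_set m' = closure (cloud m')"
      using m(2) by (simp_all add: retract_set_def)
    have dd: "\<bar>d m (f A) - d m' (f A)\<bar> \<le> d m m'" if "A \<in> Bd_sets" for A
      using triangle[OF m(1) m'(1) f_in[OF that]] triangle[OF m'(1) m(1) f_in[OF that]] by (simp add: commute)
    have weight_diff: "\<bar>source_weight A m - source_weight A m'\<bar> < \<zeta>/2"
      "\<bar>target_weight A m - target_weight A m'\<bar> < \<zeta>/2" if "A \<in> Bd_sets" for A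
      using cutoff_quotient_diff[OF dd[OF that] DE e(1) \<open>D > 0\<close>, of 3]
        cutoff_quotient_diff[OF dd[OF that] DE e(1) \<open>D > 0\<close>, of 4] e(2)
      by (simp_all add: source_weight_def target_weight_def D_def E_def)
    have active: "A \<subseteq> S" if A: "A \<in> Bd_sets" "0 < target_weight A m \<or> 0 < target_weight A m'" for A
    proof (rule S(2)[OF A(1)])
      have "d m (f A) < 4 * D \<or> d m' (f A) < 4 * E"
        using A(2) target_weight_pos_imp[of m A] target_weight_pos_imp[of m' A] \<open>D > 0\<close> E(1)
        by (auto simp: D_def E_def)
      then show "d m (f A) < 8 * D" using dd[OF A(1)] e(1) E(2) \<open>D > 0\<close> by linarith
    qed
    have "hausdorff_dist (closure (cloud m)) (closure (cloud m')) \<le> 2 * (\<epsilon>/3)"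
    proof (rule hausdorff_dist_closure_le)
      show "cloud m \<noteq> {}" "cloud m' \<noteq> {}"
        using cloud_nonempty \<open>D > 0\<close> E(1) by (auto simp: D_def E_def)
      show "\<exists>q\<in>cloud m'. dist p q \<le> 2 * (\<epsilon>/3)" if "p \<in> cloud m" for p
        using E(1) unfolding E_def
        by (intro cloud_approx[OF S(1) active \<zeta> \<open>\<zeta> \<le> 1\<close> _ weight_diff that]) auto
      show "\<exists>p\<in>cloud m. dist q p \<le> 2 * (\<epsilon>/3)" if "q \<in> cloud m'" for q
        using \<open>D > 0\<close> weight_diff unfolding D_def
        by (intro cloud_approx[OF S(1) active \<zeta> \<open>\<zeta> \<le> 1\<close> _ _ _ that]) (auto simp: abs_minus_commute)
    qed
    then show ?thesis unfolding eq using \<open>\<epsilon> > 0\<close> by linarith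
  qed
  then show ?thesis using \<open>\<delta> > 0\<close> by blast
qed

text \<open>
  If \<open>m'\<close> is within \<open>\<delta>\<close> of \<open>f A0\<close>, the gap is less than \<open>\<delta>\<close> and all active sets are within
  \<open>5 \<delta>\<close> of \<open>A0\<close>. Their pairs of points joined by trails have distance less than \<open>20 \<delta>\<close>, so
  the trails are small.
\<close>

lemma continuous_on_image:
  assumes A0: "A0 \<in> Bd_sets" and "\<epsilon> > 0"
  shows "\<exists>\<delta>>0. \<forall>m'\<in>M. d (f A0) m' < \<delta> \<longrightarrow> hausdorff_dist (retract_set (f A0)) (retract_set m') < \<epsilon>"
proof -
  have m: "f A0 \<in> M" using A0 by (rule f_in)
  obtain S where S: "bounded S" "\<And>A. A \<in> Bd_sets \<Longrightarrow> d (f A0) (f A) < 5 \<Longrightarrow> A \<subseteq> S"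
    by (rule bounded_region[OF m, of 5]) blast
  have "\<epsilon>/3 > 0" using \<open>\<epsilon> > 0\<close> by simp
  then obtain \<delta>0 where "\<delta>0 > 0" and \<delta>0: "\<forall>a\<in>S. \<forall>b\<in>S. dist a b < \<delta>0 \<longrightarrow> (\<forall>(p, s)\<in>L a b. dist a p < \<epsilon>/3)"
    using trail_system_small[OF trails[OF S(1)]] by meson
  define \<delta> where "\<delta> = Min {1, \<epsilon>/15, \<delta>0/20}"
  have \<delta>: "\<delta> > 0" "\<delta> \<le> 1" "\<delta> \<le> \<epsilon>/15" "\<delta> \<le> \<delta>0/20" using \<open>\<delta>0 > 0\<close> \<open>\<epsilon> > 0\<close> by (auto simp: \<delta>_def)
  have "hausdorff_dist A0 (retract_set m') < \<epsilon>" if m': "m' \<in> M" "d (f A0) m' < \<delta>" for m'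
  proof (cases "m' \<in> f ` Bd_sets")
    case True
    then obtain A where A: "A \<in> Bd_sets" "m' = f A" by blast
    then have "hausdorff_dist A0 A < \<delta>" using m'(2) f_isometry[OF A0 A(1)] by simp
    then show ?thesis using A \<delta>(3) \<open>\<epsilon> > 0\<close> by (simp add: retract_set_image)
  next
    case False
    define E where "E = gap m'"
    have "E > 0" unfolding E_def by (rule gap_pos[OF m'(1) False])
    have "E < \<delta>" using gap_le[OF A0, of m'] m'(2) by (simp add: E_def commute)
    have active: "hausdorff_dist A0 A < 5 * \<delta> \<and> A \<subseteq> S" if A: "A \<in> Bd_sets" "0 < target_weight A m'" for A
    proof -
      have "d m' (f A) < 4 * E" using target_weight_pos_imp[of m' A] A(2) \<open>E > 0\<close> by (simp add: E_def)
      then have "d (f A0) (f A) < 5 * \<delta>"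
        using triangle[OF m m'(1) f_in[OF A(1)]] m'(2) \<open>E < \<delta>\<close> by linarith
      then show ?thesis using S(2)[OF A(1)] \<delta>(2) f_isometry[OF A0 A(1)] by simp
    qed
    have "hausdorff_dist (closure A0) (closure (cloud m')) \<le> 2 * \<epsilon> / 3"
    proof (rule hausdorff_dist_closure_le)
      show "A0 \<noteq> {}" using A0 by (rule Bd_sets_nonempty)
      show "cloud m' \<noteq> {}" using cloud_nonempty \<open>E > 0\<close> by (simp add: E_def)
      show "\<exists>q\<in>cloud m'. dist p q \<le> 2 * \<epsilon> / 3" if "p \<in> A0" for p
      proof -
        obtain K where K: "K \<in> Bd_sets" "source_weight K m' = 1" "target_weight K m' = 1"
          using exists_source[of m'] \<open>E > 0\<close> by (auto simp: E_def)
        have "hausdorff_dist A0 K < 5 * \<delta>" using active[OF K(1)] K(3) by simp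
        then obtain k where "k \<in> K" "dist p k < 5 * \<delta>"
          using hausdorff_dist_near[OF A0 K(1) _ \<open>p \<in> A0\<close>] by blast
        moreover have "K \<subseteq> cloud m'" using source_subset_cloud[OF K(1)] K(2) by simp
        ultimately show ?thesis using \<delta>(3) \<open>\<epsilon> > 0\<close> by (intro bexI[of _ k]) auto
      qed
      show "\<exists>p\<in>A0. dist q p \<le> 2 * \<epsilon> / 3" if "q \<in> cloud m'" for q
      proof -
        obtain A B a b s where A: "A \<in> Bd_sets" "a \<in> A" "0 < source_weight A m'"
          and B: "B \<in> Bd_sets" "b \<in> B" "0 < target_weight B m'"
          and ab: "dist a b \<le> 2 * hausdorff_dist A B" "(q, s) \<in> L a b"
          using \<open>q \<in> cloud m'\<close> by (rule cloudE) blast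
        have A': "hausdorff_dist A0 A < 5 * \<delta>" "a \<in> S"
          using active[OF A(1)] source_imp_target[OF A(3)] A(2) by auto
        have B': "hausdorff_dist A0 B < 5 * \<delta>" "b \<in> S"
          using active[OF B(1,3)] B(2) by auto
        have "hausdorff_dist A B < 10 * \<delta>"
          using hausdorff_dist_triangle[OF A(1) A0 B(1)] A' B' by (simp add: hausdorff_dist_commute)
        then have "dist a b < \<delta>0" using ab(1) \<delta>(4) by linarith
        then have "dist a q < \<epsilon>/3" using \<delta>0 A'(2) B'(2) ab(2) by blast
        moreover obtain p where "p \<in> A0" "dist a p < 5 * \<delta>"
          using hausdorff_dist_near[OF A(1) A0 _ A(2)] A'(1) by (metis hausdorff_dist_commute)
        ultimately show ?thesis
          using dist_triangle3[of q p a] \<delta>(3) by (intro bexI[of _ p]) auto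
      qed
    qed
    moreover have "closure A0 = A0" using A0 by (simp add: Bd_sets_def)
    ultimately show ?thesis using False \<open>\<epsilon> > 0\<close> by (simp add: retract_set_def)
  qed
  then show ?thesis using \<delta>(1) A0 by (auto simp: retract_set_image)
qed

proposition image_retract_of_space: "f ` Bd_sets retract_of_space mtopology"
proof -
  have cont: "\<exists>\<delta>>0. \<forall>m'. m' \<in> M \<and> d m m' < \<delta> \<longrightarrow> d (f (retract_set m)) (f (retract_set m')) < \<epsilon>"
    if m: "m \<in> M" and "\<epsilon> > 0" for m \<epsilon>
  proof -
    have "\<exists>\<delta>>0. \<forall>m'\<in>M. d m m' < \<delta> \<longrightarrow> hausdorff_dist (retract_set m) (retract_set m') < \<epsilon>"
      using continuous_on_image[OF _ \<open>\<epsilon> > 0\<close>] continuous_off_image[OF m _ \<open>\<epsilon> > 0\<close>] by blast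
    then show ?thesis using f_isometry retract_set_in m by metis
  qed
  then have "continuous_map mtopology mtopology (f \<circ> retract_set)"
    using metric_continuous_map[OF Metric_space_axioms, of "f \<circ> retract_set"] f_in retract_set_in
    by (auto simp: o_def)
  moreover have "(f \<circ> retract_set) \<in> M \<rightarrow> f ` Bd_sets" using retract_set_in by auto
  ultimately have "continuous_map mtopology (subtopology mtopology (f ` Bd_sets)) (f \<circ> retract_set)"
    by (auto simp: continuous_map_in_subtopology)
  moreover have "(f \<circ> retract_set) x = x" if "x \<in> f ` Bd_sets" for x
    using that by (auto simp: retract_set_image)
  ultimately show ?thesis
    unfolding retract_of_space_def using f_in by auto
qed

end

proposition trails_imp_absolute_retract:
  assumes "\<And>S :: 'a::metric_space set. bounded S \<Longrightarrow> trail_system S L"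
  shows "absolute_retract_among TYPE('m) (Bd :: 'a set metric)"
  unfolding absolute_retract_among_def mspace_Bd
proof (intro allI impI, elim conjE)
  fix N :: "'m metric" and f :: "'a set \<Rightarrow> 'm"
  assume f: "f \<in> Bd_sets \<rightarrow> mspace N" "\<forall>x\<in>Bd_sets. \<forall>y\<in>Bd_sets. mdist N (f x) (f y) = mdist Bd x y"
    "closedin (mtopology_of N) (f ` Bd_sets)"
  interpret hyperspace_embedding "mspace N" "mdist N" f L
  proof (intro hyperspace_embedding.intro hyperspace_embedding_axioms.intro)
    show "Metric_space (mspace N) (mdist N)" by (rule Metric_space_mspace_mdist)
    show "f A \<in> mspace N" if "A \<in> Bd_sets" for A using f(1) that by blast
    show "mdist N (f A) (f B) = hausdorff_dist A B" if "A \<in> Bd_sets" "B \<in> Bd_sets" for A B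
      using f(2) that by (simp add: mdist_Bd)
    show "closedin (Metric_space.mtopology (mspace N) (mdist N)) (f ` Bd_sets)"
      using f(3) by (simp add: mtopology_of_def)
    show "trail_system S L" if "bounded S" for S using assms that .
  qed
  show "f ` Bd_sets retract_of_space mtopology_of N"
    using image_retract_of_space by (simp add: mtopology_of_def)
qed

section \<open>The characterization\<close>

theorem theorem4:
  shows "absolute_retract TYPE('m) (Bd :: 'a::metric_space set metric) \<longleftrightarrow>
    (\<forall>S::'a set. bounded S \<longrightarrow> (\<exists>Y. S \<subseteq> Y \<and> bounded Y \<and> chain_equi_connected Y)) \<and>
    (\<forall>S::'a set. bounded S \<longrightarrow> unif_locally_chain_equi_connected_at (UNIV::'a set) S)"
proof (intro iffI conjI allI impI)
  assume "absolute_retract TYPE('m) (Bd :: 'a set metric)"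
  then have AR: "absolute_retract_among TYPE('a set \<Rightarrow> real) (Bd :: 'a set metric)"
    by (simp add: absolute_retract_def)
  fix S :: "'a set" assume S: "bounded S"
  show "\<exists>Y. S \<subseteq> Y \<and> bounded Y \<and> chain_equi_connected Y"
    by (rule absolute_retract_imp_chain_equi_connected[OF AR S]) blast
  show "unif_locally_chain_equi_connected_at (UNIV :: 'a set) S"
    by (rule absolute_retract_imp_unif_locally_chain_equi_connected[OF AR S])
next
  assume *: "(\<forall>S::'a set. bounded S \<longrightarrow> (\<exists>Y. S \<subseteq> Y \<and> bounded Y \<and> chain_equi_connected Y)) \<and>
    (\<forall>S::'a set. bounded S \<longrightarrow> unif_locally_chain_equi_connected_at (UNIV::'a set) S)"
  obtain L :: "'a \<Rightarrow> 'a \<Rightarrow> ('a \<times> real) set" where L: "\<And>S. bounded S \<Longrightarrow> trail_system S L"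
    using trail_system_exists * by metis
  show "absolute_retract TYPE('m) (Bd :: 'a set metric)"
    unfolding absolute_retract_def by (intro conjI trails_imp_absolute_retract[where L = L] L)
qed

end
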